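(* Let $r>1$, $\varepsilon>0$ and $b>\frac1r$. Then there is a constant $C$ depending only on $r,\varepsilon,b$ such that for all $u_1,u_2,u_3\in X^{0,b}_r$ $$\|C_1(u_1,u_2,u_3)\|_{X^{0,-\varepsilon}_r}\le C\prod_{i=1}^3\|u_i\|_{X^{0,b}_r}.$$
   Context: $\mathbb T=\mathbb R/2\pi\mathbb Z$, $\langle\xi\rangle=(1+\xi^2)^{1/2}$. For functions $u(t,x)$ on $\mathbb R\times\mathbb T$, $\widehat u(\xi)$ denotes the partial Fourier transform in $x$, $\widehat f(\xi)=\frac{1}{\sqrt{2\pi}}\int_0^{2\pi}f(x)e^{-ix\xi}dx$, $\xi\in\mathbb Z$ ($t$ suppressed), and $\mathcal Fu(\tau,\xi)$ the Fourier transform in both variables. With $\frac1r+\frac1{r'}=1$, $X^{s,b}_r$ is the completion of the space of smooth functions on $\mathbb R\times\mathbb T$ that are, together with all derivatives, rapidly decreasing in $t$, with respect to the norm $$\|u\|_{X^{s,b}_r}=\|\langle\xi\rangle^s\langle\tau+\xi^2\rangle^b\mathcal Fu(\tau,\xi)\|_{\ell^{r'}_\xi L^{r'}_\tau}.$$ The trilinear operator $C_1$ is defined by $$\widehat{C_1(u_1,u_2,u_3)}(\xi)=(2\pi)^{-1}\sum_{\substack{\xi=\xi_1+\xi_2+\xi_3\\ \xi_1\ne\xi,\ \xi_2\neq\xi}}\widehat u_1(\xi_1)\widehat u_2(\xi_2)\widehat{\overline{u}}_3(\xi_3),\qquad \xi_i\in\mathbb Z.$$ *)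

theory Defs
  imports "HOL-Analysis.Analysis"
begin

text \<open>
  Functions on \<open>\<real> \<times> \<T>\<close> with \<open>\<T> = \<real>/2\<pi>\<int>\<close> are functions of \<open>(t, x) \<in> \<real> \<times> \<real>\<close> that are
  \<open>2\<pi>\<close>-periodic in \<open>x\<close>.
\<close>

type_synonym st_fun = "real \<times> real \<Rightarrow> complex"

inductive_set partials :: "st_fun \<Rightarrow> st_fun set" for u :: st_fun where
  self: "u \<in> partials u"
| dt: "v \<in> partials u \<Longrightarrow> (\<lambda>p. frechet_derivative v (at p) (1, 0)) \<in> partials u"
| dx: "v \<in> partials u \<Longrightarrow> (\<lambda>p. frechet_derivative v (at p) (0, 1)) \<in> partials u"

text \<open>
  Joint differentiability of every iterated partial derivative amounts to \<open>C\<^sup>\<infinity>\<close>; it also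
  ensures that \<^const>\<open>frechet_derivative\<close> denotes the actual derivative.
\<close>

definition test_fun :: "st_fun \<Rightarrow> bool" where
  "test_fun u \<longleftrightarrow>
     (\<forall>t x. u (t, x + 2 * pi) = u (t, x)) \<and>
     (\<forall>v \<in> partials u.
        (\<forall>p. v differentiable (at p)) \<and>
        (\<forall>N::nat. bounded (range (\<lambda>(t, x). \<bar>t\<bar> ^ N *\<^sub>R v (t, x)))))"

definition fourier_x :: "(real \<Rightarrow> complex) \<Rightarrow> int \<Rightarrow> complex" where
  "fourier_x f \<xi> =
     1 / sqrt (2 * pi) * (LINT x:{0..2 * pi}|lborel. f x * cis (- (x * of_int \<xi>)))"

definition fourier_tx :: "st_fun \<Rightarrow> real \<Rightarrow> int \<Rightarrow> complex" where
  "fourier_tx u \<tau> \<xi> =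
     1 / sqrt (2 * pi) * (LINT t|lborel. fourier_x (\<lambda>x. u (t, x)) \<xi> * cis (- (t * \<tau>)))"

definition bracket :: "real \<Rightarrow> real" where
  "bracket y = sqrt (1 + y\<^sup>2)"

definition conj_exponent :: "real \<Rightarrow> real" where
  "conj_exponent r = r / (r - 1)"

text \<open>
  The \<open>\<ell>\<^sup>p\<^sub>\<xi> L\<^sup>p\<^sub>\<tau>\<close> norm with \<open>p = r'\<close>. It is applied to test functions only; for these the
  integral is finite, so that \<^const>\<open>enn2real\<close> loses no information.
\<close>

definition pre_norm :: "real \<Rightarrow> real \<Rightarrow> real \<Rightarrow> st_fun \<Rightarrow> real" where
  "pre_norm r s b u =
     enn2real (\<integral>\<^sup>+ \<xi>. (\<integral>\<^sup>+ \<tau>.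
        ennreal ((bracket (of_int \<xi>) powr s * bracket (\<tau> + (of_int \<xi>)\<^sup>2) powr b
                   * cmod (fourier_tx u \<tau> \<xi>)) powr conj_exponent r)
        \<partial>lborel) \<partial>count_space (UNIV :: int set))
     powr (1 / conj_exponent r)"

text \<open>
  The completion \<open>X\<^sup>s\<^sup>,\<^sup>b\<^sub>r\<close>: Cauchy sequences of test functions modulo null sequences.
\<close>

definition X_cauchy :: "real \<Rightarrow> real \<Rightarrow> real \<Rightarrow> (nat \<Rightarrow> st_fun) set" where
  "X_cauchy r s b =
     {u. (\<forall>n. test_fun (u n)) \<and>
         (\<forall>e>0. \<exists>N. \<forall>m\<ge>N. \<forall>n\<ge>N. pre_norm r s b (\<lambda>p. u m p - u n p) < e)}"

definition X_equiv :: "real \<Rightarrow> real \<Rightarrow> real \<Rightarrow> ((nat \<Rightarrow> st_fun) \<times> (nat \<Rightarrow> st_fun)) set" where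
  "X_equiv r s b =
     {(u, v). u \<in> X_cauchy r s b \<and> v \<in> X_cauchy r s b \<and>
              (\<lambda>n. pre_norm r s b (\<lambda>p. u n p - v n p)) \<longlonglongrightarrow> 0}"

definition X_space :: "real \<Rightarrow> real \<Rightarrow> real \<Rightarrow> (nat \<Rightarrow> st_fun) set set" where
  "X_space r s b = X_cauchy r s b // X_equiv r s b"

definition X_norm :: "real \<Rightarrow> real \<Rightarrow> real \<Rightarrow> (nat \<Rightarrow> st_fun) set \<Rightarrow> real" where
  "X_norm r s b U = (THE l. \<forall>u\<in>U. (\<lambda>n. pre_norm r s b (u n)) \<longlonglongrightarrow> l)"

definition C1_coeff :: "st_fun \<Rightarrow> st_fun \<Rightarrow> st_fun \<Rightarrow> real \<Rightarrow> int \<Rightarrow> complex" where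
  "C1_coeff u1 u2 u3 t \<xi> =
     1 / (2 * pi) *
     (\<Sum>\<^sub>\<infinity>(\<xi>1, \<xi>2, \<xi>3) \<in> {(\<xi>1, \<xi>2, \<xi>3). \<xi> = \<xi>1 + \<xi>2 + \<xi>3 \<and> \<xi>1 \<noteq> \<xi> \<and> \<xi>2 \<noteq> \<xi>}.
        fourier_x (\<lambda>x. u1 (t, x)) \<xi>1 * fourier_x (\<lambda>x. u2 (t, x)) \<xi>2
        * fourier_x (\<lambda>x. cnj (u3 (t, x))) \<xi>3)"

text \<open>
  On test functions: the function whose \<open>\<xi>\<close>-th Fourier coefficient at time \<open>t\<close> is
  \<^term>\<open>C1_coeff u1 u2 u3 t \<xi>\<close>, given by its (absolutely convergent) Fourier series.
\<close>

definition C1 :: "st_fun \<Rightarrow> st_fun \<Rightarrow> st_fun \<Rightarrow> st_fun" where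
  "C1 u1 u2 u3 =
     (\<lambda>(t, x). 1 / sqrt (2 * pi) * (\<Sum>\<^sub>\<infinity>\<xi>::int. C1_coeff u1 u2 u3 t \<xi> * cis (x * of_int \<xi>)))"

text \<open>
  The extension of \<^const>\<open>C1\<close> by continuity to elements \<open>U1, U2, U3\<close> of a completion, with values
  in \<open>X\<^sup>s\<^sup>,\<^sup>b\<^sub>r\<close>. The set below is an element of \<^term>\<open>X_space r s b\<close> (and not empty) exactly if,
  for all choices of representing sequences, the sequence of images is Cauchy in \<open>X\<^sup>s\<^sup>,\<^sup>b\<^sub>r\<close>, with a
  limit that does not depend on the choice.
\<close>

definition C1_ext :: "real \<Rightarrow> real \<Rightarrow> real \<Rightarrow>
    (nat \<Rightarrow> st_fun) set \<Rightarrow> (nat \<Rightarrow> st_fun) set \<Rightarrow> (nat \<Rightarrow> st_fun) set \<Rightarrow> (nat \<Rightarrow> st_fun) set" where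
  "C1_ext r s b U1 U2 U3 =
     {w. \<forall>u1\<in>U1. \<forall>u2\<in>U2. \<forall>u3\<in>U3.
           ((\<lambda>n. C1 (u1 n) (u2 n) (u3 n)), w) \<in> X_equiv r s b}"

end

theory Submission
  imports Defs "HOL-Probability.Probability"
begin

text \<open>
  Write \<open>p\<close> for the exponent dual to \<open>r\<close> and \<open>\<langle>y\<rangle>\<close> for \<open>bracket y\<close>. On the Fourier side,
  \<open>\<F>C\<^sub>1(u\<^sub>1, u\<^sub>2, u\<^sub>3)(\<tau>, \<xi>)\<close> is bounded by the sum over \<open>j, k \<noteq> \<xi>\<close> and the integral over
  \<open>t\<^sub>1, t\<^sub>2\<close> of \<open>\<bar>\<F>u\<^sub>1(t\<^sub>1, j)\<bar> \<bar>\<F>u\<^sub>2(t\<^sub>2, k)\<bar> \<bar>\<F>u\<^sub>3(t\<^sub>1 + t\<^sub>2 - \<tau>, j + k - \<xi>)\<bar>\<close>. Write each factor as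
  \<open>\<langle>modulation\<rangle>\<^sup>-\<^sup>b\<close> times the function whose \<open>\<ell>\<^sup>p L\<^sup>p\<close> norm is the \<open>X\<^sup>0\<^sup>,\<^sup>b\<close> norm and apply Hoelder's
  inequality in all inner variables at once. By Tonelli and the translation invariance of the
  measures, the factor with the \<open>p\<close>-th powers integrates over \<open>(\<tau>, \<xi>)\<close> to the product of the norms.
  So everything reduces to bounding the other factor, a kernel that contains no unknown function,
  by a multiple of \<open>\<langle>\<tau> + \<xi>\<^sup>2\<rangle>\<^sup>\<epsilon>\<^sup>r\<close>.

  The three modulations and \<open>\<sigma> = \<tau> + \<xi>\<^sup>2\<close> are tied together by the resonance identity: their
  alternating sum is \<open>2(\<xi> - j)(\<xi> - k)\<close>. Since \<open>b r > 1\<close>, the kernel is essentially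
  \<open>\<Sum> \<langle>\<sigma> - 2ac\<rangle>\<^sup>-\<^sup>b\<^sup>r\<close> over the integers \<open>a, c \<noteq> 0\<close>; here the conditions \<open>j, k \<noteq> \<xi>\<close> enter. A nonzero
  integer \<open>n\<close> is a product \<open>ac\<close> in only \<open>O(\<bar>n\<bar>\<^sup>\<delta>)\<close> ways, which costs the factor \<open>\<langle>\<sigma>\<rangle>\<^sup>\<delta>\<close> that the weight
  \<open>\<langle>\<sigma>\<rangle>\<^sup>-\<^sup>\<epsilon>\<close> on the left-hand side pays for. These steps are \<open>divisor_bound\<close>, \<open>lattice_sum_bound\<close>,
  \<open>resonance_kernel_bound\<close> and \<open>trilinear_wnorm_estimate\<close>.

  It remains to connect this estimate with functions of \<open>(t, x)\<close>. A test function is the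
  same thing as a family of Fourier coefficients \<open>a\<^sub>\<xi>(t)\<close> that, together with all \<open>t\<close>-derivatives, decreases
  rapidly in \<open>t\<close> and \<open>\<xi>\<close> (\<open>schwartz_coef\<close>, \<open>test_fun_synth\<close>, \<open>coef_synth\<close>), and on such
  families \<open>C\<^sub>1\<close> is an absolutely convergent sum of products. Hence \<open>C\<^sub>1\<close> maps test functions to
  test functions. The Fourier transform in time turns each product into a convolution by Fourier
  inversion (\<open>fourier_inversion\<close>). By trilinearity, the
  estimate for test functions makes \<open>C\<^sub>1\<close> Lipschitz on bounded sets, so it extends to the
  completions with the same bound.
\<close>

section \<open>The Japanese bracket\<close>

lemma bracket_ge_1: "1 \<le> bracket y"
  by (simp add: bracket_def)

lemma bracket_pos [simp]: "0 < bracket y"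
  using bracket_ge_1[of y] by linarith

lemma bracket_nonneg [simp]: "0 \<le> bracket y"
  by (simp add: less_imp_le)

lemma bracket_neq_0 [simp]: "bracket y \<noteq> 0"
  using bracket_pos[of y] by linarith

lemma bracket_minus [simp]: "bracket (- y) = bracket y"
  by (simp add: bracket_def)

lemma abs_le_bracket: "\<bar>y\<bar> \<le> bracket y"
  unfolding bracket_def by (rule real_le_rsqrt) simp

lemma bracket_mono: "\<bar>x\<bar> \<le> \<bar>y\<bar> \<Longrightarrow> bracket x \<le> bracket y"
  unfolding bracket_def by (simp add: abs_le_square_iff)

lemma bracket_measurable [measurable]: "bracket \<in> borel_measurable borel"
  unfolding bracket_def by measurable

text \<open>
  Peetre's inequality. It moves powers of brackets, of either sign, from one point to
  another at the price of a power of the distance.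
\<close>

lemma bracket_add_le: "bracket (x + y) \<le> sqrt 2 * bracket x * bracket y"
proof -
  have "1 + (x + y)\<^sup>2 \<le> 2 * (1 + x\<^sup>2) * (1 + y\<^sup>2)"
  proof -
    have "2 * (1 + x\<^sup>2) * (1 + y\<^sup>2) - (1 + (x + y)\<^sup>2) = 1 + (x - y)\<^sup>2 + 2 * (x * y)\<^sup>2"
      by (simp add: power2_eq_square algebra_simps)
    moreover have "0 \<le> 1 + (x - y)\<^sup>2 + 2 * (x * y)\<^sup>2"
      by simp
    ultimately show ?thesis by linarith
  qed
  then show ?thesis
    unfolding bracket_def by (simp flip: real_sqrt_mult)
qed

lemma bracket_powr_add_le:
  assumes "0 \<le> \<gamma>"
  shows "bracket (x + y) powr \<gamma> \<le> 2 powr (\<gamma> / 2) * bracket x powr \<gamma> * bracket y powr \<gamma>"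
proof -
  have "bracket (x + y) powr \<gamma> \<le> (sqrt 2 * bracket x * bracket y) powr \<gamma>"
    using assms bracket_add_le by (intro powr_mono2) auto
  then show ?thesis
    by (simp add: powr_mult powr_half_sqrt[symmetric] powr_powr)
qed

lemma bracket_powr_minus_shift:
  assumes "0 \<le> \<gamma>"
  shows "bracket x powr (- \<gamma>) \<le> 2 powr (\<gamma> / 2) * bracket h powr \<gamma> * bracket (x + h) powr (- \<gamma>)"
proof -
  let ?X = "bracket x powr \<gamma>" and ?Y = "bracket (x + h) powr \<gamma>"
  have "?Y * (inverse ?X * inverse ?Y) \<le> 2 powr (\<gamma> / 2) * ?X * bracket h powr \<gamma> * (inverse ?X * inverse ?Y)"
    by (intro mult_right_mono bracket_powr_add_le assms) simp
  then show ?thesis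
    by (simp add: powr_minus field_simps)
qed

lemma nn_integral_bracket_finite:
  assumes "1 < \<gamma>"
  shows "(\<integral>\<^sup>+ s. ennreal (bracket s powr (- \<gamma>)) \<partial>lborel) < \<infinity>"
proof -
  let ?h = "\<lambda>s. ennreal (s powr (- \<gamma>)) * indicator {1..} s"
  have tail: "(\<integral>\<^sup>+ s. ?h s \<partial>lborel) = ennreal (0 - (- (1 powr (1 - \<gamma>)) / (\<gamma> - 1)))"
  proof (rule nn_integral_FTC_atLeast[where F = "\<lambda>s. - (s powr (1 - \<gamma>)) / (\<gamma> - 1)" and T = 0])
    show "((\<lambda>s. - (s powr (1 - \<gamma>)) / (\<gamma> - 1)) has_real_derivative s powr (- \<gamma>)) (at s)" if "1 \<le> s" for s
    proof -
      have "((\<lambda>s. - (s powr (1 - \<gamma>)) / (\<gamma> - 1)) has_real_derivative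
          - ((1 - \<gamma>) * s powr (1 - \<gamma> - 1)) / (\<gamma> - 1)) (at s)"
        using that assms by (auto intro!: derivative_eq_intros)
      moreover have "- ((1 - \<gamma>) * s powr (1 - \<gamma> - 1)) / (\<gamma> - 1) = s powr (- \<gamma>)"
      proof -
        have "- ((1 - \<gamma>) * s powr (1 - \<gamma> - 1)) = (\<gamma> - 1) * s powr (- \<gamma>)"
          by (simp add: algebra_simps)
        then show ?thesis using assms by simp
      qed
      ultimately show ?thesis by simp
    qed
    have "((\<lambda>s::real. - (s powr (1 - \<gamma>)) / (\<gamma> - 1)) \<longlongrightarrow> - 0 / (\<gamma> - 1)) at_top"
      using assms by (intro tendsto_intros tendsto_neg_powr filterlim_ident) auto
    then show "((\<lambda>s::real. - (s powr (1 - \<gamma>)) / (\<gamma> - 1)) \<longlongrightarrow> 0) at_top"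
      by simp
  qed auto
  have "(\<integral>\<^sup>+ s. ennreal (bracket s powr (- \<gamma>)) \<partial>lborel)
      \<le> (\<integral>\<^sup>+ s. indicator {-1..1} s + ?h s + ?h (0 + (- 1) * s) \<partial>lborel)"
  proof (intro nn_integral_mono)
    fix s :: real
    have le1: "bracket s powr (- \<gamma>) \<le> 1"
      using assms powr_mono[of "- \<gamma>" 0 "bracket s"] bracket_ge_1[of s] by (simp add: powr_zero_eq_one)
    have le2: "bracket s powr (- \<gamma>) \<le> \<bar>s\<bar> powr (- \<gamma>)" if "s \<noteq> 0"
      using that assms abs_le_bracket[of s] by (intro powr_mono2') auto
    consider "\<bar>s\<bar> \<le> 1" | "s > 1" | "s < - 1" by linarith
    then show "ennreal (bracket s powr (- \<gamma>)) \<le> indicator {-1..1} s + ?h s + ?h (0 + (- 1) * s)"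
    proof cases
      case 1
      then have "1 \<le> indicator {-1..1} s + ?h s + ?h (0 + (- 1) * s)"
        by (simp add: indicator_def abs_le_iff add_increasing2)
      with le1 show ?thesis
        by (meson ennreal_le_1 order.trans)
    next
      case 2
      with le2 show ?thesis by (auto simp: indicator_def intro!: ennreal_leI)
    next
      case 3
      with le2 show ?thesis by (auto simp: indicator_def intro!: ennreal_leI)
    qed
  qed
  also have "\<dots> = (\<integral>\<^sup>+ s. indicator {-1..1::real} s \<partial>lborel) + (\<integral>\<^sup>+ s. ?h s \<partial>lborel)
      + (\<integral>\<^sup>+ s. ?h (0 + (- 1) * s) \<partial>lborel)"
    by (simp add: nn_integral_add)
  also have "(\<integral>\<^sup>+ s. ?h (0 + (- 1) * s) \<partial>lborel) = (\<integral>\<^sup>+ s. ?h s \<partial>lborel)"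
    using nn_integral_real_affine[of ?h "-1" 0] by (simp del: add_0)
  also have "(\<integral>\<^sup>+ s. indicator {-1..1::real} s \<partial>lborel) + (\<integral>\<^sup>+ s. ?h s \<partial>lborel) + (\<integral>\<^sup>+ s. ?h s \<partial>lborel) < \<infinity>"
    unfolding tail by simp
  finally show ?thesis .
qed

text \<open>
  On an interval \<open>[n, n + 1)\<close> the argument moves by at most \<open>2\<close>, so by Peetre's inequality the
  term at \<open>n\<close> is at most a constant times the integral of \<open>\<langle>\<mu> - 2x\<rangle>\<^sup>-\<^sup>\<gamma>\<close> over that interval; the
  sum of these integrals does not depend on \<open>\<mu>\<close>.
\<close>

lemma sum_bracket_bounded:
  assumes "1 < \<gamma>"
  shows "\<exists>C\<ge>0. \<forall>\<mu>. (\<integral>\<^sup>+ n. ennreal (bracket (\<mu> - 2 * of_int n) powr (- \<gamma>)) \<partial>count_space (UNIV::int set)) \<le> ennreal C"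
proof -
  define I where "I = (\<integral>\<^sup>+ s. ennreal (bracket s powr (- \<gamma>)) \<partial>lborel)"
  define K where "K = 2 powr (\<gamma> / 2) * bracket 2 powr \<gamma>"
  have I: "I < \<infinity>" unfolding I_def by (rule nn_integral_bracket_finite[OF assms])
  have "(\<integral>\<^sup>+ n. ennreal (bracket (\<mu> - 2 * of_int n) powr (- \<gamma>)) \<partial>count_space (UNIV::int set)) \<le> ennreal K * I" for \<mu>
  proof -
    let ?J = "\<lambda>n::int. {of_int n..<of_int n + 1::real}"
    have pt: "ennreal (bracket (\<mu> - 2 * of_int n) powr (- \<gamma>)) * indicator (?J n) x
        \<le> ennreal K * (ennreal (bracket (\<mu> + (- 2) * x) powr (- \<gamma>)) * indicator (?J n) x)" for n x
    proof (cases "x \<in> ?J n")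
      case True
      then have "bracket (2 * of_int n - 2 * x) powr \<gamma> \<le> bracket 2 powr \<gamma>"
        using assms by (intro powr_mono2 bracket_mono) auto
      then have "2 powr (\<gamma> / 2) * bracket (2 * of_int n - 2 * x) powr \<gamma> * bracket (\<mu> + (- 2) * x) powr (- \<gamma>)
          \<le> K * bracket (\<mu> + (- 2) * x) powr (- \<gamma>)"
        unfolding K_def by (intro mult_right_mono mult_left_mono) auto
      moreover have "bracket (\<mu> - 2 * of_int n) powr (- \<gamma>)
          \<le> 2 powr (\<gamma> / 2) * bracket (2 * of_int n - 2 * x) powr \<gamma> * bracket (\<mu> + (- 2) * x) powr (- \<gamma>)"
        using bracket_powr_minus_shift[of \<gamma> "\<mu> - 2 * of_int n" "2 * of_int n - 2 * x"] assms by simp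
      ultimately have "bracket (\<mu> - 2 * of_int n) powr (- \<gamma>) \<le> K * bracket (\<mu> + (- 2) * x) powr (- \<gamma>)"
        by (rule order.trans[rotated])
      with True show ?thesis
        by (simp add: ennreal_mult'[symmetric] ennreal_leI K_def)
    qed simp
    have "(\<integral>\<^sup>+ n. ennreal (bracket (\<mu> - 2 * of_int n) powr (- \<gamma>)) \<partial>count_space (UNIV::int set))
        = (\<integral>\<^sup>+ n. (\<integral>\<^sup>+ x. ennreal (bracket (\<mu> - 2 * of_int n) powr (- \<gamma>)) * indicator (?J n) x \<partial>lborel) \<partial>count_space UNIV)"
      by (simp add: nn_integral_cmult_indicator)
    also have "\<dots> \<le> (\<integral>\<^sup>+ n. (\<integral>\<^sup>+ x. ennreal K * (ennreal (bracket (\<mu> + (- 2) * x) powr (- \<gamma>)) * indicator (?J n) x) \<partial>lborel) \<partial>count_space UNIV)"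
      by (intro nn_integral_mono pt)
    also have "\<dots> = (\<integral>\<^sup>+ x. (\<integral>\<^sup>+ n. ennreal K * (ennreal (bracket (\<mu> + (- 2) * x) powr (- \<gamma>)) * indicator (?J n) x) \<partial>count_space UNIV) \<partial>lborel)"
      by (rule nn_integral_count_space_nn_integral[symmetric]) auto
    also have "\<dots> = (\<integral>\<^sup>+ x. ennreal K * ennreal (bracket (\<mu> + (- 2) * x) powr (- \<gamma>)) \<partial>lborel)"
    proof (intro nn_integral_cong)
      fix x :: real
      have "(\<lambda>n. indicator (?J n) x) = (\<lambda>n. indicator {\<lfloor>x\<rfloor>} n :: ennreal)"
        by (auto simp: fun_eq_iff indicator_def dest: floor_unique)
      moreover have "(\<integral>\<^sup>+ n. c * (d * indicator {\<lfloor>x\<rfloor>} n) \<partial>count_space (UNIV::int set)) = c * d" for c d :: ennreal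
        by (simp add: mult.assoc[symmetric] nn_integral_cmult_indicator one_ennreal_def[symmetric])
      ultimately show "(\<integral>\<^sup>+ n. ennreal K * (ennreal (bracket (\<mu> + (- 2) * x) powr (- \<gamma>)) * indicator (?J n) x) \<partial>count_space UNIV)
          = ennreal K * ennreal (bracket (\<mu> + (- 2) * x) powr (- \<gamma>))"
        by (simp add: fun_eq_iff)
    qed
    also have "\<dots> = ennreal K * (\<integral>\<^sup>+ x. ennreal (bracket (\<mu> + (- 2) * x) powr (- \<gamma>)) \<partial>lborel)"
      by (rule nn_integral_cmult) measurable
    also have "\<dots> \<le> ennreal K * I"
    proof (intro mult_left_mono)
      have "I = ennreal \<bar>- 2\<bar> * (\<integral>\<^sup>+ x. ennreal (bracket (\<mu> + (- 2) * x) powr (- \<gamma>)) \<partial>lborel)"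
        unfolding I_def by (rule nn_integral_real_affine) auto
      moreover have "1 * y \<le> ennreal \<bar>- 2\<bar> * y" for y
        by (intro mult_right_mono) (auto simp: one_le_numeral)
      ultimately show "(\<integral>\<^sup>+ x. ennreal (bracket (\<mu> + (- 2) * x) powr (- \<gamma>)) \<partial>lborel) \<le> I"
        by (metis mult_1)
    qed auto
    finally show ?thesis .
  qed
  moreover have "ennreal K * I = ennreal (K * enn2real I)"
    using I by (simp add: ennreal_mult K_def)
  ultimately show ?thesis
    by (intro exI[of _ "K * enn2real I"]) (simp add: K_def)
qed

section \<open>The divisor bound and a sum over a hyperbolic lattice\<close>

text \<open>
  Splitting off the full power \<open>p\<^sup>e\<close> of a prime reduces the number of divisors by a factor of at
  most \<open>e + 1\<close>. This is at most \<open>p\<^sup>\<delta>\<^sup>e\<close> as soon as \<open>p\<^sup>\<delta> \<ge> 2\<close>. Only primes below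
  \<open>2\<^sup>1\<^sup>/\<^sup>\<delta>\<close> cost a further constant \<open>A\<close> each, and their number does not depend on \<open>n\<close>.
\<close>

lemma divisor_bound:
  fixes \<delta> :: real
  assumes "0 < \<delta>"
  shows "\<exists>C\<ge>1. \<forall>n::nat. 0 < n \<longrightarrow> real (card {d. d dvd n}) \<le> C * real n powr \<delta>"
proof -
  define x where "x = 2 powr \<delta> - 1"
  have x: "0 < x"
    using assms by (simp add: x_def)
  \<comment> \<open>chosen so that Bernoulli gives \<open>e + 1 \<le> A (1 + e x) \<le> A (1 + x)\<^sup>e\<close>, where \<open>1 + x = 2\<^sup>\<delta>\<close>\<close>
  define A where "A = max 1 (1 / x)"
  have A1: "1 \<le> A" and A2: "1 \<le> A * x"
    using x by (auto simp: A_def max_def field_simps)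
  have small: "real e + 1 \<le> A * (p powr \<delta>) ^ e" if "2 \<le> p" for e :: nat and p :: real
  proof -
    have "real e * 1 \<le> real e * (A * x)"
      using A2 by (intro mult_left_mono) auto
    then have "real e + 1 \<le> A * (1 + real e * x)"
      using A1 by (simp add: algebra_simps)
    also have "\<dots> \<le> A * (1 + x) ^ e"
      using A1 x by (intro mult_left_mono Bernoulli_inequality) auto
    also have "\<dots> \<le> A * (p powr \<delta>) ^ e"
      using A1 assms that by (intro mult_left_mono power_mono) (auto simp: x_def powr_mono2)
    finally show ?thesis .
  qed
  define P where "P = nat \<lceil>2 powr (1 / \<delta>)\<rceil>"
  have big: "real e + 1 \<le> (real p powr \<delta>) ^ e" if "P \<le> p" for e p
  proof -
    have "2 powr (1 / \<delta>) \<le> real p"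
      using that by (simp add: P_def)
    then have "(2 powr (1 / \<delta>)) powr \<delta> \<le> real p powr \<delta>"
      using assms by (intro powr_mono2) auto
    then have "2 \<le> real p powr \<delta>"
      using assms by (simp add: powr_powr)
    then have "2 ^ e \<le> (real p powr \<delta>) ^ e"
      by (intro power_mono) auto
    moreover have "real e + 1 \<le> 2 ^ e"
      using Bernoulli_inequality[of "1::real" e] by simp
    ultimately show ?thesis by simp
  qed
  \<comment> \<open>the small primes that divide \<open>n\<close>; each contributes one factor \<open>A\<close>\<close>
  define Q where "Q n = {p::nat. prime p \<and> p < P \<and> p dvd n}" for n
  have finQ: "finite (Q n)" for n
    by (rule finite_subset[of _ "{..<P}"]) (auto simp: Q_def)
  have main: "real (card {d. d dvd n}) \<le> A ^ card (Q n) * real n powr \<delta>" if "0 < n" for n :: nat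
    using that
  proof (induction n rule: less_induct)
    case (less n)
    show ?case
    proof (cases "n = 1")
      case True
      then show ?thesis
        using A1 by (simp add: one_le_power)
    next
      case False
      then obtain p where p: "prime p" "p dvd n"
        using prime_factor_nat by blast
      have nu: "\<not> is_unit p" using p not_prime_unit by blast
      define e where "e = multiplicity p n"
      obtain m where nm: "n = p ^ e * m" and m: "\<not> p dvd m"
        using multiplicity_decompose'[of n p] nu less.prems unfolding e_def by blast
      have e0: "0 < e"
        using p less.prems nu unfolding e_def by (simp add: multiplicity_gt_zero_iff)
      have m0: "0 < m" using less.prems nm by auto
      have "1 < p ^ e" using e0 p prime_gt_1_nat by (metis one_less_power)
      then have mn: "m < n" using m0 nm by simp
      have fm: "finite {d. d dvd m}" using m0 by simp
      have "{d. d dvd n} \<subseteq> (\<lambda>(i, d). p ^ i * d) ` ({..e} \<times> {d. d dvd m})"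
      proof
        fix d assume "d \<in> {d. d dvd n}"
        then obtain d1 d2 where d: "d = d1 * d2" "d1 dvd p ^ e" "d2 dvd m"
          unfolding nm using division_decomp by blast
        then obtain i where "i \<le> e" "d1 = p ^ i"
          using divides_primepow_nat[OF p(1)] by blast
        with d show "d \<in> (\<lambda>(i, d). p ^ i * d) ` ({..e} \<times> {d. d dvd m})"
          by force
      qed
      then have "card {d. d dvd n} \<le> card ({..e} \<times> {d. d dvd m})"
        using fm by (intro surj_card_le) auto
      then have "real (card {d. d dvd n}) \<le> real ((e + 1) * card {d. d dvd m})"
        by (intro of_nat_mono) (simp add: card_cartesian_product)
      then have card_le: "real (card {d. d dvd n}) \<le> (real e + 1) * real (card {d. d dvd m})"
        by (simp only: of_nat_mult of_nat_add of_nat_1)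
      have IH: "real (card {d. d dvd m}) \<le> A ^ card (Q m) * real m powr \<delta>"
        using less.IH[OF mn m0] .
      have npow: "real n powr \<delta> = (real p powr \<delta>) ^ e * real m powr \<delta>"
      proof -
        have p0: "real p > 0" using prime_gt_0_nat[OF p(1)] by simp
        have "real n powr \<delta> = (real p powr real e) powr \<delta> * real m powr \<delta>"
          using p0 by (subst nm) (simp add: powr_mult powr_realpow)
        also have "(real p powr real e) powr \<delta> = (real p powr \<delta>) ^ e"
          using p0 by (simp add: powr_powr powr_power mult.commute)
        finally show ?thesis .
      qed
      have "(real e + 1) * A ^ card (Q m) \<le> A ^ card (Q n) * (real p powr \<delta>) ^ e"
      proof (cases "p < P")
        case True
        have "x = p" if "prime x" "x dvd p ^ e" for x
          using that p(1) prime_dvd_power[of x p e] primes_dvd_imp_eq by blast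
        with True have "Q n = insert p (Q m)" "p \<notin> Q m"
          using p m e0 unfolding Q_def nm by (auto simp: prime_dvd_mult_iff)
        then have "card (Q n) = Suc (card (Q m))"
          using finQ by simp
        moreover have "(real e + 1) * A ^ card (Q m) \<le> (A * (real p powr \<delta>) ^ e) * A ^ card (Q m)"
          using small[of "real p" e] prime_ge_2_nat[OF p(1)] A1 by (intro mult_right_mono) auto
        ultimately show ?thesis by (simp add: algebra_simps)
      next
        case False
        have "Q m \<subseteq> Q n" unfolding Q_def nm by auto
        then have "A ^ card (Q m) \<le> A ^ card (Q n)"
          using A1 finQ by (intro power_increasing card_mono) auto
        moreover have "real e + 1 \<le> (real p powr \<delta>) ^ e"
          using big False by simp
        ultimately have "(real e + 1) * A ^ card (Q m) \<le> (real p powr \<delta>) ^ e * A ^ card (Q n)"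
          using A1 by (intro mult_mono) auto
        then show ?thesis by (simp add: mult.commute)
      qed
      then have "(real e + 1) * A ^ card (Q m) * real m powr \<delta> \<le> A ^ card (Q n) * (real p powr \<delta>) ^ e * real m powr \<delta>"
        by (rule mult_right_mono) simp
      moreover have "(real e + 1) * real (card {d. d dvd m}) \<le> (real e + 1) * (A ^ card (Q m) * real m powr \<delta>)"
        using IH by (intro mult_left_mono) auto
      ultimately show ?thesis
        using card_le unfolding npow mult.assoc by linarith
    qed
  qed
  have "card (Q n) \<le> P" for n
    using card_mono[of "{..<P}" "Q n"] by (auto simp: Q_def)
  then have "A ^ card (Q n) \<le> A ^ P" for n
    using A1 by (intro power_increasing) auto
  then have "real (card {d. d dvd n}) \<le> A ^ P * real n powr \<delta>" if "0 < n" for n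
    using main[OF that] by (meson mult_right_mono order.trans powr_ge_zero)
  then show ?thesis
    using A1 by (intro exI[of _ "A ^ P"]) (auto simp: one_le_power)
qed

lemma card_int_factorizations:
  fixes n :: int
  assumes "n \<noteq> 0"
  shows "finite {(a, c). a * c = n}"
    and "card {(a, c). a * c = n} \<le> 2 * card {d::nat. d dvd nat \<bar>n\<bar>}"
proof -
  let ?D = "{d::nat. d dvd nat \<bar>n\<bar>}"
  let ?f = "\<lambda>(s, d). (s * int d, n div (s * int d))"
  have "finite ?D"
    using assms by (intro finite_divisors_nat) simp
  then have fin: "finite ({1, -1::int} \<times> ?D)"
    by blast
  have sub: "{(a, c). a * c = n} \<subseteq> ?f ` ({1, -1::int} \<times> ?D)"
  proof (rule subsetI)
    fix q assume "q \<in> {(a, c). a * c = n}"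
    then obtain a c where q: "q = (a, c)" and ac: "n = a * c" by auto
    then have a0: "a \<noteq> 0" using assms by auto
    have "nat \<bar>a\<bar> \<in> ?D"
      using ac by (simp add: abs_mult nat_mult_distrib)
    moreover have "q = ?f (sgn a, nat \<bar>a\<bar>)"
      using a0 ac q by (simp add: sgn_mult_abs)
    moreover have "sgn a \<in> {1, -1}" using a0 by (auto simp: sgn_if)
    ultimately show "q \<in> ?f ` ({1, -1::int} \<times> ?D)"
      by blast
  qed
  show "finite {(a, c). a * c = n}"
    by (rule finite_subset[OF sub]) (use fin in auto)
  have "card {(a, c). a * c = n} \<le> card ({1, -1::int} \<times> ?D)"
    using fin sub by (rule surj_card_le)
  then show "card {(a, c). a * c = n} \<le> 2 * card ?D"
    by (simp add: card_cartesian_product)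
qed

text \<open>
  The summand depends on \<open>n = ac\<close> only, and \<open>n\<close> has \<open>O(\<bar>n\<bar>\<^sup>\<delta>)\<close> factorizations. Peetre's inequality
  distributes \<open>\<bar>n\<bar>\<^sup>\<delta>\<close> over \<open>\<langle>\<mu>\<rangle>\<^sup>\<delta>\<close>, which is the bound, and \<open>\<langle>\<mu> - 2n\<rangle>\<^sup>\<delta>\<close>, which still
  leaves a summable power because \<open>\<beta> - \<delta> > 1\<close>.
\<close>

lemma lattice_sum_bound:
  assumes "0 < \<delta>" "1 < \<beta> - \<delta>"
  shows "\<exists>C\<ge>0. \<forall>\<mu>. (\<integral>\<^sup>+ (a, c). (if a \<noteq> 0 \<and> c \<noteq> 0
            then ennreal (bracket (\<mu> - 2 * (of_int a * of_int c)) powr (- \<beta>)) else 0) \<partial>count_space (UNIV :: (int \<times> int) set))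
          \<le> ennreal (C * bracket \<mu> powr \<delta>)"
proof -
  obtain C1 where C1: "1 \<le> C1" "\<And>n::nat. 0 < n \<Longrightarrow> real (card {d. d dvd n}) \<le> C1 * real n powr \<delta>"
    using divisor_bound[OF assms(1)] by blast
  obtain C2 where C2: "0 \<le> C2"
    "\<And>\<mu>. (\<integral>\<^sup>+ n. ennreal (bracket (\<mu> - 2 * of_int n) powr (- (\<beta> - \<delta>))) \<partial>count_space (UNIV::int set)) \<le> ennreal C2"
    using sum_bracket_bounded[OF assms(2)] by blast
  define K where "K = 2 * C1 * 2 powr (\<delta> / 2)"
  have "(\<integral>\<^sup>+ (a, c). (if a \<noteq> 0 \<and> c \<noteq> 0
            then ennreal (bracket (\<mu> - 2 * (of_int a * of_int c)) powr (- \<beta>)) else 0) \<partial>count_space (UNIV :: (int \<times> int) set))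
        \<le> ennreal (K * C2 * bracket \<mu> powr \<delta>)" for \<mu>
  proof -
    define g where "g n = ennreal (bracket (\<mu> - 2 * of_int n) powr (- \<beta>))" for n :: int
    let ?S = "\<lambda>n. {(a, c). a * c = n \<and> n \<noteq> (0::int)}"
    have Sfin: "finite (?S n)" for n
      using card_int_factorizations(1)[of n] by (cases "n = 0") auto
    have "(\<integral>\<^sup>+ (a, c). (if a \<noteq> 0 \<and> c \<noteq> 0
            then ennreal (bracket (\<mu> - 2 * (of_int a * of_int c)) powr (- \<beta>)) else 0) \<partial>count_space (UNIV :: (int \<times> int) set))
        = (\<integral>\<^sup>+ q. (\<integral>\<^sup>+ n. g n * indicator (?S n) q \<partial>count_space UNIV) \<partial>count_space UNIV)"
    proof (intro nn_integral_cong, safe)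
      fix a c :: int
      have "(\<lambda>n. g n * indicator (?S n) (a, c)) = (\<lambda>n. (if a \<noteq> 0 \<and> c \<noteq> 0 then g (a * c) else 0) * indicator {a * c} n)"
        by (auto simp: indicator_def fun_eq_iff)
      then have "(\<integral>\<^sup>+ n. g n * indicator (?S n) (a, c) \<partial>count_space UNIV)
          = (if a \<noteq> 0 \<and> c \<noteq> 0 then g (a * c) else 0)"
        by (simp only:) (subst nn_integral_cmult_indicator; simp add: one_ennreal_def[symmetric])
      then show "(if a \<noteq> 0 \<and> c \<noteq> 0
            then ennreal (bracket (\<mu> - 2 * (of_int a * of_int c)) powr (- \<beta>)) else 0)
          = (\<integral>\<^sup>+ n. g n * indicator (?S n) (a, c) \<partial>count_space UNIV)"
        by (simp add: g_def)
    qed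
    also have "\<dots> = (\<integral>\<^sup>+ n. (\<integral>\<^sup>+ q. g n * indicator (?S n) q \<partial>count_space UNIV) \<partial>count_space UNIV)"
      by (rule nn_integral_count_space_nn_integral) auto
    also have "\<dots> = (\<integral>\<^sup>+ n. g n * of_nat (card (?S n)) \<partial>count_space UNIV)"
      using Sfin by (simp add: nn_integral_cmult_indicator)
    also have "\<dots> \<le> (\<integral>\<^sup>+ n. ennreal (K * bracket \<mu> powr \<delta>) * ennreal (bracket (\<mu> - 2 * of_int n) powr (- (\<beta> - \<delta>))) \<partial>count_space UNIV)"
    proof (intro nn_integral_mono)
      fix n :: int
      have "real (card (?S n)) \<le> 2 * C1 * bracket (2 * of_int n) powr \<delta>"
      proof (cases "n = 0")
        case False
        have "card (?S n) \<le> 2 * card {d::nat. d dvd nat \<bar>n\<bar>}"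
          using card_int_factorizations(2)[OF False] False by simp
        then have "real (card (?S n)) \<le> 2 * real (card {d::nat. d dvd nat \<bar>n\<bar>})"
          by linarith
        also have "\<dots> \<le> 2 * (C1 * real (nat \<bar>n\<bar>) powr \<delta>)"
          using C1(2)[of "nat \<bar>n\<bar>"] False by simp
        also have "\<dots> \<le> 2 * (C1 * bracket (2 * of_int n) powr \<delta>)"
          using C1(1) assms(1) abs_le_bracket[of "2 * of_int n"]
          by (intro mult_left_mono powr_mono2) auto
        finally show ?thesis by simp
      qed (use C1 in auto)
      also have "\<dots> \<le> 2 * C1 * (2 powr (\<delta> / 2) * bracket \<mu> powr \<delta> * bracket (\<mu> - 2 * of_int n) powr \<delta>)"
        using bracket_powr_add_le[of \<delta> \<mu> "2 * of_int n - \<mu>"] assms(1) C1(1) bracket_minus[of "\<mu> - 2 * of_int n"]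
        by (intro mult_left_mono) (auto simp: )
      finally have "bracket (\<mu> - 2 * of_int n) powr (- \<beta>) * real (card (?S n))
          \<le> bracket (\<mu> - 2 * of_int n) powr (- \<beta>) * (2 * C1 * (2 powr (\<delta> / 2) * bracket \<mu> powr \<delta> * bracket (\<mu> - 2 * of_int n) powr \<delta>))"
        by (rule mult_left_mono) simp
      also have "\<dots> = (K * bracket \<mu> powr \<delta>) * bracket (\<mu> - 2 * of_int n) powr (- (\<beta> - \<delta>))"
        by (simp add: K_def powr_diff powr_minus field_simps)
      finally show "g n * of_nat (card (?S n)) \<le> ennreal (K * bracket \<mu> powr \<delta>) * ennreal (bracket (\<mu> - 2 * of_int n) powr (- (\<beta> - \<delta>)))"
        unfolding g_def using C1(1)
        by (simp add: ennreal_of_nat_eq_real_of_nat ennreal_mult[symmetric] K_def ennreal_leI del: minus_diff_eq)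
    qed
    also have "\<dots> = ennreal (K * bracket \<mu> powr \<delta>) * (\<integral>\<^sup>+ n. ennreal (bracket (\<mu> - 2 * of_int n) powr (- (\<beta> - \<delta>))) \<partial>count_space (UNIV::int set))"
      by (rule nn_integral_cmult) simp
    also have "\<dots> \<le> ennreal (K * bracket \<mu> powr \<delta>) * ennreal C2"
      by (intro mult_left_mono C2) simp
    also have "\<dots> = ennreal (K * C2 * bracket \<mu> powr \<delta>)"
      using C1 C2 by (simp add: K_def ennreal_mult[symmetric] mult_ac)
    finally show ?thesis .
  qed
  moreover have "0 \<le> K * C2" using C1 C2 by (simp add: K_def)
  ultimately show ?thesis by blast
qed

section \<open>The resonance kernel\<close>

lemma nn_integral_lborel_shift:
  fixes f :: "real \<Rightarrow> ennreal"
  assumes "f \<in> borel_measurable borel"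
  shows "(\<integral>\<^sup>+ x. f (x + c) \<partial>lborel) = (\<integral>\<^sup>+ x. f x \<partial>lborel)"
  using nn_integral_real_affine[OF assms, of 1 c] by (simp add: add.commute)

lemma nn_integral_lborel_reflect:
  fixes f :: "real \<Rightarrow> ennreal"
  assumes "f \<in> borel_measurable borel"
  shows "(\<integral>\<^sup>+ x. f (c - x) \<partial>lborel) = (\<integral>\<^sup>+ x. f x \<partial>lborel)"
  using nn_integral_real_affine[OF assms, of "-1" c] by simp

text \<open>
  The product of the three modulation weights. The third function enters conjugated, so its
  transform is evaluated at the reflected point \<open>(t\<^sub>1 + t\<^sub>2 - \<tau>, j + k - \<xi>)\<close>; this gives
  all three weights the same sign convention.
\<close>

definition resonance_kernel :: "real \<Rightarrow> int \<Rightarrow> real \<Rightarrow> int \<Rightarrow> int \<Rightarrow> real \<Rightarrow> real \<Rightarrow> real" where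
  "resonance_kernel \<beta> \<xi> \<tau> j k t1 t2 = (if j \<noteq> \<xi> \<and> k \<noteq> \<xi>
     then bracket (t1 + (of_int j)\<^sup>2) powr (- \<beta>) * bracket (t2 + (of_int k)\<^sup>2) powr (- \<beta>)
       * bracket (t1 + t2 - \<tau> + (of_int (j + k - \<xi>))\<^sup>2) powr (- \<beta>) else 0)"

lemma resonance_kernel_nonneg: "0 \<le> resonance_kernel \<beta> \<xi> \<tau> j k t1 t2"
  by (simp add: resonance_kernel_def)

text \<open>
  Translating \<open>t\<^sub>1\<close> and \<open>t\<^sub>2\<close> by \<open>j\<^sup>2\<close> and \<open>k\<^sup>2\<close> turns the third weight into a power of
  \<open>\<langle>\<sigma> - s\<^sub>1 - s\<^sub>2 - 2(\<xi> - j)(\<xi> - k)\<rangle>\<close> with \<open>\<sigma> = \<tau> + \<xi>\<^sup>2\<close>. The lattice sum is taken first, at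
  fixed \<open>s\<^sub>1\<close> and \<open>s\<^sub>2\<close>. Its bound \<open>\<langle>\<sigma> - s\<^sub>1 - s\<^sub>2\<rangle>\<^sup>\<delta>\<close> splits into powers of \<open>\<langle>\<sigma>\<rangle>\<close>,
  \<open>\<langle>s\<^sub>1\<rangle>\<close> and \<open>\<langle>s\<^sub>2\<rangle>\<close>, and the remaining integrals in \<open>s\<^sub>1\<close> and \<open>s\<^sub>2\<close> decouple, so no estimate
  for convolutions of brackets enters.
\<close>

lemma resonance_kernel_bound:
  assumes "0 < \<delta>" "1 < \<beta> - \<delta>"
  shows "\<exists>C\<ge>0. \<forall>\<xi> \<tau>. (\<integral>\<^sup>+ (j, k). (\<integral>\<^sup>+ t1. (\<integral>\<^sup>+ t2. ennreal (resonance_kernel \<beta> \<xi> \<tau> j k t1 t2) \<partial>lborel) \<partial>lborel)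
            \<partial>count_space (UNIV :: (int \<times> int) set))
          \<le> ennreal (C * bracket (\<tau> + (of_int \<xi>)\<^sup>2) powr \<delta>)"
proof -
  obtain C1 where C1: "0 \<le> C1" "\<And>\<mu>. (\<integral>\<^sup>+ (a, c). (if a \<noteq> 0 \<and> c \<noteq> 0
            then ennreal (bracket (\<mu> - 2 * (of_int a * of_int c)) powr (- \<beta>)) else 0) \<partial>count_space (UNIV :: (int \<times> int) set))
          \<le> ennreal (C1 * bracket \<mu> powr \<delta>)"
    using lattice_sum_bound[OF assms] by blast
  define I where "I = (\<integral>\<^sup>+ s. ennreal (bracket s powr (- (\<beta> - \<delta>))) \<partial>lborel)"
  have I: "I < \<infinity>" unfolding I_def by (rule nn_integral_bracket_finite[OF assms(2)])
  define K where "K = C1 * 2 powr \<delta>"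
  have "(\<integral>\<^sup>+ (j, k). (\<integral>\<^sup>+ t1. (\<integral>\<^sup>+ t2. ennreal (resonance_kernel \<beta> \<xi> \<tau> j k t1 t2) \<partial>lborel) \<partial>lborel)
            \<partial>count_space (UNIV :: (int \<times> int) set)) \<le> ennreal (K * (enn2real I)\<^sup>2 * bracket (\<tau> + (of_int \<xi>)\<^sup>2) powr \<delta>)" for \<xi> \<tau>
  proof -
    define \<sigma> where "\<sigma> = \<tau> + (of_int \<xi>)\<^sup>2"
    define E where "E q s1 s2 = (case q of (j, k) \<Rightarrow> if j \<noteq> \<xi> \<and> k \<noteq> \<xi>
        then ennreal (bracket s1 powr (- \<beta>) * bracket s2 powr (- \<beta>)
          * bracket (\<sigma> - s1 - s2 - 2 * (of_int (\<xi> - j) * of_int (\<xi> - k))) powr (- \<beta>)) else 0)"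
      for q s1 s2
    have Emeas [measurable]: "(\<lambda>s2. E q s1 s2) \<in> borel_measurable borel" for q s1
      unfolding E_def by (cases q) simp
    have Emeas2 [measurable]: "(\<lambda>s. E q (fst s) (snd s)) \<in> borel_measurable (borel \<Otimes>\<^sub>M borel)" for q
      unfolding E_def by (cases q) simp
    have Emeas3 [measurable]: "(\<lambda>s1. \<integral>\<^sup>+ s2. E q s1 s2 \<partial>lborel) \<in> borel_measurable borel" for q
    proof -
      have "(\<lambda>s. E q (fst s) (snd s)) \<in> borel_measurable (borel \<Otimes>\<^sub>M lborel)" by measurable
      from lborel.borel_measurable_nn_integral_fst[OF this] show ?thesis by simp
    qed
    have subst: "(\<integral>\<^sup>+ t1. (\<integral>\<^sup>+ t2. ennreal (resonance_kernel \<beta> \<xi> \<tau> j k t1 t2) \<partial>lborel) \<partial>lborel)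
        = (\<integral>\<^sup>+ s1. (\<integral>\<^sup>+ s2. E (j, k) s1 s2 \<partial>lborel) \<partial>lborel)" for j k
    proof -
      \<comment> \<open>the resonance identity \<open>\<xi>\<^sup>2 - j\<^sup>2 - k\<^sup>2 + (j + k - \<xi>)\<^sup>2 = 2(\<xi> - j)(\<xi> - k)\<close>\<close>
      have phase: "bracket (t1 + t2 - \<tau> + (of_int (j + k - \<xi>))\<^sup>2)
          = bracket (\<sigma> - (t1 + (of_int j)\<^sup>2) - (t2 + (of_int k)\<^sup>2) - 2 * (of_int (\<xi> - j) * of_int (\<xi> - k)))" for t1 t2
        by (subst bracket_minus[symmetric]) (rule arg_cong[where f = bracket],
            simp add: \<sigma>_def power2_eq_square algebra_simps)
      have "(\<integral>\<^sup>+ t1. (\<integral>\<^sup>+ t2. ennreal (resonance_kernel \<beta> \<xi> \<tau> j k t1 t2) \<partial>lborel) \<partial>lborel)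
          = (\<integral>\<^sup>+ t1. (\<integral>\<^sup>+ t2. E (j, k) (t1 + (of_int j)\<^sup>2) (t2 + (of_int k)\<^sup>2) \<partial>lborel) \<partial>lborel)"
        by (intro nn_integral_cong) (simp add: resonance_kernel_def E_def phase[simplified])
      also have "\<dots> = (\<integral>\<^sup>+ t1. (\<integral>\<^sup>+ s2. E (j, k) (t1 + (of_int j)\<^sup>2) s2 \<partial>lborel) \<partial>lborel)"
        by (intro nn_integral_cong nn_integral_lborel_shift) measurable
      also have "\<dots> = (\<integral>\<^sup>+ s1. (\<integral>\<^sup>+ s2. E (j, k) s1 s2 \<partial>lborel) \<partial>lborel)"
        by (rule nn_integral_lborel_shift[where f = "\<lambda>s1. \<integral>\<^sup>+ s2. E (j, k) s1 s2 \<partial>lborel"]) measurable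
      finally show ?thesis .
    qed
    have "(\<integral>\<^sup>+ (j, k). (\<integral>\<^sup>+ t1. (\<integral>\<^sup>+ t2. ennreal (resonance_kernel \<beta> \<xi> \<tau> j k t1 t2) \<partial>lborel) \<partial>lborel) \<partial>count_space UNIV)
        = (\<integral>\<^sup>+ q. (\<integral>\<^sup>+ s1. (\<integral>\<^sup>+ s2. E q s1 s2 \<partial>lborel) \<partial>lborel) \<partial>count_space UNIV)"
      by (intro nn_integral_cong) (auto simp: subst)
    also have "\<dots> = (\<integral>\<^sup>+ s1. (\<integral>\<^sup>+ q. (\<integral>\<^sup>+ s2. E q s1 s2 \<partial>lborel) \<partial>count_space UNIV) \<partial>lborel)"
      by (rule nn_integral_count_space_nn_integral[symmetric]) auto
    also have "\<dots> = (\<integral>\<^sup>+ s1. (\<integral>\<^sup>+ s2. (\<integral>\<^sup>+ q. E q s1 s2 \<partial>count_space UNIV) \<partial>lborel) \<partial>lborel)"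
      by (intro nn_integral_cong nn_integral_count_space_nn_integral[symmetric]) auto
    also have "\<dots> \<le> (\<integral>\<^sup>+ s1. (\<integral>\<^sup>+ s2. ennreal (K * bracket \<sigma> powr \<delta>)
        * (ennreal (bracket s1 powr (- (\<beta> - \<delta>))) * ennreal (bracket s2 powr (- (\<beta> - \<delta>)))) \<partial>lborel) \<partial>lborel)"
    proof (intro nn_integral_mono)
      fix s1 s2 :: real
      define w where "w = bracket s1 powr (- \<beta>) * bracket s2 powr (- \<beta>)"
      have w0: "0 \<le> w" by (simp add: w_def)
      let ?G = "\<lambda>(a, c). if a \<noteq> 0 \<and> c \<noteq> 0 then ennreal (bracket (\<sigma> - s1 - s2 - 2 * (of_int a * of_int c)) powr (- \<beta>)) else 0"
      have "(\<integral>\<^sup>+ q. E q s1 s2 \<partial>count_space UNIV) = (\<integral>\<^sup>+ q. ennreal w * ?G ((\<lambda>(j, k). (\<xi> - j, \<xi> - k)) q) \<partial>count_space UNIV)"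
        by (intro nn_integral_cong) (auto simp: E_def w_def ennreal_mult'[symmetric])
      also have "\<dots> = ennreal w * (\<integral>\<^sup>+ q. ?G ((\<lambda>(j, k). (\<xi> - j, \<xi> - k)) q) \<partial>count_space UNIV)"
        by (rule nn_integral_cmult) simp
      also have "(\<integral>\<^sup>+ q. ?G ((\<lambda>(j, k). (\<xi> - j, \<xi> - k)) q) \<partial>count_space UNIV) = (\<integral>\<^sup>+ q. ?G q \<partial>count_space UNIV)"
        by (rule nn_integral_bij_count_space, rule bij_betw_byWitness[where f' = "\<lambda>(j, k). (\<xi> - j, \<xi> - k)"]) auto
      also have "ennreal w * \<dots> \<le> ennreal w * ennreal (C1 * bracket (\<sigma> - s1 - s2) powr \<delta>)"
        by (intro mult_left_mono C1(2)) simp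
      also have "\<dots> = ennreal (w * (C1 * bracket (\<sigma> - s1 - s2) powr \<delta>))"
        using w0 C1(1) by (simp add: ennreal_mult)
      also have "\<dots> \<le> ennreal (w * (C1 * (2 powr \<delta> * bracket \<sigma> powr \<delta> * bracket s1 powr \<delta> * bracket s2 powr \<delta>)))"
      proof (intro ennreal_leI mult_left_mono w0 C1(1))
        have "bracket (\<sigma> - s1 - s2) powr \<delta> \<le> 2 powr (\<delta> / 2) * bracket (\<sigma> - s1) powr \<delta> * bracket s2 powr \<delta>"
          using bracket_powr_add_le[of \<delta> "\<sigma> - s1" "- s2"] assms(1) by simp
        also have "\<dots> \<le> 2 powr (\<delta> / 2) * (2 powr (\<delta> / 2) * bracket \<sigma> powr \<delta> * bracket s1 powr \<delta>) * bracket s2 powr \<delta>"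
          using bracket_powr_add_le[of \<delta> "\<sigma>" "- s1"] assms(1) by (intro mult_right_mono mult_left_mono) auto
        also have "\<dots> = (2 powr (\<delta> / 2) * 2 powr (\<delta> / 2)) * bracket \<sigma> powr \<delta> * bracket s1 powr \<delta> * bracket s2 powr \<delta>"
          by (simp add: mult_ac)
        also have "2 powr (\<delta> / 2) * 2 powr (\<delta> / 2) = 2 powr \<delta>"
          by (subst powr_add[symmetric]) simp
        finally show "bracket (\<sigma> - s1 - s2) powr \<delta> \<le> 2 powr \<delta> * bracket \<sigma> powr \<delta> * bracket s1 powr \<delta> * bracket s2 powr \<delta>" .
      qed
      also have "w * (C1 * (2 powr \<delta> * bracket \<sigma> powr \<delta> * bracket s1 powr \<delta> * bracket s2 powr \<delta>))
          = (K * bracket \<sigma> powr \<delta>) * (bracket s1 powr (- (\<beta> - \<delta>)) * bracket s2 powr (- (\<beta> - \<delta>)))"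
        by (simp add: w_def K_def powr_diff powr_minus field_simps)
      also have "ennreal \<dots> = ennreal (K * bracket \<sigma> powr \<delta>) * (ennreal (bracket s1 powr (- (\<beta> - \<delta>))) * ennreal (bracket s2 powr (- (\<beta> - \<delta>))))"
        using C1(1) by (simp add: ennreal_mult K_def del: minus_diff_eq)
      finally show "(\<integral>\<^sup>+ q. E q s1 s2 \<partial>count_space UNIV) \<le> ennreal (K * bracket \<sigma> powr \<delta>)
          * (ennreal (bracket s1 powr (- (\<beta> - \<delta>))) * ennreal (bracket s2 powr (- (\<beta> - \<delta>))))" .
    qed
    also have "\<dots> = ennreal (K * bracket \<sigma> powr \<delta>) * (I * I)"
      unfolding I_def by (simp add: nn_integral_cmult nn_integral_multc del: minus_diff_eq)
    also have "\<dots> = ennreal (K * bracket \<sigma> powr \<delta>) * (ennreal (enn2real I) * ennreal (enn2real I))"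
      using I by simp
    also have "\<dots> = ennreal (K * (enn2real I)\<^sup>2 * bracket \<sigma> powr \<delta>)"
      using C1(1) by (simp add: K_def ennreal_mult[symmetric] power2_eq_square mult_ac)
    finally show ?thesis unfolding \<sigma>_def .
  qed
  moreover have "0 \<le> K * (enn2real I)\<^sup>2" using C1(1) by (simp add: K_def)
  ultimately show ?thesis by blast
qed

text \<open>
  Hoelder's inequality, raised to the power \<open>p\<close> and stated for a real number \<open>y\<close> below the
  integral, so that no real power of an extended real occurs.
\<close>

lemma nn_integral_Holder:
  fixes f g :: "'a \<Rightarrow> real"
  assumes pq: "1 < p" "1 < q" "1 / p + 1 / q = 1"
    and [measurable]: "f \<in> borel_measurable M" "g \<in> borel_measurable M"
    and nonneg: "\<And>x. 0 \<le> f x" "\<And>x. 0 \<le> g x"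
    and G: "(\<integral>\<^sup>+ x. ennreal (g x powr q) \<partial>M) \<le> ennreal B" "0 < B"
    and y: "0 \<le> y" "ennreal y \<le> (\<integral>\<^sup>+ x. ennreal (f x * g x) \<partial>M)"
  shows "ennreal (y powr p) \<le> (\<integral>\<^sup>+ x. ennreal (f x powr p) \<partial>M) * ennreal (B powr (p / q))"
proof -
  let ?A = "\<integral>\<^sup>+ x. ennreal (f x powr p) \<partial>M"
  \<comment> \<open>with any positive upper bound \<open>A\<close> of the moment, Young applies to the normalized functions even if the moment vanishes\<close>
  have bd: "y powr p \<le> A * B powr (p / q)" if A: "?A \<le> ennreal A" "0 < A" for A
  proof -
    define a b where "a = A powr (1 / p)" and "b = B powr (1 / q)"
    have ab: "0 < a" "0 < b" "a powr p = A" "b powr q = B"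
      using A G(2) pq by (auto simp: a_def b_def powr_powr)
    have pt: "ennreal (f x * g x) \<le> ennreal (a * b / (p * A)) * ennreal (f x powr p) + ennreal (a * b / (q * B)) * ennreal (g x powr q)" for x
    proof -
      have "f x / a * (g x / b) \<le> (f x / a) powr p / p + (g x / b) powr q / q"
        using pq nonneg ab by (intro Youngs_inequality) auto
      also have "\<dots> = f x powr p / (p * A) + g x powr q / (q * B)"
        using nonneg ab by (simp add: powr_divide field_simps)
      finally have "(a * b) * (f x / a * (g x / b)) \<le> (a * b) * (f x powr p / (p * A) + g x powr q / (q * B))"
        using ab by (intro mult_left_mono) auto
      then have "f x * g x \<le> a * b / (p * A) * f x powr p + a * b / (q * B) * g x powr q"
        using ab by (simp add: field_simps)
      then show ?thesis
        using ab A G(2) pq by (simp add: ennreal_mult'[symmetric] ennreal_plus[symmetric] ennreal_leI del: ennreal_plus)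
    qed
    have "ennreal y \<le> (\<integral>\<^sup>+ x. ennreal (a * b / (p * A)) * ennreal (f x powr p) + ennreal (a * b / (q * B)) * ennreal (g x powr q) \<partial>M)"
      by (rule order.trans[OF y(2)]) (intro nn_integral_mono pt)
    also have "\<dots> = ennreal (a * b / (p * A)) * ?A + ennreal (a * b / (q * B)) * (\<integral>\<^sup>+ x. ennreal (g x powr q) \<partial>M)"
      by (simp add: nn_integral_add nn_integral_cmult)
    also have "\<dots> \<le> ennreal (a * b / (p * A)) * ennreal A + ennreal (a * b / (q * B)) * ennreal B"
      by (intro add_mono mult_left_mono A G) auto
    also have "\<dots> = ennreal (a * b / (p * A) * A + a * b / (q * B) * B)"
      using ab A G(2) pq by (simp add: ennreal_mult'[symmetric] ennreal_plus[symmetric] del: ennreal_plus)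
    also have "a * b / (p * A) * A + a * b / (q * B) * B = a * b * (1 / p + 1 / q)"
      using A G(2) by (simp add: field_simps)
    finally have "y \<le> a * b"
      using ab by (simp add: pq)
    then have "y powr p \<le> (a * b) powr p"
      using y pq by (intro powr_mono2) auto
    also have "\<dots> = A * B powr (p / q)"
      using ab by (simp add: powr_mult b_def powr_powr)
    finally show ?thesis .
  qed
  show ?thesis
  proof (cases "?A = \<infinity>")
    case True
    then show ?thesis using G(2) by (simp add: ennreal_top_mult)
  next
    case False
    then obtain A where A: "?A = ennreal A" "0 \<le> A" by (cases ?A) auto
    have "y powr p \<le> A * B powr (p / q)"
    proof (rule field_le_epsilon)
      fix e :: real assume "0 < e"
      define d where "d = e / B powr (p / q)"
      have "0 < d" using \<open>0 < e\<close> G(2) by (simp add: d_def)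
      then have "y powr p \<le> (A + d) * B powr (p / q)"
        using A by (intro bd) auto
      also have "\<dots> = A * B powr (p / q) + e"
        using G(2) by (simp add: d_def field_simps)
      finally show "y powr p \<le> A * B powr (p / q) + e" .
    qed
    then show ?thesis
      using A by (simp add: ennreal_mult[symmetric] ennreal_leI)
  qed
qed

section \<open>The trilinear estimate in Fourier variables\<close>

text \<open>
  The \<open>p\<close>-th power of the weighted \<open>\<ell>\<^sup>p\<^sub>\<xi> L\<^sup>p\<^sub>\<tau>\<close> norm.
\<close>

definition wnorm :: "real \<Rightarrow> real \<Rightarrow> (int \<Rightarrow> real \<Rightarrow> real) \<Rightarrow> ennreal" where
  "wnorm p b h = (\<integral>\<^sup>+ \<xi>. (\<integral>\<^sup>+ \<tau>. ennreal ((bracket (\<tau> + (of_int \<xi>)\<^sup>2) powr b * h \<xi> \<tau>) powr p) \<partial>lborel)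
     \<partial>count_space (UNIV :: int set))"

text \<open>
  The majorant of \<open>\<F>C\<^sub>1\<close> that is left when all transforms are replaced by their absolute values.
\<close>

definition nonresonant_convolution ::
    "(int \<Rightarrow> real \<Rightarrow> real) \<Rightarrow> (int \<Rightarrow> real \<Rightarrow> real) \<Rightarrow> (int \<Rightarrow> real \<Rightarrow> real) \<Rightarrow> int \<Rightarrow> real \<Rightarrow> ennreal" where
  "nonresonant_convolution h1 h2 h3 \<xi> \<tau> = (\<integral>\<^sup>+ (j, k). (if j \<noteq> \<xi> \<and> k \<noteq> \<xi>
     then \<integral>\<^sup>+ t1. (\<integral>\<^sup>+ t2. ennreal (h1 j t1 * h2 k t2 * h3 (j + k - \<xi>) (t1 + t2 - \<tau>)) \<partial>lborel) \<partial>lborel else 0)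
     \<partial>count_space (UNIV :: (int \<times> int) set))"

text \<open>
  After Tonelli the variables \<open>\<tau>\<close> and \<open>\<xi>\<close> occur in the third factor only, where a
  reflection removes the remaining variables.
\<close>

lemma nn_integral_trilinear_convolution:
  fixes G1 G2 G3 :: "int \<Rightarrow> real \<Rightarrow> ennreal"
  assumes [measurable]: "\<And>\<xi>. G1 \<xi> \<in> borel_measurable borel" "\<And>\<xi>. G2 \<xi> \<in> borel_measurable borel"
      "\<And>\<xi>. G3 \<xi> \<in> borel_measurable borel"
  shows "(\<integral>\<^sup>+ \<xi>. (\<integral>\<^sup>+ \<tau>. (\<integral>\<^sup>+ (j, k). (\<integral>\<^sup>+ t1. (\<integral>\<^sup>+ t2. G1 j t1 * G2 k t2 * G3 (j + k - \<xi>) (t1 + t2 - \<tau>)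
           \<partial>lborel) \<partial>lborel) \<partial>count_space (UNIV :: (int \<times> int) set)) \<partial>lborel) \<partial>count_space (UNIV :: int set))
    = (\<integral>\<^sup>+ \<xi>. (\<integral>\<^sup>+ \<tau>. G1 \<xi> \<tau> \<partial>lborel) \<partial>count_space UNIV) * (\<integral>\<^sup>+ \<xi>. (\<integral>\<^sup>+ \<tau>. G2 \<xi> \<tau> \<partial>lborel) \<partial>count_space UNIV)
      * (\<integral>\<^sup>+ \<xi>. (\<integral>\<^sup>+ \<tau>. G3 \<xi> \<tau> \<partial>lborel) \<partial>count_space UNIV)"
proof -
  define I1 where "I1 j = (\<integral>\<^sup>+ t. G1 j t \<partial>lborel)" for j
  define I2 where "I2 j = (\<integral>\<^sup>+ t. G2 j t \<partial>lborel)" for j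
  define I3 where "I3 j = (\<integral>\<^sup>+ t. G3 j t \<partial>lborel)" for j
  define \<Phi> where "\<Phi> \<xi> q \<tau> t1 t2 = (case q of (j, k) \<Rightarrow> G1 j t1 * G2 k t2 * G3 (j + k - \<xi>) (t1 + t2 - \<tau>))"
    for \<xi> and q :: "int \<times> int" and \<tau> t1 t2 :: real
  have m3: "(\<lambda>((\<tau>, t1), t2). \<Phi> \<xi> q \<tau> t1 t2) \<in> borel_measurable ((lborel \<Otimes>\<^sub>M lborel) \<Otimes>\<^sub>M lborel)" for \<xi> q
    by (cases q) (simp add: \<Phi>_def split_beta')
  have m2: "(\<lambda>(\<tau>, t1). \<integral>\<^sup>+ t2. \<Phi> \<xi> q \<tau> t1 t2 \<partial>lborel) \<in> borel_measurable (lborel \<Otimes>\<^sub>M lborel)" for \<xi> q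
    using lborel.borel_measurable_nn_integral_fst[OF m3[of \<xi> q]] by (simp add: split_beta)
  have m2': "(\<lambda>(\<tau>, t2). \<Phi> \<xi> q \<tau> t1 t2) \<in> borel_measurable (lborel \<Otimes>\<^sub>M lborel)" for \<xi> q t1
    by (cases q) (simp add: \<Phi>_def split_beta')
  have m1: "(\<lambda>\<tau>. \<integral>\<^sup>+ t1. (\<integral>\<^sup>+ t2. \<Phi> \<xi> q \<tau> t1 t2 \<partial>lborel) \<partial>lborel) \<in> borel_measurable lborel" for \<xi> q
    using lborel.borel_measurable_nn_integral_fst[OF m2[of \<xi> q]] by simp
  have inner: "(\<integral>\<^sup>+ \<tau>. (\<integral>\<^sup>+ t1. (\<integral>\<^sup>+ t2. \<Phi> \<xi> (j, k) \<tau> t1 t2 \<partial>lborel) \<partial>lborel) \<partial>lborel) = I1 j * I2 k * I3 (j + k - \<xi>)" for \<xi> j k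
  proof -
    have "(\<integral>\<^sup>+ \<tau>. (\<integral>\<^sup>+ t1. (\<integral>\<^sup>+ t2. \<Phi> \<xi> (j, k) \<tau> t1 t2 \<partial>lborel) \<partial>lborel) \<partial>lborel)
        = (\<integral>\<^sup>+ t1. (\<integral>\<^sup>+ \<tau>. (\<integral>\<^sup>+ t2. \<Phi> \<xi> (j, k) \<tau> t1 t2 \<partial>lborel) \<partial>lborel) \<partial>lborel)"
      by (rule lborel_pair.Fubini'[symmetric, OF m2])
    also have "\<dots> = (\<integral>\<^sup>+ t1. (\<integral>\<^sup>+ t2. (\<integral>\<^sup>+ \<tau>. \<Phi> \<xi> (j, k) \<tau> t1 t2 \<partial>lborel) \<partial>lborel) \<partial>lborel)"
      by (intro nn_integral_cong lborel_pair.Fubini'[symmetric] m2')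
    also have "\<dots> = (\<integral>\<^sup>+ t1. (\<integral>\<^sup>+ t2. G1 j t1 * G2 k t2 * I3 (j + k - \<xi>) \<partial>lborel) \<partial>lborel)"
    proof (intro nn_integral_cong)
      fix t1 t2 :: real
      have "(\<integral>\<^sup>+ \<tau>. \<Phi> \<xi> (j, k) \<tau> t1 t2 \<partial>lborel) = G1 j t1 * G2 k t2 * (\<integral>\<^sup>+ \<tau>. G3 (j + k - \<xi>) (t1 + t2 - \<tau>) \<partial>lborel)"
        unfolding \<Phi>_def by (simp add: nn_integral_cmult)
      also have "(\<integral>\<^sup>+ \<tau>. G3 (j + k - \<xi>) (t1 + t2 - \<tau>) \<partial>lborel) = I3 (j + k - \<xi>)"
        unfolding I3_def by (rule nn_integral_lborel_reflect) measurable
      finally show "(\<integral>\<^sup>+ \<tau>. \<Phi> \<xi> (j, k) \<tau> t1 t2 \<partial>lborel) = G1 j t1 * G2 k t2 * I3 (j + k - \<xi>)" .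
    qed
    also have "\<dots> = I1 j * I2 k * I3 (j + k - \<xi>)"
      unfolding I1_def I2_def by (simp add: nn_integral_cmult nn_integral_multc mult.assoc)
    finally show ?thesis .
  qed
  have "(\<integral>\<^sup>+ \<xi>. (\<integral>\<^sup>+ \<tau>. (\<integral>\<^sup>+ (j, k). (\<integral>\<^sup>+ t1. (\<integral>\<^sup>+ t2. G1 j t1 * G2 k t2 * G3 (j + k - \<xi>) (t1 + t2 - \<tau>)
           \<partial>lborel) \<partial>lborel) \<partial>count_space (UNIV :: (int \<times> int) set)) \<partial>lborel) \<partial>count_space (UNIV :: int set))
      = (\<integral>\<^sup>+ \<xi>. (\<integral>\<^sup>+ \<tau>. (\<integral>\<^sup>+ q. (\<integral>\<^sup>+ t1. (\<integral>\<^sup>+ t2. \<Phi> \<xi> q \<tau> t1 t2 \<partial>lborel) \<partial>lborel) \<partial>count_space UNIV) \<partial>lborel) \<partial>count_space UNIV)"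
    by (intro nn_integral_cong) (auto simp: \<Phi>_def)
  also have "\<dots> = (\<integral>\<^sup>+ \<xi>. (\<integral>\<^sup>+ q. (\<integral>\<^sup>+ \<tau>. (\<integral>\<^sup>+ t1. (\<integral>\<^sup>+ t2. \<Phi> \<xi> q \<tau> t1 t2 \<partial>lborel) \<partial>lborel) \<partial>lborel) \<partial>count_space UNIV) \<partial>count_space UNIV)"
    by (intro nn_integral_cong nn_integral_count_space_nn_integral m1) auto
  also have "\<dots> = (\<integral>\<^sup>+ q. (\<integral>\<^sup>+ \<xi>. (\<integral>\<^sup>+ \<tau>. (\<integral>\<^sup>+ t1. (\<integral>\<^sup>+ t2. \<Phi> \<xi> q \<tau> t1 t2 \<partial>lborel) \<partial>lborel) \<partial>lborel) \<partial>count_space UNIV) \<partial>count_space UNIV)"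
    by (rule nn_integral_count_space_nn_integral) auto
  also have "\<dots> = (\<integral>\<^sup>+ q. (case q of (j, k) \<Rightarrow> I1 j * I2 k * (\<integral>\<^sup>+ \<xi>. I3 \<xi> \<partial>count_space UNIV)) \<partial>count_space UNIV)"
  proof (intro nn_integral_cong)
    fix q :: "int \<times> int"
    obtain j k where q: "q = (j, k)" by (cases q)
    have "(\<integral>\<^sup>+ \<xi>. I3 (j + k - \<xi>) \<partial>count_space UNIV) = (\<integral>\<^sup>+ \<xi>. I3 \<xi> \<partial>count_space UNIV)"
      by (rule nn_integral_bij_count_space, rule bij_betw_byWitness[where f' = "\<lambda>\<xi>. j + k - \<xi>"]) auto
    then show "(\<integral>\<^sup>+ \<xi>. (\<integral>\<^sup>+ \<tau>. (\<integral>\<^sup>+ t1. (\<integral>\<^sup>+ t2. \<Phi> \<xi> q \<tau> t1 t2 \<partial>lborel) \<partial>lborel) \<partial>lborel) \<partial>count_space UNIV)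
        = (case q of (j, k) \<Rightarrow> I1 j * I2 k * (\<integral>\<^sup>+ \<xi>. I3 \<xi> \<partial>count_space UNIV))"
      unfolding q by (simp add: inner nn_integral_cmult)
  qed
  also have "\<dots> = (\<integral>\<^sup>+ j. (\<integral>\<^sup>+ k. I1 j * I2 k * (\<integral>\<^sup>+ \<xi>. I3 \<xi> \<partial>count_space UNIV) \<partial>count_space UNIV) \<partial>count_space UNIV)"
    by (subst nn_integral_fst_count_space[symmetric]) simp
  also have "\<dots> = (\<integral>\<^sup>+ \<xi>. I1 \<xi> \<partial>count_space UNIV) * (\<integral>\<^sup>+ \<xi>. I2 \<xi> \<partial>count_space UNIV) * (\<integral>\<^sup>+ \<xi>. I3 \<xi> \<partial>count_space UNIV)"
    by (simp add: nn_integral_cmult nn_integral_multc mult.assoc)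
  finally show ?thesis unfolding I1_def I2_def I3_def .
qed

text \<open>
  The weights are distributed so that Hoelder's inequality meets exactly the functions
  \<open>F\<^sub>i = \<langle>\<tau> + \<xi>\<^sup>2\<rangle>\<^sup>b h\<^sub>i\<close> and the kernel. The \<open>r\<close>-th power of the kernel with exponent \<open>b\<close> is the
  kernel with exponent \<open>b r > 1\<close>, whose integral is at most \<open>C \<langle>\<sigma>\<rangle>\<^sup>\<delta>\<close> with \<open>\<delta> \<le> \<epsilon> r\<close>. The
  resulting factor \<open>\<langle>\<sigma>\<rangle>\<^sup>\<delta>\<^sup>p\<^sup>/\<^sup>r\<close> is absorbed by \<open>\<langle>\<sigma>\<rangle>\<^sup>-\<^sup>\<epsilon>\<^sup>p\<close>.
\<close>

theorem trilinear_wnorm_estimate: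
  fixes r \<epsilon> b p :: real
  assumes r: "1 < r" and \<epsilon>: "0 < \<epsilon>" and b: "1 / r < b" and p: "p = conj_exponent r"
  shows "\<exists>C\<ge>0. \<forall>h1 h2 h3 g.
    (\<forall>\<xi> \<tau>. 0 \<le> h1 \<xi> \<tau> \<and> 0 \<le> h2 \<xi> \<tau> \<and> 0 \<le> h3 \<xi> \<tau> \<and> 0 \<le> g \<xi> \<tau>) \<longrightarrow>
    (\<forall>\<xi>. h1 \<xi> \<in> borel_measurable borel \<and> h2 \<xi> \<in> borel_measurable borel \<and> h3 \<xi> \<in> borel_measurable borel) \<longrightarrow>
    (\<forall>\<xi> \<tau>. ennreal (g \<xi> \<tau>) \<le> nonresonant_convolution h1 h2 h3 \<xi> \<tau>) \<longrightarrow>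
    wnorm p (- \<epsilon>) g \<le> ennreal C * (wnorm p b h1 * wnorm p b h2 * wnorm p b h3)"
proof -
  have p1: "1 < p" and pr: "1 / p + 1 / r = 1"
    using r by (auto simp: p conj_exponent_def field_simps)
  have br: "1 < b * r"
    using b r by (simp add: field_simps)
  \<comment> \<open>small enough for the weight \<open>\<langle>\<sigma>\<rangle>\<^sup>-\<^sup>\<epsilon>\<close> to absorb, and for a summable power \<open>b r - \<delta> > 1\<close> to be left\<close>
  define \<delta> where "\<delta> = min (\<epsilon> * r) ((b * r - 1) / 2)"
  have \<delta>: "0 < \<delta>" "\<delta> \<le> \<epsilon> * r" "1 < b * r - \<delta>"
    using \<epsilon> r br by (auto simp: \<delta>_def min_def field_simps)
  obtain C0 where C0: "0 \<le> C0" "\<And>\<xi> \<tau>. (\<integral>\<^sup>+ (j, k). (\<integral>\<^sup>+ t1. (\<integral>\<^sup>+ t2. ennreal (resonance_kernel (b * r) \<xi> \<tau> j k t1 t2) \<partial>lborel) \<partial>lborel)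
            \<partial>count_space (UNIV :: (int \<times> int) set))
          \<le> ennreal (C0 * bracket (\<tau> + (of_int \<xi>)\<^sup>2) powr \<delta>)"
    using resonance_kernel_bound[OF \<delta>(1,3)] by blast
  \<comment> \<open>Hoelder needs a positive bound\<close>
  define C where "C = C0 + 1"
  have C: "0 < C" using C0 by (simp add: C_def)
  have ker: "(\<integral>\<^sup>+ (j, k). (\<integral>\<^sup>+ t1. (\<integral>\<^sup>+ t2. ennreal (resonance_kernel (b * r) \<xi> \<tau> j k t1 t2) \<partial>lborel) \<partial>lborel)
            \<partial>count_space (UNIV :: (int \<times> int) set))
          \<le> ennreal (C * bracket (\<tau> + (of_int \<xi>)\<^sup>2) powr \<delta>)" for \<xi> \<tau>
    by (rule order.trans[OF C0(2)]) (intro ennreal_leI mult_right_mono, auto simp: C_def)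
  have sf: "sigma_finite_measure ((lborel :: real measure) \<Otimes>\<^sub>M (lborel :: real measure))"
    by (simp add: lborel_prod lborel.sigma_finite_measure_axioms)
  let ?L = "count_space (UNIV :: (int \<times> int) set) \<Otimes>\<^sub>M ((lborel :: real measure) \<Otimes>\<^sub>M (lborel :: real measure))"
  have unfold_L: "(\<integral>\<^sup>+ x. \<phi> x \<partial>?L) = (\<integral>\<^sup>+ q. (\<integral>\<^sup>+ t1. (\<integral>\<^sup>+ t2. \<phi> (q, (t1, t2)) \<partial>lborel) \<partial>lborel) \<partial>count_space UNIV)"
    if m: "\<phi> \<in> borel_measurable ?L" for \<phi> :: "(int \<times> int) \<times> real \<times> real \<Rightarrow> ennreal"
  proof -
    have "(\<integral>\<^sup>+ x. \<phi> x \<partial>?L) = (\<integral>\<^sup>+ q. (\<integral>\<^sup>+ t. \<phi> (q, t) \<partial>(lborel \<Otimes>\<^sub>M lborel)) \<partial>count_space UNIV)"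
      by (rule sigma_finite_measure.nn_integral_fst[OF sf, symmetric, OF m])
    also have "\<dots> = (\<integral>\<^sup>+ q. (\<integral>\<^sup>+ t1. (\<integral>\<^sup>+ t2. \<phi> (q, (t1, t2)) \<partial>lborel) \<partial>lborel) \<partial>count_space UNIV)"
    proof (intro nn_integral_cong)
      fix q :: "int \<times> int"
      have "(\<lambda>t. \<phi> (q, t)) \<in> borel_measurable (lborel \<Otimes>\<^sub>M lborel)"
        using m by (intro measurable_compose[OF _ m] measurable_Pair1') simp
      then show "(\<integral>\<^sup>+ t. \<phi> (q, t) \<partial>(lborel \<Otimes>\<^sub>M lborel)) = (\<integral>\<^sup>+ t1. (\<integral>\<^sup>+ t2. \<phi> (q, (t1, t2)) \<partial>lborel) \<partial>lborel)"
        by (simp add: lborel.nn_integral_fst[symmetric])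
    qed
    finally show ?thesis .
  qed
  show ?thesis
  proof (intro exI[of _ "C powr (p / r)"] conjI allI impI)
    fix h1 h2 h3 g :: "int \<Rightarrow> real \<Rightarrow> real"
    assume "\<forall>\<xi> \<tau>. 0 \<le> h1 \<xi> \<tau> \<and> 0 \<le> h2 \<xi> \<tau> \<and> 0 \<le> h3 \<xi> \<tau> \<and> 0 \<le> g \<xi> \<tau>"
    then have nn: "0 \<le> h1 \<xi> \<tau>" "0 \<le> h2 \<xi> \<tau>" "0 \<le> h3 \<xi> \<tau>" "0 \<le> g \<xi> \<tau>" for \<xi> \<tau> by auto
    assume "\<forall>\<xi>. h1 \<xi> \<in> borel_measurable borel \<and> h2 \<xi> \<in> borel_measurable borel \<and> h3 \<xi> \<in> borel_measurable borel"
    then have [measurable]: "h1 \<xi> \<in> borel_measurable borel" "h2 \<xi> \<in> borel_measurable borel" "h3 \<xi> \<in> borel_measurable borel" for \<xi>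
      by auto
    assume g: "\<forall>\<xi> \<tau>. ennreal (g \<xi> \<tau>) \<le> nonresonant_convolution h1 h2 h3 \<xi> \<tau>"
    define F where "F h \<xi> \<tau> = bracket (\<tau> + (of_int \<xi>)\<^sup>2) powr b * h \<xi> \<tau>" for h \<xi> \<tau>
    have F0: "0 \<le> F h1 \<xi> \<tau>" "0 \<le> F h2 \<xi> \<tau>" "0 \<le> F h3 \<xi> \<tau>" for \<xi> \<tau>
      using nn by (auto simp: F_def)
    have [measurable]: "F h1 \<xi> \<in> borel_measurable borel" "F h2 \<xi> \<in> borel_measurable borel" "F h3 \<xi> \<in> borel_measurable borel" for \<xi>
      by (auto simp: F_def[abs_def])
    define A where "A \<xi> \<tau> = (\<integral>\<^sup>+ (j, k). (\<integral>\<^sup>+ t1. (\<integral>\<^sup>+ t2. ennreal (F h1 j t1 powr p) * ennreal (F h2 k t2 powr p)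
        * ennreal (F h3 (j + k - \<xi>) (t1 + t2 - \<tau>) powr p) \<partial>lborel) \<partial>lborel) \<partial>count_space (UNIV :: (int \<times> int) set))" for \<xi> \<tau>
    have pt: "ennreal ((bracket (\<tau> + (of_int \<xi>)\<^sup>2) powr (- \<epsilon>) * g \<xi> \<tau>) powr p) \<le> ennreal (C powr (p / r)) * A \<xi> \<tau>" for \<xi> \<tau>
    proof -
      define f where "f = (\<lambda>((j, k), (t1, t2)). F h1 j t1 * F h2 k t2 * F h3 (j + k - \<xi>) (t1 + t2 - \<tau>))"
      define k where "k = (\<lambda>((j, k), (t1, t2)). resonance_kernel b \<xi> \<tau> j k t1 t2)"
      define \<sigma> where "\<sigma> = \<tau> + (of_int \<xi>)\<^sup>2"
      have fm [measurable]: "f \<in> borel_measurable ?L"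
        by (rule measurable_pair_measure_countable1) (auto simp: f_def)
      have km [measurable]: "k \<in> borel_measurable ?L"
      proof (rule measurable_pair_measure_countable1)
        fix q :: "int \<times> int"
        obtain i j where q: "q = (i, j)" by (cases q)
        have "(\<lambda>y. k (q, y)) = (\<lambda>y. if i \<noteq> \<xi> \<and> j \<noteq> \<xi> then bracket (fst y + (of_int i)\<^sup>2) powr (- b) * bracket (snd y + (of_int j)\<^sup>2) powr (- b)
            * bracket (fst y + snd y - \<tau> + (of_int (i + j - \<xi>))\<^sup>2) powr (- b) else 0)"
          by (auto simp: k_def q resonance_kernel_def fun_eq_iff)
        then show "(\<lambda>y. k (q, y)) \<in> borel_measurable (lborel \<Otimes>\<^sub>M lborel)"
          by simp
      qed auto
      have f0: "0 \<le> f x" and k0: "0 \<le> k x" for x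
        using F0 by (auto simp: f_def k_def resonance_kernel_nonneg split: prod.split)
      have kr: "k x powr r = (case x of ((j, k), (t1, t2)) \<Rightarrow> resonance_kernel (b * r) \<xi> \<tau> j k t1 t2)" for x
        using r by (auto simp: k_def resonance_kernel_def powr_mult powr_powr split: prod.split)
      have "ennreal (g \<xi> \<tau> powr p) \<le> (\<integral>\<^sup>+ x. ennreal (f x powr p) \<partial>?L) * ennreal ((C * bracket \<sigma> powr \<delta>) powr (p / r))"
      proof (rule nn_integral_Holder[where g = k])
        show "(\<integral>\<^sup>+ x. ennreal (k x powr r) \<partial>?L) \<le> ennreal (C * bracket \<sigma> powr \<delta>)"
          by (subst unfold_L, measurable) (use ker[of \<xi> \<tau>] in \<open>simp add: kr case_prod_unfold \<sigma>_def\<close>)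
        have "ennreal (g \<xi> \<tau>) \<le> nonresonant_convolution h1 h2 h3 \<xi> \<tau>"
          using g by blast
        also have "nonresonant_convolution h1 h2 h3 \<xi> \<tau> = (\<integral>\<^sup>+ q. (\<integral>\<^sup>+ t1. (\<integral>\<^sup>+ t2. ennreal (f (q, (t1, t2)) * k (q, (t1, t2))) \<partial>lborel) \<partial>lborel) \<partial>count_space UNIV)"
        unfolding nonresonant_convolution_def
        proof (intro nn_integral_cong)
          fix q :: "int \<times> int"
          obtain i j where q: "q = (i, j)" by (cases q)
          have "f ((i, j), (t1, t2)) * k ((i, j), (t1, t2)) = (if i \<noteq> \<xi> \<and> j \<noteq> \<xi> then h1 i t1 * h2 j t2 * h3 (i + j - \<xi>) (t1 + t2 - \<tau>) else 0)" for t1 t2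
            by (simp add: f_def k_def F_def resonance_kernel_def powr_minus field_simps)
          then show "(case q of (j, k) \<Rightarrow> if j \<noteq> \<xi> \<and> k \<noteq> \<xi>
            then \<integral>\<^sup>+ t1. (\<integral>\<^sup>+ t2. ennreal (h1 j t1 * h2 k t2 * h3 (j + k - \<xi>) (t1 + t2 - \<tau>)) \<partial>lborel) \<partial>lborel else 0)
            = (\<integral>\<^sup>+ t1. (\<integral>\<^sup>+ t2. ennreal (f (q, (t1, t2)) * k (q, (t1, t2))) \<partial>lborel) \<partial>lborel)"
            unfolding q by simp
        qed
        also have "\<dots> = (\<integral>\<^sup>+ x. ennreal (f x * k x) \<partial>?L)"
          by (rule unfold_L[symmetric]) measurable
        finally show "ennreal (g \<xi> \<tau>) \<le> (\<integral>\<^sup>+ x. ennreal (f x * k x) \<partial>?L)" .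
      qed (use p1 r pr f0 k0 C nn in auto)
      also have "(\<integral>\<^sup>+ x. ennreal (f x powr p) \<partial>?L) = A \<xi> \<tau>"
      proof -
        have "ennreal (f ((i, j), (t1, t2)) powr p) = ennreal (F h1 i t1 powr p) * ennreal (F h2 j t2 powr p)
            * ennreal (F h3 (i + j - \<xi>) (t1 + t2 - \<tau>) powr p)" for i j t1 t2
          using F0 by (simp add: f_def powr_mult ennreal_mult[symmetric])
        then show ?thesis
          unfolding A_def by (subst unfold_L) (auto intro!: nn_integral_cong)
      qed
      finally have 1: "ennreal (g \<xi> \<tau> powr p) \<le> A \<xi> \<tau> * ennreal ((C * bracket \<sigma> powr \<delta>) powr (p / r))" .
      have "(bracket \<sigma> powr (- \<epsilon>)) powr p * (C * bracket \<sigma> powr \<delta>) powr (p / r)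
          = C powr (p / r) * (bracket \<sigma> powr (- \<epsilon> * p) * bracket \<sigma> powr (\<delta> * (p / r)))"
        using C by (simp add: powr_mult powr_powr)
      also have "bracket \<sigma> powr (- \<epsilon> * p) * bracket \<sigma> powr (\<delta> * (p / r)) = bracket \<sigma> powr ((\<delta> / r - \<epsilon>) * p)"
        by (simp add: powr_add[symmetric] algebra_simps)
      also have "\<dots> \<le> bracket \<sigma> powr 0"
        using \<delta>(2) r p1 bracket_ge_1[of \<sigma>] by (intro powr_mono mult_nonpos_nonneg) (auto simp: field_simps)
      finally have 2: "(bracket \<sigma> powr (- \<epsilon>)) powr p * (C * bracket \<sigma> powr \<delta>) powr (p / r) \<le> C powr (p / r)"
        by (simp add: mult_left_mono)
      have "ennreal ((bracket \<sigma> powr (- \<epsilon>) * g \<xi> \<tau>) powr p) = ennreal ((bracket \<sigma> powr (- \<epsilon>)) powr p) * ennreal (g \<xi> \<tau> powr p)"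
        using nn by (simp add: powr_mult ennreal_mult)
      also have "\<dots> \<le> ennreal ((bracket \<sigma> powr (- \<epsilon>)) powr p) * (A \<xi> \<tau> * ennreal ((C * bracket \<sigma> powr \<delta>) powr (p / r)))"
        by (intro mult_left_mono 1) simp
      also have "\<dots> = ennreal ((bracket \<sigma> powr (- \<epsilon>)) powr p * (C * bracket \<sigma> powr \<delta>) powr (p / r)) * A \<xi> \<tau>"
        by (simp add: ennreal_mult mult_ac)
      also have "\<dots> \<le> ennreal (C powr (p / r)) * A \<xi> \<tau>"
        by (intro mult_right_mono ennreal_leI 2) simp
      finally show ?thesis unfolding \<sigma>_def .
    qed
    have "wnorm p (- \<epsilon>) g \<le> (\<integral>\<^sup>+ \<xi>. (\<integral>\<^sup>+ \<tau>. ennreal (C powr (p / r)) * A \<xi> \<tau> \<partial>lborel) \<partial>count_space UNIV)"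
      unfolding wnorm_def by (intro nn_integral_mono pt)
    also have "\<dots> = ennreal (C powr (p / r)) * (\<integral>\<^sup>+ \<xi>. (\<integral>\<^sup>+ \<tau>. A \<xi> \<tau> \<partial>lborel) \<partial>count_space UNIV)"
    proof -
      have "A \<xi> \<in> borel_measurable lborel" for \<xi>
      proof -
        have m3: "(\<lambda>((\<tau>, t1), t2). ennreal (F h1 (fst q) t1 powr p) * ennreal (F h2 (snd q) t2 powr p)
          * ennreal (F h3 (fst q + snd q - \<xi>) (t1 + t2 - \<tau>) powr p)) \<in> borel_measurable ((lborel \<Otimes>\<^sub>M lborel) \<Otimes>\<^sub>M lborel)" for q
          by (simp add: split_beta')
        have m2: "(\<lambda>(\<tau>, t1). \<integral>\<^sup>+ t2. ennreal (F h1 (fst q) t1 powr p) * ennreal (F h2 (snd q) t2 powr p)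
          * ennreal (F h3 (fst q + snd q - \<xi>) (t1 + t2 - \<tau>) powr p) \<partial>lborel) \<in> borel_measurable (lborel \<Otimes>\<^sub>M lborel)" for q
          using lborel.borel_measurable_nn_integral_fst[OF m3[of q]] by (simp add: split_beta)
        have "(\<lambda>\<tau>. \<integral>\<^sup>+ t1. (\<integral>\<^sup>+ t2. ennreal (F h1 (fst q) t1 powr p) * ennreal (F h2 (snd q) t2 powr p)
          * ennreal (F h3 (fst q + snd q - \<xi>) (t1 + t2 - \<tau>) powr p) \<partial>lborel) \<partial>lborel) \<in> borel_measurable lborel" for q
          using lborel.borel_measurable_nn_integral_fst[OF m2[of q]] by simp
        then have "(\<lambda>x. (\<lambda>(q, \<tau>). \<integral>\<^sup>+ t1. (\<integral>\<^sup>+ t2. ennreal (F h1 (fst q) t1 powr p) * ennreal (F h2 (snd q) t2 powr p)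
          * ennreal (F h3 (fst q + snd q - \<xi>) (t1 + t2 - \<tau>) powr p) \<partial>lborel) \<partial>lborel) x)
          \<in> borel_measurable (count_space (UNIV :: (int \<times> int) set) \<Otimes>\<^sub>M lborel)"
          by (intro measurable_pair_measure_countable1) auto
        then have "(\<lambda>(\<tau>, q). \<integral>\<^sup>+ t1. (\<integral>\<^sup>+ t2. ennreal (F h1 (fst q) t1 powr p) * ennreal (F h2 (snd q) t2 powr p)
          * ennreal (F h3 (fst q + snd q - \<xi>) (t1 + t2 - \<tau>) powr p) \<partial>lborel) \<partial>lborel)
          \<in> borel_measurable (lborel \<Otimes>\<^sub>M count_space (UNIV :: (int \<times> int) set))"
          by (subst measurable_pair_swap_iff) (simp add: split_beta)
        from sigma_finite_measure.borel_measurable_nn_integral_fst[OF sigma_finite_measure_count_space_countable this]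
        show ?thesis
          unfolding A_def[abs_def] by (simp add: case_prod_unfold)
      qed
      then show ?thesis by (simp add: nn_integral_cmult)
    qed
    also have "(\<integral>\<^sup>+ \<xi>. (\<integral>\<^sup>+ \<tau>. A \<xi> \<tau> \<partial>lborel) \<partial>count_space UNIV) = wnorm p b h1 * wnorm p b h2 * wnorm p b h3"
      unfolding A_def wnorm_def F_def[symmetric] by (rule nn_integral_trilinear_convolution) measurable
    finally show "wnorm p (- \<epsilon>) g \<le> ennreal (C powr (p / r)) * (wnorm p b h1 * wnorm p b h2 * wnorm p b h3)" .
  qed simp
qed

section \<open>Minkowski's inequality for the weighted norm\<close>

definition lnorm :: "real \<Rightarrow> real \<Rightarrow> (int \<Rightarrow> real \<Rightarrow> real) \<Rightarrow> real" where
  "lnorm p b h = enn2real (wnorm p b h) powr (1 / p)"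

text \<open>
  Convexity of \<open>x \<mapsto> x\<^sup>p\<close> at \<open>x/a\<close> and \<open>y/c\<close> with weights proportional to \<open>a\<close> and \<open>c\<close>.
  Integrated, with \<open>a\<close> and \<open>c\<close> the norms of two functions, it is Minkowski's inequality.
\<close>

lemma powr_convex_combination:
  fixes p :: real
  assumes p: "1 \<le> p" and ac: "0 < a" "0 < c" and xy: "0 \<le> x" "0 \<le> y"
  shows "((x + y) / (a + c)) powr p \<le> a / (a + c) * (x / a) powr p + c / (a + c) * (y / c) powr p"
proof -
  have frac: "(d / (a + c)) powr p \<le> d / (a + c)" if "d = a \<or> d = c" for d
  proof -
    have "(d / (a + c)) powr p \<le> (d / (a + c)) powr 1"
      using that ac p by (intro powr_mono') auto
    then show ?thesis using that ac by auto
  qed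
  consider "x = 0" | "y = 0" | "0 < x" "0 < y" using xy by linarith
  then show ?thesis
  proof cases
    case 1
    have "(y / (a + c)) powr p = (c / (a + c)) powr p * (y / c) powr p"
      using ac xy by (simp add: powr_mult[symmetric])
    also have "\<dots> \<le> c / (a + c) * (y / c) powr p"
      by (intro mult_right_mono frac) auto
    finally show ?thesis using 1 p by simp
  next
    case 2
    have "(x / (a + c)) powr p = (a / (a + c)) powr p * (x / a) powr p"
      using ac xy by (simp add: powr_mult[symmetric])
    also have "\<dots> \<le> a / (a + c) * (x / a) powr p"
      by (intro mult_right_mono frac) auto
    finally show ?thesis using 2 p by simp
  next
    case 3
    define t where "t = c / (a + c)"
    have t: "1 - t = a / (a + c)" "0 \<le> t" "t \<le> 1"
      using ac by (auto simp: t_def field_simps)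
    have "((1 - t) *\<^sub>R (x / a) + t *\<^sub>R (y / c)) powr p \<le> (1 - t) * (x / a) powr p + t * (y / c) powr p"
      using 3 ac t by (intro convex_onD[OF powr_convex[OF p]]) auto
    moreover have "(1 - t) *\<^sub>R (x / a) + t *\<^sub>R (y / c) = (x + y) / (a + c)"
      using ac by (simp add: t(1) add_divide_distrib) (simp add: t_def)
    ultimately show ?thesis by (simp add: t(1)) (simp add: t_def)
  qed
qed

lemma wnorm_mono:
  assumes "\<And>\<xi> \<tau>. 0 \<le> h \<xi> \<tau>" "\<And>\<xi> \<tau>. h \<xi> \<tau> \<le> h' \<xi> \<tau>" "0 \<le> p"
  shows "wnorm p b h \<le> wnorm p b h'"
  unfolding wnorm_def using assms
  by (intro nn_integral_mono ennreal_leI powr_mono2 mult_left_mono mult_nonneg_nonneg) auto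

lemma wnorm_add_le:
  assumes p: "1 \<le> p" and ac: "0 < a" "0 < c"
    and nn: "\<And>\<xi> \<tau>. 0 \<le> h1 \<xi> \<tau>" "\<And>\<xi> \<tau>. 0 \<le> h2 \<xi> \<tau>"
    and [measurable]: "\<And>\<xi>. h1 \<xi> \<in> borel_measurable borel" "\<And>\<xi>. h2 \<xi> \<in> borel_measurable borel"
    and le: "wnorm p b h1 \<le> ennreal (a powr p)" "wnorm p b h2 \<le> ennreal (c powr p)"
  shows "wnorm p b (\<lambda>\<xi> \<tau>. h1 \<xi> \<tau> + h2 \<xi> \<tau>) \<le> ennreal ((a + c) powr p)"
proof -
  define k1 k2 where "k1 = (a + c) powr p * (a / (a + c)) / a powr p" and "k2 = (a + c) powr p * (c / (a + c)) / c powr p"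
  have k: "0 \<le> k1" "0 \<le> k2" using ac by (auto simp: k1_def k2_def)
  let ?w = "\<lambda>\<xi> \<tau>. bracket (\<tau> + (of_int \<xi>)\<^sup>2) powr b"
  have pt: "ennreal ((?w \<xi> \<tau> * (h1 \<xi> \<tau> + h2 \<xi> \<tau>)) powr p)
      \<le> ennreal k1 * ennreal ((?w \<xi> \<tau> * h1 \<xi> \<tau>) powr p) + ennreal k2 * ennreal ((?w \<xi> \<tau> * h2 \<xi> \<tau>) powr p)" for \<xi> \<tau>
  proof -
    define x y where "x = ?w \<xi> \<tau> * h1 \<xi> \<tau>" and "y = ?w \<xi> \<tau> * h2 \<xi> \<tau>"
    have xy: "0 \<le> x" "0 \<le> y" using nn by (auto simp: x_def y_def)
    have "(x + y) powr p = (a + c) powr p * ((x + y) / (a + c)) powr p"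
      using ac xy by (simp add: powr_mult[symmetric])
    also have "\<dots> \<le> (a + c) powr p * (a / (a + c) * (x / a) powr p + c / (a + c) * (y / c) powr p)"
      by (intro mult_left_mono powr_convex_combination p ac xy) simp
    also have "\<dots> = k1 * x powr p + k2 * y powr p"
      using ac xy by (simp add: k1_def k2_def powr_divide distrib_left)
    finally have "ennreal ((x + y) powr p) \<le> ennreal (k1 * x powr p + k2 * y powr p)"
      by (rule ennreal_leI)
    also have "\<dots> = ennreal k1 * ennreal (x powr p) + ennreal k2 * ennreal (y powr p)"
      using k by (simp add: ennreal_mult)
    finally show ?thesis
      by (simp only: x_def y_def distrib_left)
  qed
  have "wnorm p b (\<lambda>\<xi> \<tau>. h1 \<xi> \<tau> + h2 \<xi> \<tau>)
      \<le> (\<integral>\<^sup>+ \<xi>. (\<integral>\<^sup>+ \<tau>. ennreal k1 * ennreal ((?w \<xi> \<tau> * h1 \<xi> \<tau>) powr p)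
            + ennreal k2 * ennreal ((?w \<xi> \<tau> * h2 \<xi> \<tau>) powr p) \<partial>lborel) \<partial>count_space UNIV)"
    unfolding wnorm_def by (intro nn_integral_mono pt)
  also have "\<dots> = ennreal k1 * wnorm p b h1 + ennreal k2 * wnorm p b h2"
    unfolding wnorm_def by (simp add: nn_integral_add nn_integral_cmult)
  also have "\<dots> \<le> ennreal k1 * ennreal (a powr p) + ennreal k2 * ennreal (c powr p)"
    by (intro add_mono mult_left_mono le) auto
  also have "\<dots> = ennreal (k1 * a powr p + k2 * c powr p)"
    using k by (simp add: ennreal_mult)
  also have "k1 * a powr p + k2 * c powr p = (a + c) powr p"
  proof -
    have "k1 * a powr p + k2 * c powr p = (a + c) powr p * (a / (a + c) + c / (a + c))"
      using ac by (simp add: k1_def k2_def distrib_left)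
    also have "a / (a + c) + c / (a + c) = 1"
      using ac by (simp add: add_divide_distrib[symmetric])
    finally show ?thesis by simp
  qed
  finally show ?thesis .
qed

lemma lnorm_triangle:
  assumes p: "1 \<le> p"
    and nn: "\<And>\<xi> \<tau>. 0 \<le> h \<xi> \<tau>" "\<And>\<xi> \<tau>. 0 \<le> h1 \<xi> \<tau>" "\<And>\<xi> \<tau>. 0 \<le> h2 \<xi> \<tau>"
    and m: "\<And>\<xi>. h1 \<xi> \<in> borel_measurable borel" "\<And>\<xi>. h2 \<xi> \<in> borel_measurable borel"
    and fin: "wnorm p b h1 < \<infinity>" "wnorm p b h2 < \<infinity>"
    and le: "\<And>\<xi> \<tau>. h \<xi> \<tau> \<le> h1 \<xi> \<tau> + h2 \<xi> \<tau>"
  shows "lnorm p b h \<le> lnorm p b h1 + lnorm p b h2"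
proof (rule field_le_epsilon)
  \<comment> \<open>the norms may vanish, whereas \<open>wnorm_add_le\<close> asks for positive bounds; hence the \<open>e / 2\<close>\<close>
  fix e :: real assume e: "0 < e"
  have bound: "wnorm p b h' \<le> ennreal ((lnorm p b h' + e / 2) powr p)" if f: "wnorm p b h' < \<infinity>" for h'
  proof -
    have "enn2real (wnorm p b h') = lnorm p b h' powr p"
      using p by (simp add: lnorm_def powr_powr)
    also have "\<dots> \<le> (lnorm p b h' + e / 2) powr p"
      using p e by (intro powr_mono2) (auto simp: lnorm_def)
    finally show ?thesis
      using f by (simp add: ennreal_enn2real_if[symmetric] ennreal_leI less_top[symmetric]) (metis ennreal_enn2real ennreal_leI less_top)
  qed
  have "wnorm p b h \<le> wnorm p b (\<lambda>\<xi> \<tau>. h1 \<xi> \<tau> + h2 \<xi> \<tau>)"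
    using nn le p by (intro wnorm_mono) auto
  also have "\<dots> \<le> ennreal ((lnorm p b h1 + e / 2 + (lnorm p b h2 + e / 2)) powr p)"
    using p e nn m fin by (intro wnorm_add_le bound) (auto simp: lnorm_def add_nonneg_pos)
  finally have "enn2real (wnorm p b h) \<le> (lnorm p b h1 + lnorm p b h2 + e) powr p"
    by (intro enn2real_leI) (auto simp: algebra_simps)
  then have "lnorm p b h \<le> ((lnorm p b h1 + lnorm p b h2 + e) powr p) powr (1 / p)"
    unfolding lnorm_def using p by (intro powr_mono2) auto
  also have "\<dots> = lnorm p b h1 + lnorm p b h2 + e"
    using p e by (simp add: powr_powr lnorm_def)
  finally show "lnorm p b h \<le> lnorm p b h1 + lnorm p b h2 + e" .
qed

section \<open>The Fourier transform on the line\<close>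

definition ft :: "(real \<Rightarrow> complex) \<Rightarrow> real \<Rightarrow> complex" where
  "ft f \<tau> = 1 / sqrt (2 * pi) * (LINT t|lborel. f t * cis (- (t * \<tau>)))"

lemma cis_measurable [measurable]: "cis \<in> borel_measurable borel"
  by (intro borel_measurable_continuous_onI continuous_intros)

lemma norm_ft_factor: "cmod (1 / of_real (sqrt (2 * pi))) = 1 / sqrt (2 * pi)" "1 / sqrt (2 * pi) \<le> 1"
proof -
  have "1 \<le> sqrt (2 * pi)" using pi_gt3 by (intro real_le_rsqrt) auto
  then show "1 / sqrt (2 * pi) \<le> 1" by simp
qed (simp add: norm_divide)

lemma integrable_mult_cis:
  fixes f :: "real \<Rightarrow> complex"
  assumes [measurable]: "integrable lborel f" "g \<in> borel_measurable borel"
  shows "integrable lborel (\<lambda>t. f t * cis (g t))"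
  by (rule Bochner_Integration.integrable_bound[OF assms(1)]) (auto simp: norm_mult)

lemma ft_measurable [measurable]:
  assumes [measurable]: "f \<in> borel_measurable borel"
  shows "ft f \<in> borel_measurable borel"
  unfolding ft_def[abs_def] by measurable

lemma gaussian_integral_cis:
  assumes "0 < \<delta>"
  shows "(LINT \<tau>|lborel. cis (s * \<tau>) * of_real (exp (- (\<delta> * \<tau>)\<^sup>2 / 2)))
    = of_real (sqrt (2 * pi) / \<delta> * exp (- (s / \<delta>)\<^sup>2 / 2))"
proof -
  have "(LINT \<tau>|lborel. cis (s * \<tau>) * of_real (exp (- (\<delta> * \<tau>)\<^sup>2 / 2)))
      = \<bar>1 / \<delta>\<bar> *\<^sub>R (LINT x|lborel. cis (s * (0 + 1 / \<delta> * x)) * of_real (exp (- (\<delta> * (0 + 1 / \<delta> * x))\<^sup>2 / 2)))"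
    using assms by (intro lborel_integral_real_affine) auto
  also have "(\<lambda>x. cis (s * (0 + 1 / \<delta> * x)) * complex_of_real (exp (- (\<delta> * (0 + 1 / \<delta> * x))\<^sup>2 / 2)))
      = (\<lambda>x. of_real (sqrt (2 * pi)) * (std_normal_density x *\<^sub>R iexp (s / \<delta> * x)))"
    using assms by (intro ext) (simp add: std_normal_density_def cis_conv_exp scaleR_conv_of_real)
  also have "(LINT x|lborel. of_real (sqrt (2 * pi)) * (std_normal_density x *\<^sub>R iexp (s / \<delta> * x)))
      = of_real (sqrt (2 * pi)) * (LINT x|lborel. std_normal_density x *\<^sub>R iexp (s / \<delta> * x))"
    by (rule integral_mult_right_zero)
  also have "(LINT x|lborel. std_normal_density x *\<^sub>R iexp (s / \<delta> * x)) = char std_normal_distribution (s / \<delta>)"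
    unfolding char_def by (rule integral_density[symmetric]) auto
  also have "\<dots> = of_real (exp (- (s / \<delta>)\<^sup>2 / 2))"
    by (simp add: char_std_normal_distribution)
  finally show ?thesis
    using assms by (simp add: scaleR_conv_of_real)
qed

lemma integrable_gaussian: "integrable lborel (\<lambda>y::real. exp (- y\<^sup>2 / 2))"
proof -
  have "integrable lborel (\<lambda>y. sqrt (2 * pi) * std_normal_density y)"
    by (intro integrable_mult_right) simp
  then show ?thesis by (simp add: std_normal_density_def)
qed

lemma integrable_gaussian_scaled: "\<delta> \<noteq> 0 \<Longrightarrow> integrable lborel (\<lambda>y::real. exp (- (\<delta> * y)\<^sup>2 / 2))"
  using lborel_integrable_real_affine[OF integrable_gaussian, of \<delta> 0] by simp

lemma integral_gaussian: "(LINT y|lborel. exp (- y\<^sup>2 / 2)) = sqrt (2 * pi)"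
proof -
  have "(LINT y|lborel. sqrt (2 * pi) * std_normal_density y) = sqrt (2 * pi)"
    by (subst integral_mult_right_zero) simp
  then show ?thesis by (simp add: std_normal_density_def)
qed

lemma integrable_product_bound:
  fixes F :: "real \<times> real \<Rightarrow> complex" and f g :: "real \<Rightarrow> complex"
  assumes [measurable]: "F \<in> borel_measurable (lborel \<Otimes>\<^sub>M lborel)"
    and f: "integrable lborel f" and g: "integrable lborel g"
    and F: "\<And>x y. norm (F (x, y)) = norm (f x) * norm (g y)"
  shows "integrable (lborel \<Otimes>\<^sub>M lborel) F"
proof (rule lborel_pair.Fubini_integrable)
  have "(\<lambda>x. LINT y|lborel. norm (F (x, y))) = (\<lambda>x. norm (f x) * (LINT y|lborel. norm (g y)))"
    by (simp add: F)
  then show "integrable lborel (\<lambda>x. LINT y|lborel. norm (F (x, y)))"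
    using f by (simp add: integrable_mult_left)
  show "AE x in lborel. integrable lborel (\<lambda>y. F (x, y))"
  proof (intro AE_I2)
    fix x
    have "integrable lborel (\<lambda>y. norm (f x) *\<^sub>R g y)" using g by simp
    then show "integrable lborel (\<lambda>y. F (x, y))"
      by (rule Bochner_Integration.integrable_bound) (auto simp: F)
  qed
qed simp

text \<open>
  Gaussian regularization. With the factor \<open>exp(-\<delta>\<^sup>2\<tau>\<^sup>2/2)\<close> inserted, the inversion
  integral becomes, by Fubini, an average of \<open>f\<close> near \<open>t\<close> against a Gaussian of width \<open>\<delta>\<close>. Both
  sides converge by dominated convergence as \<open>\<delta> \<rightarrow> 0\<close>, the left one because \<open>ft f\<close> is
  integrable, the right one because \<open>f\<close> is bounded and continuous.
\<close>

lemma fourier_inversion: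
  assumes cont: "continuous_on UNIV f" and f: "integrable lborel f" and bdd: "bounded (range f)"
    and ff: "integrable lborel (ft f)"
  shows "f t = 1 / sqrt (2 * pi) * (LINT \<tau>|lborel. ft f \<tau> * cis (t * \<tau>))"
proof -
  have [measurable]: "f \<in> borel_measurable borel"
    using cont by (rule borel_measurable_continuous_onI)
  obtain B where B: "\<And>s. norm (f s) \<le> B" using bdd by (auto simp: bounded_iff)
  have key: "(LINT \<tau>|lborel. ft f \<tau> * cis (t * \<tau>) * of_real (exp (- (\<delta> * \<tau>)\<^sup>2 / 2)))
      = (LINT y|lborel. f (t + \<delta> * y) * of_real (exp (- y\<^sup>2 / 2)))" if \<delta>: "0 < \<delta>" for \<delta>
  proof -
    let ?g = "\<lambda>\<tau>. complex_of_real (exp (- (\<delta> * \<tau>)\<^sup>2 / 2))"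
    define c where "c = complex_of_real (1 / sqrt (2 * pi))"
    have "(LINT \<tau>|lborel. ft f \<tau> * cis (t * \<tau>) * ?g \<tau>)
        = (LINT \<tau>|lborel. c * (LINT s|lborel. f s * (cis ((t - s) * \<tau>) * ?g \<tau>)))"
    proof (intro Bochner_Integration.integral_cong refl)
      fix \<tau>
      have "(\<lambda>s. f s * (cis ((t - s) * \<tau>) * ?g \<tau>)) = (\<lambda>s. f s * cis (- (s * \<tau>)) * (cis (t * \<tau>) * ?g \<tau>))"
      proof
        fix s
        have "cis ((t - s) * \<tau>) = cis (- (s * \<tau>)) * cis (t * \<tau>)"
          by (simp add: cis_mult algebra_simps)
        then show "f s * (cis ((t - s) * \<tau>) * ?g \<tau>) = f s * cis (- (s * \<tau>)) * (cis (t * \<tau>) * ?g \<tau>)"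
          by (simp only: mult_ac)
      qed
      then have "(LINT s|lborel. f s * (cis ((t - s) * \<tau>) * ?g \<tau>))
          = (LINT s|lborel. f s * cis (- (s * \<tau>))) * (cis (t * \<tau>) * ?g \<tau>)"
        by (simp only: integral_mult_left_zero)
      then show "ft f \<tau> * cis (t * \<tau>) * ?g \<tau> = c * (LINT s|lborel. f s * (cis ((t - s) * \<tau>) * ?g \<tau>))"
        by (simp add: ft_def c_def mult_ac)
    qed
    also have "\<dots> = c * (LINT \<tau>|lborel. (LINT s|lborel. f s * (cis ((t - s) * \<tau>) * ?g \<tau>)))"
      by (rule integral_mult_right_zero)
    also have "(LINT \<tau>|lborel. (LINT s|lborel. f s * (cis ((t - s) * \<tau>) * ?g \<tau>)))
        = (LINT s|lborel. (LINT \<tau>|lborel. f s * (cis ((t - s) * \<tau>) * ?g \<tau>)))"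
    proof (rule lborel_pair.Fubini_integral)
      have "integrable lborel ?g" using integrable_gaussian_scaled[of \<delta>] \<delta> by simp
      then show "integrable (lborel \<Otimes>\<^sub>M lborel) (\<lambda>(s, \<tau>). f s * (cis ((t - s) * \<tau>) * ?g \<tau>))"
        by (intro integrable_product_bound[OF _ f, where g = ?g]) (auto simp: norm_mult)
    qed
    also have "\<dots> = (LINT s|lborel. f s * of_real (sqrt (2 * pi) / \<delta> * exp (- ((t - s) / \<delta>)\<^sup>2 / 2)))"
      by (simp only: integral_mult_right_zero gaussian_integral_cis[OF \<delta>])
    also have "\<dots> = \<bar>\<delta>\<bar> *\<^sub>R (LINT y|lborel. f (t + \<delta> * y) * of_real (sqrt (2 * pi) / \<delta> * exp (- ((t - (t + \<delta> * y)) / \<delta>)\<^sup>2 / 2)))"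
      using \<delta> by (intro lborel_integral_real_affine) auto
    also have "(\<lambda>y. f (t + \<delta> * y) * complex_of_real (sqrt (2 * pi) / \<delta> * exp (- ((t - (t + \<delta> * y)) / \<delta>)\<^sup>2 / 2)))
        = (\<lambda>y. of_real (sqrt (2 * pi) / \<delta>) * (f (t + \<delta> * y) * of_real (exp (- y\<^sup>2 / 2))))"
      using \<delta> by (intro ext) simp
    also have "(LINT y|lborel. of_real (sqrt (2 * pi) / \<delta>) * (f (t + \<delta> * y) * complex_of_real (exp (- y\<^sup>2 / 2))))
        = of_real (sqrt (2 * pi) / \<delta>) * (LINT y|lborel. f (t + \<delta> * y) * of_real (exp (- y\<^sup>2 / 2)))"
      by (rule integral_mult_right_zero)
    finally show ?thesis
      using \<delta> by (simp add: c_def scaleR_conv_of_real)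
  qed
  define \<delta> where "\<delta> n = 1 / real (Suc n)" for n
  have \<delta>0: "0 < \<delta> n" for n by (simp add: \<delta>_def)
  have \<delta>lim: "\<delta> \<longlonglongrightarrow> 0"
    unfolding \<delta>_def[abs_def] using LIMSEQ_inverse_real_of_nat by (simp add: inverse_eq_divide)
  have L: "(\<lambda>n. LINT \<tau>|lborel. ft f \<tau> * cis (t * \<tau>) * of_real (exp (- (\<delta> n * \<tau>)\<^sup>2 / 2)))
      \<longlonglongrightarrow> (LINT \<tau>|lborel. ft f \<tau> * cis (t * \<tau>))"
  proof (rule integral_dominated_convergence[where w = "\<lambda>\<tau>. norm (ft f \<tau>)"])
    show "AE \<tau> in lborel. (\<lambda>n. ft f \<tau> * cis (t * \<tau>) * of_real (exp (- (\<delta> n * \<tau>)\<^sup>2 / 2))) \<longlonglongrightarrow> ft f \<tau> * cis (t * \<tau>)"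
    proof (intro AE_I2)
      fix \<tau>
      have "(\<lambda>n. ft f \<tau> * cis (t * \<tau>) * of_real (exp (- (\<delta> n * \<tau>)\<^sup>2 / 2))) \<longlonglongrightarrow> ft f \<tau> * cis (t * \<tau>) * of_real (exp (- (0 * \<tau>)\<^sup>2 / 2))"
        by (intro tendsto_intros \<delta>lim) simp
      then show "(\<lambda>n. ft f \<tau> * cis (t * \<tau>) * of_real (exp (- (\<delta> n * \<tau>)\<^sup>2 / 2))) \<longlonglongrightarrow> ft f \<tau> * cis (t * \<tau>)"
        by simp
    qed
    show "integrable lborel (\<lambda>\<tau>. norm (ft f \<tau>))" using ff by simp
    show "AE \<tau> in lborel. norm (ft f \<tau> * cis (t * \<tau>) * of_real (exp (- (\<delta> n * \<tau>)\<^sup>2 / 2))) \<le> norm (ft f \<tau>)" for n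
      by (intro AE_I2) (auto simp: norm_mult intro!: mult_left_le)
  qed measurable
  have R: "(\<lambda>n. LINT y|lborel. f (t + \<delta> n * y) * of_real (exp (- y\<^sup>2 / 2)))
      \<longlonglongrightarrow> (LINT y|lborel. f t * complex_of_real (exp (- y\<^sup>2 / 2)))"
  proof (rule integral_dominated_convergence[where w = "\<lambda>y. B * exp (- y\<^sup>2 / 2)"])
    show "AE y in lborel. (\<lambda>n. f (t + \<delta> n * y) * of_real (exp (- y\<^sup>2 / 2))) \<longlonglongrightarrow> f t * of_real (exp (- y\<^sup>2 / 2))"
    proof (intro AE_I2 tendsto_intros)
      fix y
      have "(\<lambda>n. t + \<delta> n * y) \<longlonglongrightarrow> t + 0 * y"
        by (intro tendsto_intros \<delta>lim)
      then show "(\<lambda>n. f (t + \<delta> n * y)) \<longlonglongrightarrow> f t"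
        using cont by (auto intro!: isCont_tendsto_compose[of t f] simp: continuous_on_eq_continuous_at)
    qed
    show "integrable lborel (\<lambda>y. B * exp (- y\<^sup>2 / 2))"
      by (intro integrable_mult_right integrable_gaussian)
    show "AE y in lborel. norm (f (t + \<delta> n * y) * of_real (exp (- y\<^sup>2 / 2))) \<le> B * exp (- y\<^sup>2 / 2)" for n
      by (intro AE_I2) (auto simp: norm_mult intro!: mult_right_mono B)
  qed measurable
  have "(LINT \<tau>|lborel. ft f \<tau> * cis (t * \<tau>)) = (LINT y|lborel. f t * complex_of_real (exp (- y\<^sup>2 / 2)))"
    using L[unfolded key[OF \<delta>0]] R by (rule LIMSEQ_unique)
  also have "\<dots> = f t * of_real (sqrt (2 * pi))"
    by (simp only: integral_mult_right_zero integral_complex_of_real integral_gaussian)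
  finally show ?thesis by simp
qed

text \<open>
  Only the first factor is expanded by Fourier inversion; the second one has to be no more than
  integrable, which allows it to be a product itself when the lemma is iterated.
\<close>

lemma ft_mult:
  assumes cont: "continuous_on UNIV f" and f: "integrable lborel f" and bdd: "bounded (range f)"
    and ff: "integrable lborel (ft f)" and g: "integrable lborel g"
  shows "ft (\<lambda>t. f t * g t) \<tau> = 1 / sqrt (2 * pi) * (LINT \<rho>|lborel. ft f \<rho> * ft g (\<tau> - \<rho>))"
proof -
  have [measurable]: "f \<in> borel_measurable borel" "g \<in> borel_measurable borel"
    using f g by auto
  define c where "c = complex_of_real (1 / sqrt (2 * pi))"
  have "(LINT t|lborel. f t * g t * cis (- (t * \<tau>)))
      = (LINT t|lborel. c * (LINT \<rho>|lborel. ft f \<rho> * (g t * cis (- (t * (\<tau> - \<rho>))))))"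
  proof (intro Bochner_Integration.integral_cong refl)
    fix t
    have "(\<lambda>\<rho>. ft f \<rho> * (g t * cis (- (t * (\<tau> - \<rho>))))) = (\<lambda>\<rho>. ft f \<rho> * cis (t * \<rho>) * (g t * cis (- (t * \<tau>))))"
      by (simp add: cis_mult algebra_simps)
    then have "(LINT \<rho>|lborel. ft f \<rho> * (g t * cis (- (t * (\<tau> - \<rho>)))))
        = (LINT \<rho>|lborel. ft f \<rho> * cis (t * \<rho>)) * (g t * cis (- (t * \<tau>)))"
      by (simp only: integral_mult_left_zero)
    moreover have "f t = c * (LINT \<rho>|lborel. ft f \<rho> * cis (t * \<rho>))"
      using fourier_inversion[OF cont f bdd ff, of t] by (simp add: c_def)
    ultimately show "f t * g t * cis (- (t * \<tau>)) = c * (LINT \<rho>|lborel. ft f \<rho> * (g t * cis (- (t * (\<tau> - \<rho>)))))"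
      by (simp add: mult.assoc)
  qed
  also have "\<dots> = c * (LINT t|lborel. (LINT \<rho>|lborel. ft f \<rho> * (g t * cis (- (t * (\<tau> - \<rho>))))))"
    by (rule integral_mult_right_zero)
  also have "(LINT t|lborel. (LINT \<rho>|lborel. ft f \<rho> * (g t * cis (- (t * (\<tau> - \<rho>))))))
      = (LINT \<rho>|lborel. (LINT t|lborel. ft f \<rho> * (g t * cis (- (t * (\<tau> - \<rho>))))))"
    by (rule lborel_pair.Fubini_integral)
       (auto intro!: integrable_product_bound[OF _ ff g] simp: norm_mult)
  also have "\<dots> = (LINT \<rho>|lborel. ft f \<rho> * (LINT t|lborel. g t * cis (- (t * (\<tau> - \<rho>)))))"
    by (simp only: integral_mult_right_zero)
  also have "c * \<dots> = (LINT \<rho>|lborel. c * (ft f \<rho> * (LINT t|lborel. g t * cis (- (t * (\<tau> - \<rho>))))))"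
    by (rule integral_mult_right_zero[symmetric])
  also have "(\<lambda>\<rho>. c * (ft f \<rho> * (LINT t|lborel. g t * cis (- (t * (\<tau> - \<rho>)))))) = (\<lambda>\<rho>. ft f \<rho> * ft g (\<tau> - \<rho>))"
    by (simp add: ft_def[of g] c_def fun_eq_iff)
  finally show ?thesis by (simp add: ft_def[of "\<lambda>t. f t * g t"])
qed

lemma norm_ft_mult_le:
  assumes "continuous_on UNIV f" "integrable lborel f" "bounded (range f)" "integrable lborel (ft f)" "integrable lborel g"
  shows "ennreal (cmod (ft (\<lambda>t. f t * g t) \<tau>)) \<le> (\<integral>\<^sup>+ \<rho>. ennreal (cmod (ft f \<rho>) * cmod (ft g (\<tau> - \<rho>))) \<partial>lborel)"
proof -
  have "cmod (ft (\<lambda>t. f t * g t) \<tau>) \<le> 1 * cmod (LINT \<rho>|lborel. ft f \<rho> * ft g (\<tau> - \<rho>))"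
    unfolding ft_mult[OF assms] using norm_ft_factor
    by (simp only: norm_mult of_real_divide of_real_1) (intro mult_right_mono, auto)
  then have "ennreal (cmod (ft (\<lambda>t. f t * g t) \<tau>)) \<le> ennreal (cmod (LINT \<rho>|lborel. ft f \<rho> * ft g (\<tau> - \<rho>)))"
    by (intro ennreal_leI) simp
  also have "\<dots> \<le> (\<integral>\<^sup>+ \<rho>. ennreal (cmod (ft f \<rho> * ft g (\<tau> - \<rho>))) \<partial>lborel)"
  proof (cases "integrable lborel (\<lambda>\<rho>. ft f \<rho> * ft g (\<tau> - \<rho>))")
    case True
    then show ?thesis by (rule integral_norm_bound_ennreal)
  qed (simp add: not_integrable_integral_eq)
  finally show ?thesis by (simp add: norm_mult)
qed

lemma ft_cnj: "ft (\<lambda>t. cnj (f t)) \<tau> = cnj (ft f (- \<tau>))"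
proof -
  have "(\<lambda>t. cnj (f t) * cis (- (t * \<tau>))) = (\<lambda>t. cnj (f t * cis (- (t * - \<tau>))))"
    by (simp add: cis_cnj)
  then have "(LINT t|lborel. cnj (f t) * cis (- (t * \<tau>))) = cnj (LINT t|lborel. f t * cis (- (t * - \<tau>)))"
    by (simp only: Bochner_Integration.integral_cnj)
  then show ?thesis
    unfolding ft_def by (simp only: complex_cnj_mult) simp
qed

lemma norm_ft_triple_le:
  assumes f: "continuous_on UNIV f" "integrable lborel f" "bounded (range f)" "integrable lborel (ft f)"
    and g: "continuous_on UNIV g" "integrable lborel g" "bounded (range g)" "integrable lborel (ft g)"
    and h: "continuous_on UNIV h" "integrable lborel h"
  shows "ennreal (cmod (ft (\<lambda>t. f t * g t * cnj (h t)) \<tau>))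
    \<le> (\<integral>\<^sup>+ t1. (\<integral>\<^sup>+ t2. ennreal (cmod (ft f t1) * cmod (ft g t2) * cmod (ft h (t1 + t2 - \<tau>))) \<partial>lborel) \<partial>lborel)"
proof -
  have [measurable]: "f \<in> borel_measurable borel" "g \<in> borel_measurable borel" "h \<in> borel_measurable borel"
    using f g h by auto
  have ch: "integrable lborel (\<lambda>t. cnj (h t))" using h by simp
  have [measurable]: "(\<lambda>t. cnj (h t)) \<in> borel_measurable borel"
    using borel_measurable_integrable[OF ch] by simp
  obtain B where B: "\<And>s. norm (g s) \<le> B" using g(3) by (auto simp: bounded_iff)
  have gch: "integrable lborel (\<lambda>t. g t * cnj (h t))"
  proof (rule Bochner_Integration.integrable_bound)
    show "integrable lborel (\<lambda>t. B *\<^sub>R h t)" using h by simp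
    have "0 \<le> B" using B[of 0] norm_ge_zero order.trans by blast
    then show "AE t in lborel. norm (g t * cnj (h t)) \<le> norm (B *\<^sub>R h t)"
      by (intro AE_I2) (auto simp: norm_mult intro!: mult_right_mono B)
  qed measurable
  have "ennreal (cmod (ft (\<lambda>t. f t * (g t * cnj (h t))) \<tau>))
      \<le> (\<integral>\<^sup>+ t1. ennreal (cmod (ft f t1) * cmod (ft (\<lambda>t. g t * cnj (h t)) (\<tau> - t1))) \<partial>lborel)"
    by (rule norm_ft_mult_le[OF f gch])
  also have "\<dots> \<le> (\<integral>\<^sup>+ t1. (\<integral>\<^sup>+ t2. ennreal (cmod (ft f t1) * cmod (ft g t2) * cmod (ft h (t1 + t2 - \<tau>))) \<partial>lborel) \<partial>lborel)"
  proof (intro nn_integral_mono)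
    fix t1
    have "ennreal (cmod (ft f t1) * cmod (ft (\<lambda>t. g t * cnj (h t)) (\<tau> - t1)))
        = ennreal (cmod (ft f t1)) * ennreal (cmod (ft (\<lambda>t. g t * cnj (h t)) (\<tau> - t1)))"
      by (simp add: ennreal_mult)
    also have "\<dots> \<le> ennreal (cmod (ft f t1)) * (\<integral>\<^sup>+ t2. ennreal (cmod (ft g t2) * cmod (ft (\<lambda>t. cnj (h t)) (\<tau> - t1 - t2))) \<partial>lborel)"
      by (intro mult_left_mono norm_ft_mult_le g ch) simp
    also have "\<dots> = (\<integral>\<^sup>+ t2. ennreal (cmod (ft f t1)) * ennreal (cmod (ft g t2) * cmod (ft (\<lambda>t. cnj (h t)) (\<tau> - t1 - t2))) \<partial>lborel)"
      by (rule nn_integral_cmult[symmetric]) measurable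
    also have "\<dots> = (\<integral>\<^sup>+ t2. ennreal (cmod (ft f t1) * cmod (ft g t2) * cmod (ft h (t1 + t2 - \<tau>))) \<partial>lborel)"
      by (intro nn_integral_cong) (simp add: ft_cnj ennreal_mult'[symmetric] mult.assoc algebra_simps)
    finally show "ennreal (cmod (ft f t1) * cmod (ft (\<lambda>t. g t * cnj (h t)) (\<tau> - t1)))
        \<le> (\<integral>\<^sup>+ t2. ennreal (cmod (ft f t1) * cmod (ft g t2) * cmod (ft h (t1 + t2 - \<tau>))) \<partial>lborel)" .
  qed
  finally show ?thesis by (simp add: mult.assoc)
qed

section \<open>Countable sums of functions\<close>

lemma infsum_eq_suminf_enum:
  fixes f :: "'i::countable \<Rightarrow> 'b::banach"
  assumes "infinite (UNIV :: 'i set)" "(\<lambda>i. norm (f i)) summable_on UNIV"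
  shows "infsum f UNIV = (\<Sum>n. f (from_nat_into UNIV n))"
proof -
  have "bij_betw (from_nat_into (UNIV :: 'i set)) UNIV UNIV"
    by (rule bij_betw_from_nat_into) (use assms in auto)
  moreover have "(f has_sum infsum f UNIV) UNIV"
    using Infinite_Sum.abs_summable_summable[OF assms(2)] by (rule has_sum_infsum)
  ultimately have "((\<lambda>n. f (from_nat_into UNIV n)) has_sum infsum f UNIV) UNIV"
    by (simp add: has_sum_reindex_bij_betw)
  then show ?thesis
    by (rule sums_unique[OF has_sum_imp_sums])
qed

lemma summable_enum:
  fixes B :: "'i::countable \<Rightarrow> real"
  assumes "infinite (UNIV :: 'i set)" "B summable_on UNIV"
  shows "summable (\<lambda>n. B (from_nat_into UNIV n))"
proof -
  have "bij_betw (from_nat_into (UNIV :: 'i set)) UNIV UNIV"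
    by (rule bij_betw_from_nat_into) (use assms in auto)
  with assms(2) have "(\<lambda>n. B (from_nat_into UNIV n)) summable_on UNIV"
    by (simp add: summable_on_reindex_bij_betw)
  then show ?thesis by (rule summable_on_imp_summable)
qed

lemma
  fixes f :: "'i::countable \<Rightarrow> 'a \<Rightarrow> complex"
  assumes inf: "infinite (UNIV :: 'i set)"
    and m: "\<And>i. f i \<in> borel_measurable M"
    and bd: "\<And>i x. cmod (f i x) \<le> B i * w x"
    and B: "B summable_on UNIV" "\<And>i. 0 \<le> B i"
    and w: "integrable M w" "\<And>x. 0 \<le> w x"
  shows integral_infsum: "(LINT x|M. (\<Sum>\<^sub>\<infinity>i. f i x)) = (\<Sum>\<^sub>\<infinity>i. LINT x|M. f i x)"
    and integrals_abs_summable: "(\<lambda>i. cmod (LINT x|M. f i x)) summable_on UNIV"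
proof -
  have f: "integrable M (f i)" for i
  proof (rule Bochner_Integration.integrable_bound)
    show "integrable M (\<lambda>x. B i * w x)" using w by simp
    show "AE x in M. cmod (f i x) \<le> norm (B i * w x)"
      using bd B(2) w(2) by (intro AE_I2) simp
  qed (rule m)
  have nf: "(LINT x|M. cmod (f i x)) \<le> B i * (LINT x|M. w x)" for i
  proof -
    have "(LINT x|M. cmod (f i x)) \<le> (LINT x|M. B i * w x)"
      using f w by (intro integral_mono bd) auto
    then show ?thesis by simp
  qed
  have BI: "(\<lambda>i. B i * (LINT x|M. w x)) summable_on UNIV"
    using B(1) by (rule summable_on_cmult_left)
  show s: "(\<lambda>i. cmod (LINT x|M. f i x)) summable_on UNIV"
    by (rule Infinite_Sum.abs_summable_on_comparison_test'[OF BI]) (meson integral_norm_bound nf order.trans)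
  let ?g = "from_nat_into (UNIV :: 'i set)"
  have ps: "(\<lambda>i. cmod (f i x)) summable_on UNIV" for x
    by (rule Infinite_Sum.abs_summable_on_comparison_test'[OF summable_on_cmult_left[OF B(1), of "w x"]]) (rule bd)
  have "(LINT x|M. (\<Sum>\<^sub>\<infinity>i. f i x)) = (LINT x|M. (\<Sum>n. f (?g n) x))"
    by (intro Bochner_Integration.integral_cong refl infsum_eq_suminf_enum inf ps)
  also have "\<dots> = (\<Sum>n. LINT x|M. f (?g n) x)"
  proof (rule integral_suminf)
    show "AE x in M. summable (\<lambda>n. cmod (f (?g n) x))"
      by (intro AE_I2 summable_enum[OF inf] ps)
    have "summable (\<lambda>n. B (?g n) * (LINT x|M. w x))"
      by (rule summable_enum[OF inf BI])
    then show "summable (\<lambda>n. LINT x|M. cmod (f (?g n) x))"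
      by (rule summable_comparison_test') (use nf in auto)
  qed (rule f)
  also have "\<dots> = (\<Sum>\<^sub>\<infinity>i. LINT x|M. f i x)"
    by (rule infsum_eq_suminf_enum[symmetric, OF inf s])
  finally show "(LINT x|M. (\<Sum>\<^sub>\<infinity>i. f i x)) = (\<Sum>\<^sub>\<infinity>i. LINT x|M. f i x)" .
qed

lemma ennreal_infsum_eq_nn_integral:
  fixes f :: "'i \<Rightarrow> real"
  assumes "f summable_on UNIV" "\<And>i. 0 \<le> f i"
  shows "ennreal (infsum f UNIV) = (\<integral>\<^sup>+ i. ennreal (f i) \<partial>count_space UNIV)"
proof -
  have "Infinite_Set_Sum.abs_summable_on f UNIV"
    unfolding abs_summable_equivalent[symmetric] using assms by simp
  then show ?thesis
    using assms nn_integral_conv_infsetsum[of f UNIV] infsetsum_infsum[of f UNIV] by simp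
qed

lemma infsum_diff_banach:
  fixes f g :: "'i \<Rightarrow> complex"
  assumes "f summable_on A" "g summable_on A"
  shows "infsum (\<lambda>i. f i - g i) A = infsum f A - infsum g A"
  using infsum_add[OF assms(1) summable_on_uminus[THEN iffD2, OF assms(2)]] by (simp add: infsum_uminus)

text \<open>
  The difference quotients of the partial sums converge uniformly by the Weierstrass test,
  with majorant \<open>2 B\<close> by the mean value inequality, so the limits may be exchanged.
\<close>

lemma has_derivative_infsum:
  fixes f :: "'i \<Rightarrow> 'a::real_normed_vector \<Rightarrow> complex"
  assumes der: "\<And>i y. (f i has_derivative f' i y) (at y)"
    and bd: "\<And>i y h. norm (f' i y h) \<le> B i * norm h"
    and B: "B summable_on UNIV" and B0: "\<And>i. 0 \<le> B i"
    and sm: "\<And>y. (\<lambda>i. cmod (f i y)) summable_on UNIV"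
  shows "((\<lambda>y. \<Sum>\<^sub>\<infinity>i. f i y) has_derivative (\<lambda>h. \<Sum>\<^sub>\<infinity>i. f' i x h)) (at x)"
proof -
  have smy: "(\<lambda>i. f i y) summable_on UNIV" for y
    by (rule Infinite_Sum.abs_summable_summable[OF sm])
  have sm'a: "(\<lambda>i. cmod (f' i x h)) summable_on UNIV" for h
    by (rule Infinite_Sum.abs_summable_on_comparison_test'[OF summable_on_cmult_left[OF B, of "norm h"]]) (rule bd)
  then have sm': "(\<lambda>i. f' i x h) summable_on UNIV" for h
    by (rule abs_summable_summable)
  have lin: "linear (f' i x)" for i
    using der has_derivative_linear by blast
  have lip: "norm (f i (x + h) - f i x) \<le> B i * norm h" for i h
  proof -
    have "norm (f i (x + h) - f i x) \<le> B i * norm (x + h - x)"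
    proof (rule differentiable_bound[of UNIV])
      show "(f i has_derivative f' i y) (at y within UNIV)" for y using der by simp
      show "onorm (f' i y) \<le> B i" for y
        by (rule onorm_bound[OF B0 bd])
    qed auto
    then show ?thesis by simp
  qed
  define q where "q i h = of_real (1 / norm h) * (f i (x + h) - f i x - f' i x h)" for i h
  have nq: "norm (q i h) = norm (f i (x + h) - f i x - f' i x h) / norm h" for i h
    by (simp add: q_def norm_mult norm_divide)
  have q: "norm (q i h) \<le> 2 * B i" for i h
  proof (cases "h = 0")
    case False
    have "norm (f i (x + h) - f i x - f' i x h) \<le> B i * norm h + B i * norm h"
      by (rule order.trans[OF norm_triangle_ineq4]) (intro add_mono lip bd)
    then show ?thesis using False by (simp add: nq pos_divide_le_eq)
  qed (simp add: q_def B0)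
  have "((\<lambda>h. \<Sum>\<^sub>\<infinity>i. q i h) \<longlongrightarrow> 0) (at 0)"
  proof (rule swap_uniform_limit)
    show "uniform_limit UNIV (\<lambda>F h. \<Sum>i\<in>F. q i h) (\<lambda>h. \<Sum>\<^sub>\<infinity>i. q i h) (finite_subsets_at_top UNIV)"
      by (rule Weierstrass_m_test_general[OF q]) (rule summable_on_cmult_right[OF B])
    have "(q i \<longlongrightarrow> 0) (at 0)" for i
    proof -
      have "((\<lambda>h. norm (q i h)) \<longlongrightarrow> 0) (at 0)"
        using der[of i x] unfolding has_derivative_at nq by blast
      then show ?thesis by (rule tendsto_norm_zero_cancel)
    qed
    then show "\<forall>\<^sub>F F in finite_subsets_at_top UNIV. ((\<lambda>h. \<Sum>i\<in>F. q i h) \<longlongrightarrow> 0) (at 0)"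
      by (intro always_eventually allI tendsto_null_sum)
  qed auto
  moreover have "(\<Sum>\<^sub>\<infinity>i. q i h) = of_real (1 / norm h) * ((\<Sum>\<^sub>\<infinity>i. f i (x + h)) - (\<Sum>\<^sub>\<infinity>i. f i x) - (\<Sum>\<^sub>\<infinity>i. f' i x h))" for h
  proof -
    have "(\<lambda>i. f i (x + h) - f i x) summable_on UNIV"
      using summable_on_add[OF smy[of "x + h"] summable_on_uminus[THEN iffD2, OF smy[of x]]] by simp
    then show ?thesis
      unfolding q_def by (simp only: infsum_cmult_right' infsum_diff_banach smy sm')
  qed
  ultimately have "((\<lambda>h. norm (of_real (1 / norm h) * ((\<Sum>\<^sub>\<infinity>i. f i (x + h)) - (\<Sum>\<^sub>\<infinity>i. f i x) - (\<Sum>\<^sub>\<infinity>i. f' i x h)))) \<longlongrightarrow> 0) (at 0)"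
    by (simp only: tendsto_norm_zero)
  moreover have "bounded_linear (\<lambda>h. \<Sum>\<^sub>\<infinity>i. f' i x h)"
  proof (rule bounded_linear_intro)
    show "(\<Sum>\<^sub>\<infinity>i. f' i x (g + h)) = (\<Sum>\<^sub>\<infinity>i. f' i x g) + (\<Sum>\<^sub>\<infinity>i. f' i x h)" for g h
      using infsum_add[OF sm'[of g] sm'[of h]] by (simp add: linear_add[OF lin])
    show "(\<Sum>\<^sub>\<infinity>i. f' i x (c *\<^sub>R h)) = c *\<^sub>R (\<Sum>\<^sub>\<infinity>i. f' i x h)" for c h
      by (simp add: linear_scale[OF lin] scaleR_conv_of_real infsum_cmult_right')
    fix h
    have "norm (\<Sum>\<^sub>\<infinity>i. f' i x h) \<le> (\<Sum>\<^sub>\<infinity>i. norm (f' i x h))"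
      by (rule norm_infsum_bound[OF sm'a])
    also have "\<dots> \<le> (\<Sum>\<^sub>\<infinity>i. B i * norm h)"
      by (intro infsum_mono sm'a summable_on_cmult_left[OF B] bd)
    also have "\<dots> = norm h * (\<Sum>\<^sub>\<infinity>i. B i)"
      by (simp add: infsum_cmult_left' mult.commute)
    finally show "norm (\<Sum>\<^sub>\<infinity>i. f' i x h) \<le> norm h * (\<Sum>\<^sub>\<infinity>i. B i)" .
  qed
  ultimately show ?thesis
    unfolding has_derivative_at by (simp add: norm_mult norm_divide)
qed

section \<open>Rapidly decreasing coefficient families\<close>

type_synonym coeffs = "int \<Rightarrow> real \<Rightarrow> complex"

text \<open>
  Unlike \<open>bracket\<close>, this weight is submultiplicative with constant \<open>1\<close>.
\<close>

definition wt :: "real \<Rightarrow> real" where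
  "wt y = 1 + \<bar>y\<bar>"

lemma wt_ge_1: "1 \<le> wt y" and wt_pos [simp]: "0 < wt y" and wt_nonneg [simp]: "0 \<le> wt y"
  and wt_neq_0 [simp]: "wt y \<noteq> 0"
  by (auto simp: wt_def)

lemma wt_measurable [measurable]: "wt \<in> borel_measurable borel"
  unfolding wt_def[abs_def] by measurable

lemma wt_add_le: "wt (x + y) \<le> wt x * wt y"
proof -
  have "wt x * wt y = 1 + \<bar>x\<bar> + \<bar>y\<bar> + \<bar>x\<bar> * \<bar>y\<bar>"
    by (simp add: wt_def algebra_simps)
  then show ?thesis
    using abs_triangle_ineq[of x y] by (simp add: wt_def add_increasing2)
qed

lemma wt_power_le: "wt y ^ N \<le> 2 ^ N * (1 + \<bar>y\<bar> ^ N)"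
proof (cases "\<bar>y\<bar> \<le> 1")
  case True
  then have "wt y ^ N \<le> 2 ^ N * 1" by (simp add: power_mono wt_def)
  also have "\<dots> \<le> 2 ^ N * (1 + \<bar>y\<bar> ^ N)" by (intro mult_left_mono) auto
  finally show ?thesis .
next
  case False
  then have "wt y ^ N \<le> (2 * \<bar>y\<bar>) ^ N" by (intro power_mono) (auto simp: wt_def)
  also have "\<dots> \<le> 2 ^ N * (1 + \<bar>y\<bar> ^ N)" by (simp add: power_mult_distrib)
  finally show ?thesis .
qed

lemma bracket_le_wt: "bracket y \<le> wt y"
proof -
  have "1 + y\<^sup>2 \<le> (wt y)\<^sup>2"
    by (simp add: wt_def power2_eq_square algebra_simps)
  then show ?thesis
    unfolding bracket_def by (intro real_le_lsqrt) auto
qed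

definition decay :: "real \<Rightarrow> real" where
  "decay y = 1 / (wt y)\<^sup>2"

lemma decay_pos [simp]: "0 < decay y" and decay_nonneg [simp]: "0 \<le> decay y"
  by (auto simp: decay_def)

lemma decay_le_1: "decay y \<le> 1"
  using wt_ge_1[of y] by (simp add: decay_def one_le_power)

lemma decay_measurable [measurable]: "decay \<in> borel_measurable borel"
  unfolding decay_def[abs_def] by measurable

lemma decay_le_bracket: "decay y \<le> bracket y powr (- 2)"
proof -
  have "(bracket y)\<^sup>2 \<le> (wt y)\<^sup>2"
    by (intro power_mono bracket_le_wt) auto
  then show ?thesis
    by (simp add: decay_def powr_minus powr_numeral divide_simps)
qed

lemma integrable_decay: "integrable lborel decay"
proof (rule integrableI_bounded)
  have "(\<integral>\<^sup>+ y. ennreal (norm (decay y)) \<partial>lborel) \<le> (\<integral>\<^sup>+ y. ennreal (bracket y powr (- 2)) \<partial>lborel)"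
    by (intro nn_integral_mono ennreal_leI) (simp add: decay_le_bracket)
  also have "\<dots> < \<infinity>" by (rule nn_integral_bracket_finite) simp
  finally show "(\<integral>\<^sup>+ y. ennreal (norm (decay y)) \<partial>lborel) < \<infinity>" .
qed simp

lemma summable_decay: "(\<lambda>n::int. decay (of_int n)) summable_on UNIV"
proof -
  obtain C where "\<forall>\<mu>. (\<integral>\<^sup>+ n. ennreal (bracket (\<mu> - 2 * of_int n) powr (- 2)) \<partial>count_space (UNIV::int set)) \<le> ennreal C"
    using sum_bracket_bounded[of 2] by auto
  then have C: "(\<integral>\<^sup>+ n. ennreal (bracket (0 - 2 * of_int n) powr (- 2)) \<partial>count_space (UNIV::int set)) \<le> ennreal C"
    by blast
  have le: "decay (of_int n) \<le> 4 * bracket (0 - 2 * of_int n) powr (- 2)" for n :: int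
  proof -
    have "(bracket (2 * of_int n))\<^sup>2 \<le> 4 * (wt (of_int n))\<^sup>2"
      by (simp add: bracket_def wt_def power2_eq_square algebra_simps)
    then have "1 / (wt (of_int n))\<^sup>2 \<le> 4 / (bracket (2 * of_int n))\<^sup>2"
      by (simp add: divide_simps mult.commute)
    moreover have "bracket (0 - 2 * of_int n) powr (- 2) = 1 / (bracket (2 * of_int n))\<^sup>2"
      by (simp add: powr_minus powr_numeral divide_simps)
    ultimately show ?thesis by (simp add: decay_def)
  qed
  have "(\<integral>\<^sup>+ n. ennreal (norm (decay (of_int n))) \<partial>count_space (UNIV::int set))
      \<le> (\<integral>\<^sup>+ n. 4 * ennreal (bracket (0 - 2 * of_int n) powr (- 2)) \<partial>count_space (UNIV::int set))"
  proof (intro nn_integral_mono)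
    fix n :: int
    have "ennreal (norm (decay (of_int n))) \<le> ennreal (4 * bracket (0 - 2 * of_int n) powr (- 2))"
      using le[of n] by (intro ennreal_leI) simp
    then show "ennreal (norm (decay (of_int n))) \<le> 4 * ennreal (bracket (0 - 2 * of_int n) powr (- 2))"
      by (simp add: ennreal_mult)
  qed
  also have "\<dots> = 4 * (\<integral>\<^sup>+ n. ennreal (bracket (0 - 2 * of_int n) powr (- 2)) \<partial>count_space (UNIV::int set))"
    by (rule nn_integral_cmult) simp
  also have "\<dots> \<le> 4 * ennreal C" by (intro mult_left_mono C) simp
  also have "\<dots> < \<infinity>" by (simp add: ennreal_mult_less_top)
  finally have "integrable (count_space UNIV) (\<lambda>n::int. decay (of_int n))"
    by (intro integrableI_bounded) auto
  then have "(\<lambda>n::int. norm (decay (of_int n))) summable_on UNIV"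
    unfolding abs_summable_equivalent Infinite_Set_Sum.abs_summable_on_def .
  then show ?thesis by simp
qed

lemma summable_decay_pair: "(\<lambda>(j, k). decay (of_int j) * decay (of_int k)) summable_on (UNIV :: (int \<times> int) set)"
proof -
  have "(\<lambda>(j, k). decay (of_int j) * decay (of_int k)) summable_on Sigma (UNIV :: int set) (\<lambda>_. UNIV :: int set)"
  proof (rule summable_on_SigmaI)
    show "((\<lambda>k::int. case (j, k) of (j, k) \<Rightarrow> decay (of_int j) * decay (of_int k)) has_sum
        decay (of_int j) * (\<Sum>\<^sub>\<infinity>k::int. decay (of_int k))) UNIV" for j :: int
      unfolding prod.case by (intro has_sum_cmult_right has_sum_infsum summable_decay)
    show "(\<lambda>j::int. decay (of_int j) * (\<Sum>\<^sub>\<infinity>k::int. decay (of_int k))) summable_on UNIV"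
      by (intro summable_on_cmult_left summable_decay)
  qed auto
  then show ?thesis by simp
qed

text \<open>
  A family \<open>a\<close> stands for the function on \<open>\<real> \<times> \<T>\<close> with Fourier coefficients \<open>a \<xi> t\<close> at time \<open>t\<close>.
  A single exponent \<open>N\<close> suffices for both weights, as these are at least \<open>1\<close>.
\<close>

definition rapid :: "coeffs \<Rightarrow> bool" where
  "rapid a \<longleftrightarrow> (\<forall>N::nat. \<exists>C. \<forall>\<xi> t. cmod (a \<xi> t) * (wt (of_int \<xi>) * wt t) ^ N \<le> C)"

lemma rapidD:
  assumes "rapid a"
  obtains C where "0 \<le> C" "\<And>\<xi> t. cmod (a \<xi> t) \<le> C / (wt (of_int \<xi>) * wt t) ^ N"
proof -
  obtain C where C: "\<And>\<xi> t. cmod (a \<xi> t) * (wt (of_int \<xi>) * wt t) ^ N \<le> C"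
    using assms unfolding rapid_def by blast
  have "0 \<le> C"
    by (rule order.trans[OF _ C[of 0 0]]) simp
  moreover have "cmod (a \<xi> t) \<le> C / (wt (of_int \<xi>) * wt t) ^ N" for \<xi> t
    using C[of \<xi> t] by (simp add: pos_le_divide_eq)
  ultimately show ?thesis by (rule that)
qed

lemma rapidI:
  assumes "\<And>N. \<exists>C. \<forall>\<xi> t. cmod (a \<xi> t) \<le> C / (wt (of_int \<xi>) * wt t) ^ N"
  shows "rapid a"
  unfolding rapid_def
proof
  fix N
  obtain C where "\<And>\<xi> t. cmod (a \<xi> t) \<le> C / (wt (of_int \<xi>) * wt t) ^ N"
    using assms by blast
  then have "cmod (a \<xi> t) * (wt (of_int \<xi>) * wt t) ^ N \<le> C" for \<xi> t
    by (simp add: pos_le_divide_eq[symmetric])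
  then show "\<exists>C. \<forall>\<xi> t. cmod (a \<xi> t) * (wt (of_int \<xi>) * wt t) ^ N \<le> C" by blast
qed

lemma rapid_add:
  assumes "rapid a" "rapid b"
  shows "rapid (\<lambda>\<xi> t. a \<xi> t + b \<xi> t)"
proof (rule rapidI)
  fix N
  obtain A where A: "\<And>\<xi> t. cmod (a \<xi> t) \<le> A / (wt (of_int \<xi>) * wt t) ^ N" using rapidD[OF assms(1)] by metis
  obtain B where B: "\<And>\<xi> t. cmod (b \<xi> t) \<le> B / (wt (of_int \<xi>) * wt t) ^ N" using rapidD[OF assms(2)] by metis
  have "cmod (a \<xi> t + b \<xi> t) \<le> (A + B) / (wt (of_int \<xi>) * wt t) ^ N" for \<xi> t
    unfolding add_divide_distrib by (rule order.trans[OF norm_triangle_ineq]) (intro add_mono A B)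
  then show "\<exists>C. \<forall>\<xi> t. cmod (a \<xi> t + b \<xi> t) \<le> C / (wt (of_int \<xi>) * wt t) ^ N" by blast
qed

lemma rapid_mult_int:
  assumes "rapid a" "\<And>\<xi>. cmod (c \<xi>) \<le> wt (of_int \<xi>)"
  shows "rapid (\<lambda>\<xi> t. c \<xi> * a \<xi> t)"
proof (rule rapidI)
  fix N
  obtain A where A: "0 \<le> A" "\<And>\<xi> t. cmod (a \<xi> t) \<le> A / (wt (of_int \<xi>) * wt t) ^ (Suc N)" using rapidD[OF assms(1)] by metis
  have "cmod (c \<xi> * a \<xi> t) \<le> A / (wt (of_int \<xi>) * wt t) ^ N" for \<xi> t
  proof -
    have "cmod (c \<xi> * a \<xi> t) \<le> wt (of_int \<xi>) * (A / (wt (of_int \<xi>) * wt t) ^ (Suc N))"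
      unfolding norm_mult by (intro mult_mono assms A) auto
    also have "\<dots> = A / (wt (of_int \<xi>) * wt t) ^ N / wt t"
      by (simp add: field_simps)
    also have "\<dots> \<le> A / (wt (of_int \<xi>) * wt t) ^ N / 1"
      using A wt_ge_1 by (intro divide_left_mono) auto
    finally show ?thesis by simp
  qed
  then show "\<exists>C. \<forall>\<xi> t. cmod (c \<xi> * a \<xi> t) \<le> C / (wt (of_int \<xi>) * wt t) ^ N" by blast
qed

definition time_deriv :: "coeffs \<Rightarrow> coeffs" where
  "time_deriv a = (\<lambda>\<xi> t. vector_derivative (a \<xi>) (at t))"

fun smooth_upto :: "nat \<Rightarrow> coeffs \<Rightarrow> bool" where
  "smooth_upto 0 a \<longleftrightarrow> rapid a"
| "smooth_upto (Suc k) a \<longleftrightarrow> rapid a \<and> (\<forall>\<xi> t. a \<xi> differentiable (at t)) \<and> smooth_upto k (time_deriv a)"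

text \<open>
  The coefficient families of test functions. Decay in \<open>\<xi>\<close> takes the place of the
  \<open>x\<close>-derivatives, so only \<open>t\<close>-derivatives occur.
\<close>

definition schwartz :: "coeffs \<Rightarrow> bool" where
  "schwartz a \<longleftrightarrow> (\<forall>k. smooth_upto k a)"

lemma smooth_upto_rapid: "smooth_upto k a \<Longrightarrow> rapid a"
  by (cases k) auto

lemma smooth_upto_SucI:
  assumes "rapid a" "\<And>\<xi> t. (a \<xi> has_vector_derivative a' \<xi> t) (at t)" "smooth_upto k a'"
  shows "smooth_upto (Suc k) a"
proof -
  have "time_deriv a = a'"
    using assms(2) by (auto simp: time_deriv_def fun_eq_iff vector_derivative_at)
  with assms show ?thesis
    by (auto intro: differentiableI_vector)
qed

lemma smooth_upto_SucD:
  assumes "smooth_upto (Suc k) a"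
  shows "(a \<xi> has_vector_derivative time_deriv a \<xi> t) (at t)" "smooth_upto k (time_deriv a)"
  using assms by (auto simp: time_deriv_def vector_derivative_works)

lemma smooth_upto_mono: "smooth_upto (Suc k) a \<Longrightarrow> smooth_upto k a"
proof (induction k arbitrary: a)
  case (Suc k)
  then show ?case by (metis smooth_upto.simps(2))
qed simp

lemma smooth_upto_add:
  "smooth_upto k a \<Longrightarrow> smooth_upto k b \<Longrightarrow> smooth_upto k (\<lambda>\<xi> t. a \<xi> t + b \<xi> t)"
proof (induction k arbitrary: a b)
  case (Suc k)
  show ?case
  proof (rule smooth_upto_SucI)
    show "rapid (\<lambda>\<xi> t. a \<xi> t + b \<xi> t)"
      by (intro rapid_add smooth_upto_rapid[OF Suc.prems(1)] smooth_upto_rapid[OF Suc.prems(2)])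
    show "((\<lambda>t. a \<xi> t + b \<xi> t) has_vector_derivative time_deriv a \<xi> t + time_deriv b \<xi> t) (at t)" for \<xi> t
      by (intro has_vector_derivative_add smooth_upto_SucD(1)[OF Suc.prems(1)] smooth_upto_SucD(1)[OF Suc.prems(2)])
    show "smooth_upto k (\<lambda>\<xi> t. time_deriv a \<xi> t + time_deriv b \<xi> t)"
      by (intro Suc.IH smooth_upto_SucD(2)[OF Suc.prems(1)] smooth_upto_SucD(2)[OF Suc.prems(2)])
  qed
qed (simp add: rapid_add)

lemma smooth_upto_mult_int:
  assumes c: "\<And>\<xi>. cmod (c \<xi>) \<le> wt (of_int \<xi>)"
  shows "smooth_upto k a \<Longrightarrow> smooth_upto k (\<lambda>\<xi> t. c \<xi> * a \<xi> t)"
proof (induction k arbitrary: a)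
  case (Suc k)
  show ?case
  proof (rule smooth_upto_SucI)
    show "rapid (\<lambda>\<xi> t. c \<xi> * a \<xi> t)"
      by (intro rapid_mult_int[OF smooth_upto_rapid[OF Suc.prems] c])
    show "((\<lambda>t. c \<xi> * a \<xi> t) has_vector_derivative c \<xi> * time_deriv a \<xi> t) (at t)" for \<xi> t
      by (intro has_vector_derivative_mult_right smooth_upto_SucD(1)[OF Suc.prems])
    show "smooth_upto k (\<lambda>\<xi> t. c \<xi> * time_deriv a \<xi> t)"
      by (intro Suc.IH smooth_upto_SucD(2)[OF Suc.prems])
  qed
qed (simp add: rapid_mult_int c)

lemma schwartz_rapid: "schwartz a \<Longrightarrow> rapid a"
  unfolding schwartz_def using smooth_upto_rapid by blast

lemma schwartz_has_vector_derivative: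
  "schwartz a \<Longrightarrow> (a \<xi> has_vector_derivative time_deriv a \<xi> t) (at t)"
  unfolding schwartz_def using smooth_upto_SucD(1) by blast

lemma schwartz_time_deriv: "schwartz a \<Longrightarrow> schwartz (time_deriv a)"
  unfolding schwartz_def using smooth_upto_SucD(2) by blast

lemma schwartz_add: "schwartz a \<Longrightarrow> schwartz b \<Longrightarrow> schwartz (\<lambda>\<xi> t. a \<xi> t + b \<xi> t)"
  unfolding schwartz_def using smooth_upto_add by blast

lemma schwartz_mult_int:
  "(\<And>\<xi>. cmod (c \<xi>) \<le> wt (of_int \<xi>)) \<Longrightarrow> schwartz a \<Longrightarrow> schwartz (\<lambda>\<xi> t. c \<xi> * a \<xi> t)"
  unfolding schwartz_def using smooth_upto_mult_int by blast

lemma schwartz_diff: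
  assumes "schwartz a" "schwartz b"
  shows "schwartz (\<lambda>\<xi> t. a \<xi> t - b \<xi> t)"
proof -
  have "schwartz (\<lambda>\<xi> t. - 1 * b \<xi> t)"
    by (rule schwartz_mult_int[OF _ assms(2)]) (simp add: wt_ge_1)
  from schwartz_add[OF assms(1) this] show ?thesis by simp
qed

lemma schwartz_continuous: "schwartz a \<Longrightarrow> continuous_on UNIV (a \<xi>)"
  using schwartz_has_vector_derivative has_vector_derivative_continuous
  by (metis continuous_at_imp_continuous_on)

lemma schwartz_measurable: "schwartz a \<Longrightarrow> a \<xi> \<in> borel_measurable borel"
  by (rule borel_measurable_continuous_onI[OF schwartz_continuous])

lemma schwartz_decay_bound:
  assumes "schwartz a"
  obtains C where "0 \<le> C" "\<And>\<xi> t. cmod (a \<xi> t) \<le> C / wt (of_int \<xi>) ^ N * decay t"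
proof -
  obtain C where C: "0 \<le> C" "\<And>\<xi> t. cmod (a \<xi> t) \<le> C / (wt (of_int \<xi>) * wt t) ^ (N + 2)"
    using rapidD[OF schwartz_rapid[OF assms]] by metis
  have le: "C / (wt (of_int \<xi>) * wt t) ^ (N + 2) \<le> C / wt (of_int \<xi>) ^ N * decay t" for \<xi> t
  proof -
    have "wt (of_int \<xi>) ^ N * (wt t)\<^sup>2 \<le> wt (of_int \<xi>) ^ (N + 2) * wt t ^ (N + 2)"
      by (intro mult_mono power_increasing wt_ge_1) auto
    then have "C / (wt (of_int \<xi>) ^ (N + 2) * wt t ^ (N + 2)) \<le> C / (wt (of_int \<xi>) ^ N * (wt t)\<^sup>2)"
      using C by (intro divide_left_mono) auto
    then show ?thesis
      by (simp only: decay_def power_mult_distrib times_divide_eq_right mult_1_right divide_divide_eq_left)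
  qed
  show ?thesis
    by (rule that[OF C(1) order.trans[OF C(2) le]])
qed

lemma schwartz_integrable:
  assumes "schwartz a"
  shows "integrable lborel (a \<xi>)"
proof -
  obtain C where C: "0 \<le> C" "\<And>\<xi> t. cmod (a \<xi> t) \<le> C / wt (of_int \<xi>) ^ 0 * decay t"
    using schwartz_decay_bound[OF assms] by metis
  show ?thesis
  proof (rule Bochner_Integration.integrable_bound)
    show "integrable lborel (\<lambda>t. C * decay t)"
      using integrable_decay by simp
    show "AE t in lborel. cmod (a \<xi> t) \<le> norm (C * decay t)"
      using C by (intro AE_I2) (auto simp: abs_mult)
  qed (use schwartz_measurable[OF assms] in simp)
qed

lemma schwartz_bounded:
  assumes "schwartz a"
  shows "bounded (range (a \<xi>))"
proof -
  obtain C where C: "0 \<le> C" "\<And>\<xi> t. cmod (a \<xi> t) \<le> C / (wt (of_int \<xi>) * wt t) ^ 0"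
    using rapidD[OF schwartz_rapid[OF assms]] by metis
  then show ?thesis by (auto simp: bounded_iff)
qed

lemma schwartz_tendsto_0:
  assumes "schwartz a"
  shows "(a \<xi> \<longlongrightarrow> 0) at_top" "(a \<xi> \<longlongrightarrow> 0) at_bot"
proof -
  obtain C where C: "0 \<le> C" "\<And>\<xi> t. cmod (a \<xi> t) \<le> C / (wt (of_int \<xi>) * wt t) ^ 1"
    using rapidD[OF schwartz_rapid[OF assms]] by metis
  have bd: "cmod (a \<xi> t) \<le> C / \<bar>t\<bar>" if "t \<noteq> 0" for t
  proof -
    have "\<bar>t\<bar> \<le> 1 * wt t" by (simp add: wt_def)
    also have "\<dots> \<le> wt (of_int \<xi>) * wt t" by (intro mult_right_mono wt_ge_1) simp
    finally have "C / (wt (of_int \<xi>) * wt t) \<le> C / \<bar>t\<bar>"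
      using C that by (intro divide_left_mono) auto
    with C(2)[of \<xi> t] show ?thesis by simp
  qed
  show "(a \<xi> \<longlongrightarrow> 0) at_top"
  proof (rule Lim_null_comparison)
    show "\<forall>\<^sub>F t in at_top. cmod (a \<xi> t) \<le> C / \<bar>t\<bar>"
      using eventually_gt_at_top[of 0] by eventually_elim (rule bd, simp)
    show "((\<lambda>t. C / \<bar>t\<bar>) \<longlongrightarrow> 0) at_top"
      by (intro tendsto_divide_0[OF tendsto_const] filterlim_at_top_imp_at_infinity filterlim_abs_real)
  qed
  show "(a \<xi> \<longlongrightarrow> 0) at_bot"
  proof (rule Lim_null_comparison)
    show "\<forall>\<^sub>F t in at_bot. cmod (a \<xi> t) \<le> C / \<bar>t\<bar>"
      using eventually_gt_at_bot[of 0] by eventually_elim (rule bd, simp)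
    have "filterlim (\<lambda>t::real. \<bar>t\<bar>) at_top at_bot"
      by (subst at_bot_mirror, subst filterlim_filtermap) (simp add: filterlim_abs_real)
    then show "((\<lambda>t. C / \<bar>t\<bar>) \<longlongrightarrow> 0) at_bot"
      by (intro tendsto_divide_0[OF tendsto_const] filterlim_at_top_imp_at_infinity)
  qed
qed

lemma has_vector_derivative_cis_linear:
  "((\<lambda>t. cis (c * t)) has_vector_derivative of_real c * \<i> * cis (c * t)) (at t)"
proof -
  have "((\<lambda>t. c * t) has_vector_derivative c) (at t)"
    unfolding has_real_derivative_iff_has_vector_derivative[symmetric]
    by (auto intro!: derivative_eq_intros)
  from vector_diff_chain_at[OF this has_vector_derivative_iexp]
  show ?thesis
    by (simp add: o_def cis_conv_exp scaleR_conv_of_real mult.assoc)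
qed

text \<open>
  Integration by parts. The boundary terms vanish, so the integral over the line of the
  derivative of \<open>a \<xi> t cis(- t \<tau>)\<close> is zero.
\<close>

lemma ft_time_deriv:
  assumes "schwartz a"
  shows "ft (time_deriv a \<xi>) \<tau> = \<i> * \<tau> * ft (a \<xi>) \<tau>"
proof -
  have i1: "integrable lborel (\<lambda>t. time_deriv a \<xi> t * cis (- (t * \<tau>)))"
    by (intro integrable_mult_cis schwartz_integrable schwartz_time_deriv assms) simp
  have i2: "integrable lborel (\<lambda>t. a \<xi> t * cis (- (t * \<tau>)))"
    by (intro integrable_mult_cis schwartz_integrable assms) simp
  let ?F = "\<lambda>t. a \<xi> t * cis (- (t * \<tau>))"
  let ?f = "\<lambda>t. time_deriv a \<xi> t * cis (- (t * \<tau>)) - \<i> * \<tau> * (a \<xi> t * cis (- (t * \<tau>)))"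
  have c1: "isCont (a \<xi>) t" and c2: "isCont (time_deriv a \<xi>) t" for t
    using schwartz_continuous[OF assms, of \<xi>] schwartz_continuous[OF schwartz_time_deriv[OF assms], of \<xi>]
    by (auto simp: continuous_on_eq_continuous_at)
  have "(LBINT t=-\<infinity>..\<infinity>. ?f t) = 0 - 0"
  proof (rule interval_integral_FTC_integrable)
    show "(?F has_vector_derivative ?f t) (at t)" for t
    proof -
      have "((\<lambda>t. cis (- (t * \<tau>))) has_vector_derivative of_real (- \<tau>) * \<i> * cis (- (t * \<tau>))) (at t)"
        using has_vector_derivative_cis_linear[of "- \<tau>" t] by (simp add: mult.commute)
      from has_vector_derivative_mult[OF schwartz_has_vector_derivative[OF assms] this]
      show ?thesis
        by (simp add: scaleR_conv_of_real algebra_simps)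
    qed
    have c3: "isCont (\<lambda>t. cis (- (t * \<tau>))) t" for t
      using has_vector_derivative_continuous[OF has_vector_derivative_cis_linear[of "- \<tau>" t]]
      by (simp add: mult.commute)
    show "isCont ?f t" for t
      by (intro continuous_intros c1 c2 c3)
    show "set_integrable lborel (einterval (- \<infinity>) \<infinity>) ?f"
      using i1 i2 by (simp add: set_integrable_def)
    have lim: "(?F \<longlongrightarrow> 0) F" if "(a \<xi> \<longlongrightarrow> 0) F" for F
    proof (rule tendsto_norm_zero_cancel)
      show "((\<lambda>t. cmod (?F t)) \<longlongrightarrow> 0) F"
        using tendsto_norm_zero[OF that] by (simp add: norm_mult)
    qed
    show "((?F \<circ> real_of_ereal) \<longlongrightarrow> 0) (at_right (- \<infinity>))"
      using lim[OF schwartz_tendsto_0(2)[OF assms]] by (simp add: ereal_tendsto_simps)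
    show "((?F \<circ> real_of_ereal) \<longlongrightarrow> 0) (at_left \<infinity>)"
      using lim[OF schwartz_tendsto_0(1)[OF assms]] by (simp add: ereal_tendsto_simps)
  qed simp
  then have "(LINT t|lborel. ?f t) = 0"
    by (simp add: interval_lebesgue_integral_def set_lebesgue_integral_def)
  also have "(LINT t|lborel. ?f t) = (LINT t|lborel. time_deriv a \<xi> t * cis (- (t * \<tau>))) - \<i> * \<tau> * (LINT t|lborel. a \<xi> t * cis (- (t * \<tau>)))"
    using i1 i2 by (subst Bochner_Integration.integral_diff) auto
  finally show ?thesis
    by (simp add: ft_def)
qed

lemma ft_decay_polynomial:
  "schwartz a \<Longrightarrow> \<exists>C\<ge>0. \<forall>\<xi> \<tau>. cmod (ft (a \<xi>) \<tau>) * wt (of_int \<xi>) ^ N * \<bar>\<tau>\<bar> ^ k \<le> C"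
proof (induction k arbitrary: a)
  case 0
  obtain C where C: "0 \<le> C" "\<And>\<xi> t. cmod (a \<xi> t) \<le> C / wt (of_int \<xi>) ^ N * decay t"
    using schwartz_decay_bound[OF 0] by metis
  define D where "D = (LINT t|lborel. decay t)"
  have D: "0 \<le> D" unfolding D_def by simp
  have "cmod (ft (a \<xi>) \<tau>) * wt (of_int \<xi>) ^ N * \<bar>\<tau>\<bar> ^ 0 \<le> C * D" for \<xi> \<tau>
  proof -
    have "cmod (ft (a \<xi>) \<tau>) = 1 / sqrt (2 * pi) * cmod (LINT t|lborel. a \<xi> t * cis (- (t * \<tau>)))"
      unfolding ft_def by (simp add: norm_mult norm_divide)
    also have "\<dots> \<le> 1 * cmod (LINT t|lborel. a \<xi> t * cis (- (t * \<tau>)))"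
      by (intro mult_right_mono norm_ft_factor) simp
    also have "\<dots> \<le> 1 * (LINT t|lborel. cmod (a \<xi> t * cis (- (t * \<tau>))))"
      by (intro mult_left_mono integral_norm_bound) simp
    also have "\<dots> \<le> 1 * (LINT t|lborel. C / wt (of_int \<xi>) ^ N * decay t)"
      using schwartz_integrable[OF 0, of \<xi>] integrable_decay C
      by (intro mult_left_mono integral_mono) (auto simp: norm_mult)
    finally have "cmod (ft (a \<xi>) \<tau>) \<le> C * D / wt (of_int \<xi>) ^ N"
      by (simp add: D_def)
    then show ?thesis by (simp add: pos_le_divide_eq)
  qed
  then show ?case using C D by (intro exI[of _ "C * D"]) auto
next
  case (Suc k)
  from Suc.IH[OF schwartz_time_deriv[OF Suc.prems]] obtain C where C: "0 \<le> C"
    "\<And>\<xi> \<tau>. cmod (ft (time_deriv a \<xi>) \<tau>) * wt (of_int \<xi>) ^ N * \<bar>\<tau>\<bar> ^ k \<le> C" by blast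
  have "cmod (ft (a \<xi>) \<tau>) * wt (of_int \<xi>) ^ N * \<bar>\<tau>\<bar> ^ Suc k \<le> C" for \<xi> \<tau>
    using C(2)[of \<xi> \<tau>] by (simp add: ft_time_deriv[OF Suc.prems] norm_mult mult_ac)
  with C(1) show ?case by blast
qed

lemma ft_decay:
  assumes "schwartz a"
  obtains C where "0 \<le> C" "\<And>\<xi> \<tau>. cmod (ft (a \<xi>) \<tau>) \<le> C / (wt (of_int \<xi>) * wt \<tau>) ^ N"
proof -
  obtain A where A: "0 \<le> A" "\<And>\<xi> \<tau>. cmod (ft (a \<xi>) \<tau>) * wt (of_int \<xi>) ^ N * \<bar>\<tau>\<bar> ^ 0 \<le> A"
    using ft_decay_polynomial[OF assms] by metis
  obtain B where B: "0 \<le> B" "\<And>\<xi> \<tau>. cmod (ft (a \<xi>) \<tau>) * wt (of_int \<xi>) ^ N * \<bar>\<tau>\<bar> ^ N \<le> B"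
    using ft_decay_polynomial[OF assms] by metis
  have "cmod (ft (a \<xi>) \<tau>) \<le> (2 ^ N * (A + B)) / (wt (of_int \<xi>) * wt \<tau>) ^ N" for \<xi> \<tau>
  proof -
    have "cmod (ft (a \<xi>) \<tau>) * wt (of_int \<xi>) ^ N * wt \<tau> ^ N \<le> cmod (ft (a \<xi>) \<tau>) * wt (of_int \<xi>) ^ N * (2 ^ N * (1 + \<bar>\<tau>\<bar> ^ N))"
      by (intro mult_left_mono wt_power_le) auto
    also have "\<dots> = 2 ^ N * (cmod (ft (a \<xi>) \<tau>) * wt (of_int \<xi>) ^ N * \<bar>\<tau>\<bar> ^ 0 + cmod (ft (a \<xi>) \<tau>) * wt (of_int \<xi>) ^ N * \<bar>\<tau>\<bar> ^ N)"
      by (simp add: algebra_simps)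
    also have "\<dots> \<le> 2 ^ N * (A + B)"
      by (intro mult_left_mono add_mono A B) auto
    finally show ?thesis
      by (simp add: pos_le_divide_eq power_mult_distrib mult.assoc)
  qed
  moreover have "0 \<le> 2 ^ N * (A + B)" using A B by simp
  ultimately show ?thesis using that by blast
qed

lemma ft_integrable:
  assumes "schwartz a"
  shows "integrable lborel (ft (a \<xi>))"
proof -
  obtain C where C: "0 \<le> C" "\<And>\<xi> \<tau>. cmod (ft (a \<xi>) \<tau>) \<le> C / (wt (of_int \<xi>) * wt \<tau>) ^ 2"
    using ft_decay[OF assms] by metis
  show ?thesis
  proof (rule Bochner_Integration.integrable_bound)
    show "integrable lborel (\<lambda>t. (C / (wt (of_int \<xi>))\<^sup>2) * decay t)"
      using integrable_decay by simp
    show "AE \<tau> in lborel. cmod (ft (a \<xi>) \<tau>) \<le> norm ((C / (wt (of_int \<xi>))\<^sup>2) * decay \<tau>)"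
      using C by (intro AE_I2) (auto simp: abs_mult decay_def power_mult_distrib)
  qed (use schwartz_measurable[OF assms] in simp)
qed

text \<open>
  This makes the real-valued norms meaningful, since \<open>enn2real\<close> maps \<open>\<infinity>\<close> to \<open>0\<close>.
\<close>

lemma wnorm_schwartz_finite:
  assumes a: "schwartz a" and p: "1 \<le> p"
  shows "wnorm p b (\<lambda>\<xi> \<tau>. cmod (ft (a \<xi>) \<tau>)) < \<infinity>"
proof -
  \<comment> \<open>\<open>\<langle>\<tau> + \<xi>\<^sup>2\<rangle>\<^sup>b\<close> is at most the power \<open>2n\<close> of the weights; two more powers ensure integrability\<close>
  define n where "n = nat \<lceil>\<bar>b\<bar>\<rceil>"
  have n: "\<bar>b\<bar> \<le> real n" by (simp add: n_def)
  obtain C where C: "0 \<le> C" "\<And>\<xi> \<tau>. cmod (ft (a \<xi>) \<tau>) \<le> C / (wt (of_int \<xi>) * wt \<tau>) ^ (2 * n + 2)"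
    using ft_decay[OF a] by metis
  have pt: "(bracket (\<tau> + (of_int \<xi>)\<^sup>2) powr b * cmod (ft (a \<xi>) \<tau>)) powr p \<le> C powr p * decay \<tau> * decay (of_int \<xi>)" for \<xi> \<tau>
  proof -
    let ?P = "wt (of_int \<xi>) * wt \<tau>"
    have P: "0 < ?P" by simp
    have "bracket (\<tau> + (of_int \<xi>)\<^sup>2) \<le> wt (\<tau> + (of_int \<xi>)\<^sup>2)"
      by (rule bracket_le_wt)
    also have "\<dots> \<le> wt \<tau> * wt ((of_int \<xi>)\<^sup>2)" by (rule wt_add_le)
    also have "\<dots> \<le> (wt \<tau>)\<^sup>2 * (wt (of_int \<xi>))\<^sup>2"
    proof (intro mult_mono)
      show "wt \<tau> \<le> (wt \<tau>)\<^sup>2" using wt_ge_1[of \<tau>] by (simp add: power2_eq_square)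
      show "wt ((of_int \<xi>)\<^sup>2) \<le> (wt (of_int \<xi>))\<^sup>2" by (simp add: wt_def power2_eq_square algebra_simps)
    qed auto
    finally have br: "bracket (\<tau> + (of_int \<xi>)\<^sup>2) \<le> ?P\<^sup>2" by (simp add: power_mult_distrib mult.commute)
    have "bracket (\<tau> + (of_int \<xi>)\<^sup>2) powr b \<le> bracket (\<tau> + (of_int \<xi>)\<^sup>2) powr real n"
      using n bracket_ge_1 by (intro powr_mono) auto
    also have "\<dots> = bracket (\<tau> + (of_int \<xi>)\<^sup>2) ^ n"
      by (simp add: powr_realpow)
    also have "\<dots> \<le> (?P\<^sup>2) ^ n"
      by (intro power_mono br) simp
    finally have "bracket (\<tau> + (of_int \<xi>)\<^sup>2) powr b * cmod (ft (a \<xi>) \<tau>) \<le> (?P\<^sup>2) ^ n * (C / ?P ^ (2 * n + 2))"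
      by (intro mult_mono C) auto
    also have "\<dots> = C * (decay \<tau> * decay (of_int \<xi>))"
      by (simp add: decay_def power_add power_mult power_mult_distrib power2_eq_square)
    finally have "(bracket (\<tau> + (of_int \<xi>)\<^sup>2) powr b * cmod (ft (a \<xi>) \<tau>)) powr p \<le> (C * (decay \<tau> * decay (of_int \<xi>))) powr p"
      using p by (intro powr_mono2) auto
    also have "\<dots> = C powr p * (decay \<tau> * decay (of_int \<xi>)) powr p"
      using C by (simp add: powr_mult)
    also have "\<dots> \<le> C powr p * (decay \<tau> * decay (of_int \<xi>)) powr 1"
      using p decay_le_1 by (intro mult_left_mono powr_mono' mult_le_one) auto
    finally show ?thesis by (simp add: mult.assoc)
  qed
  have "wnorm p b (\<lambda>\<xi> \<tau>. cmod (ft (a \<xi>) \<tau>))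
      \<le> (\<integral>\<^sup>+ \<xi>. (\<integral>\<^sup>+ \<tau>. ennreal (C powr p) * (ennreal (decay \<tau>) * ennreal (decay (of_int \<xi>))) \<partial>lborel) \<partial>count_space UNIV)"
    unfolding wnorm_def
  proof (intro nn_integral_mono)
    show "ennreal ((bracket (\<tau> + (of_int \<xi>)\<^sup>2) powr b * cmod (ft (a \<xi>) \<tau>)) powr p)
        \<le> ennreal (C powr p) * (ennreal (decay \<tau>) * ennreal (decay (of_int \<xi>)))" for \<xi> \<tau>
      using ennreal_leI[OF pt[of \<tau> \<xi>]] by (simp add: ennreal_mult mult.assoc)
  qed
  also have "\<dots> = ennreal (C powr p) * ((\<integral>\<^sup>+ \<tau>. ennreal (decay \<tau>) \<partial>lborel) * (\<integral>\<^sup>+ \<xi>. ennreal (decay (of_int \<xi>)) \<partial>count_space (UNIV :: int set)))"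
    by (simp add: nn_integral_cmult nn_integral_multc)
  also have "(\<integral>\<^sup>+ \<tau>. ennreal (decay \<tau>) \<partial>lborel) = ennreal (LINT \<tau>|lborel. decay \<tau>)"
    by (intro nn_integral_eq_integral integrable_decay) simp
  also have "(\<integral>\<^sup>+ \<xi>. ennreal (decay (of_int \<xi>)) \<partial>count_space (UNIV :: int set)) = ennreal (\<Sum>\<^sub>\<infinity>\<xi>::int. decay (of_int \<xi>))"
    by (intro ennreal_infsum_eq_nn_integral[symmetric] summable_decay) simp
  also have "ennreal (C powr p) * (ennreal (LINT \<tau>|lborel. decay \<tau>) * ennreal (\<Sum>\<^sub>\<infinity>\<xi>::int. decay (of_int \<xi>))) < \<infinity>"
    by (simp add: ennreal_mult_less_top)
  finally show ?thesis .
qed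

section \<open>The trilinear operator on coefficient families\<close>

definition tri_term :: "coeffs \<Rightarrow> coeffs \<Rightarrow> coeffs \<Rightarrow> int \<Rightarrow> int \<times> int \<Rightarrow> real \<Rightarrow> complex" where
  "tri_term a1 a2 a3 \<xi> q t = (case q of (j, k) \<Rightarrow>
     if j \<noteq> \<xi> \<and> k \<noteq> \<xi> then a1 j t * a2 k t * cnj (a3 (j + k - \<xi>) t) else 0)"

text \<open>
  The operator \<open>C\<^sub>1\<close> on coefficient families. The sum runs over all pairs, with zero terms at the
  excluded frequencies, and \<open>\<xi>\<^sub>3 = \<xi> - j - k\<close> enters with the opposite sign because
  conjugation reflects Fourier coefficients.
\<close>

definition trilinear :: "coeffs \<Rightarrow> coeffs \<Rightarrow> coeffs \<Rightarrow> coeffs" where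
  "trilinear a1 a2 a3 \<xi> t = 1 / (2 * pi) * (\<Sum>\<^sub>\<infinity>q. tri_term a1 a2 a3 \<xi> q t)"

text \<open>
  Since \<open>\<xi>\<close> is the alternating sum of the three frequencies, submultiplicativity lets the
  decay of the three factors provide decay in \<open>\<xi>\<close>. Two spare powers make the sum over \<open>j\<close>
  and \<open>k\<close> converge.
\<close>

lemma tri_term_bound:
  assumes "rapid a1" "rapid a2" "rapid a3"
  obtains C where "0 \<le> C" "\<And>\<xi> j k t. cmod (tri_term a1 a2 a3 \<xi> (j, k) t)
    \<le> C / (wt (of_int \<xi>) * wt t) ^ N * (decay (of_int j) * decay (of_int k))"
proof -
  obtain C1 where C1: "0 \<le> C1" "\<And>\<xi> t. cmod (a1 \<xi> t) \<le> C1 / (wt (of_int \<xi>) * wt t) ^ (N + 2)"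
    using rapidD[OF assms(1)] by metis
  obtain C2 where C2: "0 \<le> C2" "\<And>\<xi> t. cmod (a2 \<xi> t) \<le> C2 / (wt (of_int \<xi>) * wt t) ^ (N + 2)"
    using rapidD[OF assms(2)] by metis
  obtain C3 where C3: "0 \<le> C3" "\<And>\<xi> t. cmod (a3 \<xi> t) \<le> C3 / (wt (of_int \<xi>) * wt t) ^ (N + 2)"
    using rapidD[OF assms(3)] by metis
  have "cmod (tri_term a1 a2 a3 \<xi> (j, k) t)
    \<le> C1 * C2 * C3 / (wt (of_int \<xi>) * wt t) ^ N * (decay (of_int j) * decay (of_int k))" for \<xi> j k t
  proof -
    let ?x = "wt (of_int j)" and ?y = "wt (of_int k)" and ?z = "wt (of_int (j + k - \<xi>))" and ?w = "wt t"
    have ge1: "1 \<le> ?x" "1 \<le> ?y" "1 \<le> ?z" "1 \<le> ?w" by (rule wt_ge_1)+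
    have "wt (of_int \<xi>) = wt (of_int j + (of_int k + - of_int (j + k - \<xi>)))" by simp
    also have "\<dots> \<le> ?x * wt (of_int k + - of_int (j + k - \<xi>))" by (rule wt_add_le)
    also have "\<dots> \<le> ?x * (?y * wt (- of_int (j + k - \<xi>)))" by (intro mult_left_mono wt_add_le) simp
    also have "wt (- of_int (j + k - \<xi>)) = ?z" by (simp add: wt_def)
    finally have sub: "wt (of_int \<xi>) \<le> ?x * ?y * ?z" by (simp add: mult.assoc)
    have "cmod (tri_term a1 a2 a3 \<xi> (j, k) t) \<le> cmod (a1 j t) * cmod (a2 k t) * cmod (a3 (j + k - \<xi>) t)"
      by (simp add: tri_term_def norm_mult)
    also have "\<dots> \<le> C1 / (?x * ?w) ^ (N + 2) * (C2 / (?y * ?w) ^ (N + 2)) * (C3 / (?z * ?w) ^ (N + 2))"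
      using C1(1) C2(1) C3(1) by (intro mult_mono C1(2) C2(2) C3(2)) auto
    also have "\<dots> = C1 * C2 * C3 / ((?x * ?w) ^ (N + 2) * (?y * ?w) ^ (N + 2) * (?z * ?w) ^ (N + 2))"
      by simp
    also have "\<dots> \<le> C1 * C2 * C3 / ((wt (of_int \<xi>) * ?w) ^ N * (?x\<^sup>2 * ?y\<^sup>2))"
    proof (intro divide_left_mono)
      have "(wt (of_int \<xi>) * ?w) ^ N * (?x\<^sup>2 * ?y\<^sup>2) \<le> (?x * ?y * ?z * ?w) ^ N * (?x\<^sup>2 * ?y\<^sup>2)"
        by (intro mult_right_mono power_mono sub) auto
      also have "\<dots> = (?x ^ (N + 2) * ?y ^ (N + 2)) * (?z ^ N * ?w ^ N)"
        by (simp add: power_mult_distrib power_add power2_eq_square)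
      also have "\<dots> \<le> (?x ^ (N + 2) * ?y ^ (N + 2)) * (?z ^ (N + 2) * ?w ^ ((N + 2) + (N + 2) + (N + 2)))"
        using ge1 by (intro mult_left_mono mult_mono power_increasing) auto
      also have "\<dots> = (?x * ?w) ^ (N + 2) * (?y * ?w) ^ (N + 2) * (?z * ?w) ^ (N + 2)"
        unfolding power_add[of ?w "N + 2 + (N + 2)"] power_add[of ?w "N + 2" "N + 2"] power_mult_distrib
        by (simp only: mult_ac)
      finally show "(wt (of_int \<xi>) * ?w) ^ N * (?x\<^sup>2 * ?y\<^sup>2) \<le> (?x * ?w) ^ (N + 2) * (?y * ?w) ^ (N + 2) * (?z * ?w) ^ (N + 2)" .
    qed (use C1 C2 C3 in auto)
    also have "\<dots> = C1 * C2 * C3 / (wt (of_int \<xi>) * ?w) ^ N * (decay (of_int j) * decay (of_int k))"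
      by (simp add: decay_def)
    finally show ?thesis .
  qed
  moreover have "0 \<le> C1 * C2 * C3" using C1 C2 C3 by simp
  ultimately show ?thesis using that by blast
qed

lemma decay_pair_nonneg: "0 \<le> (case q of (j, k) \<Rightarrow> decay (of_int j) * decay (of_int k))"
  by (simp add: split_beta)

lemma tri_term_abs_summable:
  assumes "rapid a1" "rapid a2" "rapid a3"
  shows "(\<lambda>q. cmod (tri_term a1 a2 a3 \<xi> q t)) summable_on UNIV"
proof -
  obtain C where C: "\<And>\<xi> j k t. cmod (tri_term a1 a2 a3 \<xi> (j, k) t)
      \<le> C / (wt (of_int \<xi>) * wt t) ^ 0 * (decay (of_int j) * decay (of_int k))"
    using tri_term_bound[OF assms] by metis
  show ?thesis
    by (rule Infinite_Sum.abs_summable_on_comparison_test'[OF summable_on_cmult_right[OF summable_decay_pair, of C]])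
       (use C in auto)
qed

lemma tri_term_summable:
  assumes "rapid a1" "rapid a2" "rapid a3"
  shows "(\<lambda>q. tri_term a1 a2 a3 \<xi> q t) summable_on UNIV"
  by (rule Infinite_Sum.abs_summable_summable[OF tri_term_abs_summable[OF assms]])

lemma rapid_trilinear:
  assumes "rapid a1" "rapid a2" "rapid a3"
  shows "rapid (trilinear a1 a2 a3)"
proof (rule rapidI)
  fix N
  obtain C where C: "0 \<le> C" "\<And>\<xi> j k t. cmod (tri_term a1 a2 a3 \<xi> (j, k) t)
      \<le> C / (wt (of_int \<xi>) * wt t) ^ N * (decay (of_int j) * decay (of_int k))"
    using tri_term_bound[OF assms] by metis
  define S where "S = (\<Sum>\<^sub>\<infinity>(j, k). decay (of_int j) * decay (of_int k) :: real)"
  have "cmod (trilinear a1 a2 a3 \<xi> t) \<le> 1 / (2 * pi) * C * S / (wt (of_int \<xi>) * wt t) ^ N" for \<xi> t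
  proof -
    have "cmod (\<Sum>\<^sub>\<infinity>q. tri_term a1 a2 a3 \<xi> q t) \<le> (\<Sum>\<^sub>\<infinity>q. cmod (tri_term a1 a2 a3 \<xi> q t))"
      by (rule norm_infsum_bound[OF tri_term_abs_summable[OF assms]])
    also have "\<dots> \<le> (\<Sum>\<^sub>\<infinity>q. C / (wt (of_int \<xi>) * wt t) ^ N * (case q of (j, k) \<Rightarrow> decay (of_int j) * decay (of_int k)))"
      by (intro infsum_mono tri_term_abs_summable[OF assms] summable_on_cmult_right summable_decay_pair)
         (use C in auto)
    also have "\<dots> = C / (wt (of_int \<xi>) * wt t) ^ N * S"
      unfolding S_def by (rule infsum_cmult_right')
    finally have "1 / (2 * pi) * cmod (\<Sum>\<^sub>\<infinity>q. tri_term a1 a2 a3 \<xi> q t) \<le> 1 / (2 * pi) * (C / (wt (of_int \<xi>) * wt t) ^ N * S)"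
      by (intro mult_left_mono) auto
    then show ?thesis
      by (simp add: trilinear_def norm_mult norm_divide)
  qed
  then show "\<exists>C. \<forall>\<xi> t. cmod (trilinear a1 a2 a3 \<xi> t) \<le> C / (wt (of_int \<xi>) * wt t) ^ N" by blast
qed

lemma trilinear_has_vector_derivative:
  assumes r: "rapid a1" "rapid a2" "rapid a3" and r': "rapid a1'" "rapid a2'" "rapid a3'"
    and d: "\<And>\<xi> t. (a1 \<xi> has_vector_derivative a1' \<xi> t) (at t)" "\<And>\<xi> t. (a2 \<xi> has_vector_derivative a2' \<xi> t) (at t)"
      "\<And>\<xi> t. (a3 \<xi> has_vector_derivative a3' \<xi> t) (at t)"
  shows "(trilinear a1 a2 a3 \<xi> has_vector_derivative
    (trilinear a1' a2 a3 \<xi> t + trilinear a1 a2' a3 \<xi> t + trilinear a1 a2 a3' \<xi> t)) (at t)"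
proof -
  let ?D = "\<lambda>q t. tri_term a1' a2 a3 \<xi> q t + tri_term a1 a2' a3 \<xi> q t + tri_term a1 a2 a3' \<xi> q t"
  obtain A where A: "0 \<le> A" "\<And>\<xi> j k t. cmod (tri_term a1' a2 a3 \<xi> (j, k) t) \<le> A / (wt (of_int \<xi>) * wt t) ^ 0 * (decay (of_int j) * decay (of_int k))"
    using tri_term_bound[OF r'(1) r(2,3)] by metis
  obtain B where B: "0 \<le> B" "\<And>\<xi> j k t. cmod (tri_term a1 a2' a3 \<xi> (j, k) t) \<le> B / (wt (of_int \<xi>) * wt t) ^ 0 * (decay (of_int j) * decay (of_int k))"
    using tri_term_bound[OF r(1) r'(2) r(3)] by metis
  obtain C where C: "0 \<le> C" "\<And>\<xi> j k t. cmod (tri_term a1 a2 a3' \<xi> (j, k) t) \<le> C / (wt (of_int \<xi>) * wt t) ^ 0 * (decay (of_int j) * decay (of_int k))"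
    using tri_term_bound[OF r(1,2) r'(3)] by metis
  define W where "W q = (A + B + C) * (case q of (j, k) \<Rightarrow> decay (of_int j) * decay (of_int k))" for q :: "int \<times> int"
  have "((\<lambda>t. \<Sum>\<^sub>\<infinity>q. tri_term a1 a2 a3 \<xi> q t) has_derivative (\<lambda>h. \<Sum>\<^sub>\<infinity>q. h *\<^sub>R ?D q t)) (at t)"
  proof (rule has_derivative_infsum[where B = W])
    show "((\<lambda>t. tri_term a1 a2 a3 \<xi> q t) has_derivative (\<lambda>h. h *\<^sub>R ?D q t)) (at t)" for q t
    proof -
      obtain j k where q: "q = (j, k)" by (cases q)
      have "((\<lambda>t. tri_term a1 a2 a3 \<xi> q t) has_vector_derivative ?D q t) (at t)"
      proof (cases "j \<noteq> \<xi> \<and> k \<noteq> \<xi>")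
        case True
        have "((\<lambda>t. a1 j t * a2 k t * cnj (a3 (j + k - \<xi>) t)) has_vector_derivative
            a1 j t * a2 k t * cnj (a3' (j + k - \<xi>) t) + (a1 j t * a2' k t + a1' j t * a2 k t) * cnj (a3 (j + k - \<xi>) t)) (at t)"
          by (intro has_vector_derivative_mult has_vector_derivative_cnj d)
        with True show ?thesis by (simp add: q tri_term_def algebra_simps)
      qed (auto simp: q tri_term_def)
      then show ?thesis by (simp add: has_vector_derivative_def)
    qed
    show "cmod (h *\<^sub>R ?D q t) \<le> W q * norm h" for q t h
    proof -
      obtain j k where q: "q = (j, k)" by (cases q)
      have "cmod (?D q t) \<le> A * (decay (of_int j) * decay (of_int k)) + B * (decay (of_int j) * decay (of_int k)) + C * (decay (of_int j) * decay (of_int k))"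
        unfolding q by (intro norm_triangle_le add_mono) (use A(2)[of \<xi> j k t] B(2)[of \<xi> j k t] C(2)[of \<xi> j k t] in auto)
      then have "cmod (?D q t) \<le> W q" by (simp add: W_def q algebra_simps)
      then have "\<bar>h\<bar> * cmod (?D q t) \<le> \<bar>h\<bar> * W q" by (rule mult_left_mono) simp
      then show ?thesis by (simp add: mult.commute)
    qed
    show "W summable_on UNIV"
      unfolding W_def by (intro summable_on_cmult_right summable_decay_pair)
    show "0 \<le> W q" for q
      unfolding W_def using A B C decay_pair_nonneg by (intro mult_nonneg_nonneg) auto
    show "(\<lambda>q. cmod (tri_term a1 a2 a3 \<xi> q t)) summable_on UNIV" for t
      by (rule tri_term_abs_summable[OF r])
  qed
  moreover have "(\<Sum>\<^sub>\<infinity>q. h *\<^sub>R ?D q t) = h *\<^sub>R (\<Sum>\<^sub>\<infinity>q. ?D q t)" for h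
    by (simp only: scaleR_conv_of_real infsum_cmult_right')
  ultimately have "((\<lambda>t. \<Sum>\<^sub>\<infinity>q. tri_term a1 a2 a3 \<xi> q t) has_vector_derivative (\<Sum>\<^sub>\<infinity>q. ?D q t)) (at t)"
    by (simp only: has_vector_derivative_def)
  then have "((\<lambda>t. 1 / (2 * pi) * (\<Sum>\<^sub>\<infinity>q. tri_term a1 a2 a3 \<xi> q t)) has_vector_derivative 1 / (2 * pi) * (\<Sum>\<^sub>\<infinity>q. ?D q t)) (at t)"
    by (rule has_vector_derivative_mult_right)
  moreover have "(\<Sum>\<^sub>\<infinity>q. ?D q t) = (\<Sum>\<^sub>\<infinity>q. tri_term a1' a2 a3 \<xi> q t) + (\<Sum>\<^sub>\<infinity>q. tri_term a1 a2' a3 \<xi> q t) + (\<Sum>\<^sub>\<infinity>q. tri_term a1 a2 a3' \<xi> q t)"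
    using tri_term_summable[OF r'(1) r(2,3)] tri_term_summable[OF r(1) r'(2) r(3)] tri_term_summable[OF r(1,2) r'(3)]
    by (simp add: infsum_add summable_on_add)
  ultimately show ?thesis
    by (simp add: trilinear_def[abs_def] distrib_left)
qed

lemma smooth_upto_trilinear:
  "smooth_upto k a1 \<Longrightarrow> smooth_upto k a2 \<Longrightarrow> smooth_upto k a3 \<Longrightarrow> smooth_upto k (trilinear a1 a2 a3)"
proof (induction k arbitrary: a1 a2 a3)
  case 0
  then show ?case by (simp add: rapid_trilinear)
next
  case (Suc k)
  note r = smooth_upto_rapid[OF Suc.prems(1)] smooth_upto_rapid[OF Suc.prems(2)] smooth_upto_rapid[OF Suc.prems(3)]
  note d = smooth_upto_SucD[OF Suc.prems(1)] smooth_upto_SucD[OF Suc.prems(2)] smooth_upto_SucD[OF Suc.prems(3)]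
  show ?case
  proof (rule smooth_upto_SucI)
    show "rapid (trilinear a1 a2 a3)" by (rule rapid_trilinear[OF r])
    show "(trilinear a1 a2 a3 \<xi> has_vector_derivative
        (trilinear (time_deriv a1) a2 a3 \<xi> t + trilinear a1 (time_deriv a2) a3 \<xi> t + trilinear a1 a2 (time_deriv a3) \<xi> t)) (at t)" for \<xi> t
      by (intro trilinear_has_vector_derivative r d smooth_upto_rapid[OF d(2)] smooth_upto_rapid[OF d(4)] smooth_upto_rapid[OF d(6)])
    show "smooth_upto k (\<lambda>\<xi> t. trilinear (time_deriv a1) a2 a3 \<xi> t + trilinear a1 (time_deriv a2) a3 \<xi> t + trilinear a1 a2 (time_deriv a3) \<xi> t)"
      by (intro smooth_upto_add Suc.IH d Suc.prems[THEN smooth_upto_mono])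
  qed
qed

lemma schwartz_trilinear:
  "schwartz a1 \<Longrightarrow> schwartz a2 \<Longrightarrow> schwartz a3 \<Longrightarrow> schwartz (trilinear a1 a2 a3)"
  unfolding schwartz_def using smooth_upto_trilinear by blast

lemma trilinear_diff:
  assumes "rapid a1" "rapid a2" "rapid a3" "rapid b1" "rapid b2" "rapid b3"
  shows "trilinear (\<lambda>\<xi> t. a1 \<xi> t - b1 \<xi> t) a2 a3 = (\<lambda>\<xi> t. trilinear a1 a2 a3 \<xi> t - trilinear b1 a2 a3 \<xi> t)"
    and "trilinear b1 (\<lambda>\<xi> t. a2 \<xi> t - b2 \<xi> t) a3 = (\<lambda>\<xi> t. trilinear b1 a2 a3 \<xi> t - trilinear b1 b2 a3 \<xi> t)"
    and "trilinear b1 b2 (\<lambda>\<xi> t. a3 \<xi> t - b3 \<xi> t) = (\<lambda>\<xi> t. trilinear b1 b2 a3 \<xi> t - trilinear b1 b2 b3 \<xi> t)"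
proof -
  note s = tri_term_summable
  have "tri_term (\<lambda>\<xi> t. a1 \<xi> t - b1 \<xi> t) a2 a3 \<xi> q t = tri_term a1 a2 a3 \<xi> q t - tri_term b1 a2 a3 \<xi> q t" for \<xi> q t
    by (cases q) (simp add: tri_term_def algebra_simps)
  then show "trilinear (\<lambda>\<xi> t. a1 \<xi> t - b1 \<xi> t) a2 a3 = (\<lambda>\<xi> t. trilinear a1 a2 a3 \<xi> t - trilinear b1 a2 a3 \<xi> t)"
    using assms by (intro ext) (simp add: trilinear_def infsum_diff_banach s right_diff_distrib)
  have "tri_term b1 (\<lambda>\<xi> t. a2 \<xi> t - b2 \<xi> t) a3 \<xi> q t = tri_term b1 a2 a3 \<xi> q t - tri_term b1 b2 a3 \<xi> q t" for \<xi> q t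
    by (cases q) (simp add: tri_term_def algebra_simps)
  then show "trilinear b1 (\<lambda>\<xi> t. a2 \<xi> t - b2 \<xi> t) a3 = (\<lambda>\<xi> t. trilinear b1 a2 a3 \<xi> t - trilinear b1 b2 a3 \<xi> t)"
    using assms by (intro ext) (simp add: trilinear_def infsum_diff_banach s right_diff_distrib)
  have "tri_term b1 b2 (\<lambda>\<xi> t. a3 \<xi> t - b3 \<xi> t) \<xi> q t = tri_term b1 b2 a3 \<xi> q t - tri_term b1 b2 b3 \<xi> q t" for \<xi> q t
    by (cases q) (simp add: tri_term_def algebra_simps)
  then show "trilinear b1 b2 (\<lambda>\<xi> t. a3 \<xi> t - b3 \<xi> t) = (\<lambda>\<xi> t. trilinear b1 b2 a3 \<xi> t - trilinear b1 b2 b3 \<xi> t)"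
    using assms by (intro ext) (simp add: trilinear_def infsum_diff_banach s right_diff_distrib)
qed

text \<open>
  The sum over the frequencies is taken out of the time integral by absolute convergence, and
  the Fourier transform of each product of three functions of time is a convolution.
\<close>

lemma norm_ft_trilinear_le:
  assumes a: "schwartz a1" "schwartz a2" "schwartz a3"
  shows "ennreal (cmod (ft (trilinear a1 a2 a3 \<xi>) \<tau>)) \<le> nonresonant_convolution (\<lambda>\<xi> \<tau>. cmod (ft (a1 \<xi>) \<tau>)) (\<lambda>\<xi> \<tau>. cmod (ft (a2 \<xi>) \<tau>)) (\<lambda>\<xi> \<tau>. cmod (ft (a3 \<xi>) \<tau>)) \<xi> \<tau>"
proof -
  note r = a[THEN schwartz_rapid]
  obtain C where C: "0 \<le> C" "\<And>\<xi> j k t. cmod (tri_term a1 a2 a3 \<xi> (j, k) t)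
      \<le> C / (wt (of_int \<xi>) * wt t) ^ 2 * (decay (of_int j) * decay (of_int k))"
    using tri_term_bound[OF r] by metis
  have inf: "infinite (UNIV :: (int \<times> int) set)"
    by (simp add: finite_prod infinite_UNIV_int)
  let ?c = "\<lambda>t. cis (- (t * \<tau>))"
  let ?f = "\<lambda>q t. tri_term a1 a2 a3 \<xi> q t * ?c t"
  let ?W = "\<lambda>q :: int \<times> int. C * (case q of (j, k) \<Rightarrow> decay (of_int j) * decay (of_int k))"
  note [measurable] = a[THEN schwartz_measurable]
  have fm: "?f q \<in> borel_measurable lborel" for q
  proof -
    have "(\<lambda>t. cnj (a3 m t)) \<in> borel_measurable borel" for m
      using borel_measurable_integrable[OF integrable_cnj[OF schwartz_integrable[OF a(3)]]] by simp
    note [measurable] = this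
    show ?thesis by (cases q) (simp add: tri_term_def)
  qed
  have fb: "cmod (?f q t) \<le> ?W q * decay t" for q t
  proof -
    obtain j k where q: "q = (j, k)" by (cases q)
    have "cmod (?f q t) \<le> C / (wt (of_int \<xi>) * wt t) ^ 2 * (decay (of_int j) * decay (of_int k))"
      using C(2)[of \<xi> j k t] by (simp add: q norm_mult)
    also have "\<dots> \<le> C / (1 * wt t) ^ 2 * (decay (of_int j) * decay (of_int k))"
      using C(1) by (intro mult_right_mono divide_left_mono power_mono mult_right_mono wt_ge_1) auto
    finally show ?thesis by (simp add: q decay_def mult.commute)
  qed
  have Ws: "?W summable_on UNIV" "0 \<le> ?W q" for q
    using summable_on_cmult_right[OF summable_decay_pair] C(1) decay_pair_nonneg
    by (blast, intro mult_nonneg_nonneg)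
  note dom = inf fm fb Ws integrable_decay decay_nonneg
  have ft_term: "1 / sqrt (2 * pi) * (LINT t|lborel. ?f q t) = ft (tri_term a1 a2 a3 \<xi> q) \<tau>" for q
    by (simp add: ft_def)
  have "ft (trilinear a1 a2 a3 \<xi>) \<tau> = 1 / sqrt (2 * pi) * (LINT t|lborel. of_real (1 / (2 * pi)) * (\<Sum>\<^sub>\<infinity>q. ?f q t))"
    unfolding ft_def trilinear_def by (simp add: infsum_cmult_left' mult.assoc)
  also have "\<dots> = of_real (1 / (2 * pi)) * (1 / sqrt (2 * pi) * (\<Sum>\<^sub>\<infinity>q. LINT t|lborel. ?f q t))"
    using integral_infsum[OF dom] by (simp add: mult.left_commute)
  also have "1 / sqrt (2 * pi) * (\<Sum>\<^sub>\<infinity>q. LINT t|lborel. ?f q t) = (\<Sum>\<^sub>\<infinity>q. ft (tri_term a1 a2 a3 \<xi> q) \<tau>)"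
    unfolding ft_term[symmetric] by (rule infsum_cmult_right'[symmetric])
  finally have eq: "ft (trilinear a1 a2 a3 \<xi>) \<tau> = of_real (1 / (2 * pi)) * (\<Sum>\<^sub>\<infinity>q. ft (tri_term a1 a2 a3 \<xi> q) \<tau>)" .
  have s: "(\<lambda>q. cmod (ft (tri_term a1 a2 a3 \<xi> q) \<tau>)) summable_on UNIV"
    using summable_on_cmult_right[OF integrals_abs_summable[OF dom], of "1 / sqrt (2 * pi)"]
    by (simp add: ft_def norm_mult norm_divide)
  have "cmod (ft (trilinear a1 a2 a3 \<xi>) \<tau>) \<le> 1 * cmod (\<Sum>\<^sub>\<infinity>q. ft (tri_term a1 a2 a3 \<xi> q) \<tau>)"
    unfolding eq norm_mult using pi_gt3 by (intro mult_right_mono) (auto simp: norm_divide norm_mult)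
  also have "\<dots> \<le> (\<Sum>\<^sub>\<infinity>q. cmod (ft (tri_term a1 a2 a3 \<xi> q) \<tau>))"
    using norm_infsum_bound[OF s] by simp
  finally have "ennreal (cmod (ft (trilinear a1 a2 a3 \<xi>) \<tau>)) \<le> ennreal (\<Sum>\<^sub>\<infinity>q. cmod (ft (tri_term a1 a2 a3 \<xi> q) \<tau>))"
    by (rule ennreal_leI)
  also have "\<dots> = (\<integral>\<^sup>+ q. ennreal (cmod (ft (tri_term a1 a2 a3 \<xi> q) \<tau>)) \<partial>count_space UNIV)"
    by (rule ennreal_infsum_eq_nn_integral[OF s]) simp
  also have "\<dots> \<le> nonresonant_convolution (\<lambda>\<xi> \<tau>. cmod (ft (a1 \<xi>) \<tau>)) (\<lambda>\<xi> \<tau>. cmod (ft (a2 \<xi>) \<tau>)) (\<lambda>\<xi> \<tau>. cmod (ft (a3 \<xi>) \<tau>)) \<xi> \<tau>"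
    unfolding nonresonant_convolution_def
  proof (intro nn_integral_mono)
    fix q :: "int \<times> int"
    obtain j k where q: "q = (j, k)" by (cases q)
    show "ennreal (cmod (ft (tri_term a1 a2 a3 \<xi> q) \<tau>)) \<le> (case q of (j, k) \<Rightarrow> if j \<noteq> \<xi> \<and> k \<noteq> \<xi>
        then \<integral>\<^sup>+ t1. (\<integral>\<^sup>+ t2. ennreal (cmod (ft (a1 j) t1) * cmod (ft (a2 k) t2) * cmod (ft (a3 (j + k - \<xi>)) (t1 + t2 - \<tau>))) \<partial>lborel) \<partial>lborel else 0)"
    proof (cases "j \<noteq> \<xi> \<and> k \<noteq> \<xi>")
      case True
      then have "tri_term a1 a2 a3 \<xi> q = (\<lambda>t. a1 j t * a2 k t * cnj (a3 (j + k - \<xi>) t))"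
        by (simp add: q tri_term_def fun_eq_iff)
      moreover have "ennreal (cmod (ft (\<lambda>t. a1 j t * a2 k t * cnj (a3 (j + k - \<xi>) t)) \<tau>))
          \<le> (\<integral>\<^sup>+ t1. (\<integral>\<^sup>+ t2. ennreal (cmod (ft (a1 j) t1) * cmod (ft (a2 k) t2) * cmod (ft (a3 (j + k - \<xi>)) (t1 + t2 - \<tau>))) \<partial>lborel) \<partial>lborel)"
        by (intro norm_ft_triple_le schwartz_continuous schwartz_integrable schwartz_bounded ft_integrable a)
      ultimately show ?thesis using True by (simp add: q)
    next
      case False
      then have "tri_term a1 a2 a3 \<xi> q = (\<lambda>t. 0)"
        by (auto simp: q tri_term_def fun_eq_iff)
      then show ?thesis using False by (auto simp: q ft_def)
    qed
  qed
  finally show ?thesis .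
qed

text \<open>
  The norm of \<open>X\<^sup>0\<^sup>,\<^sup>b\<^sub>r\<close>, with \<open>p\<close> dual to \<open>r\<close>, expressed by Fourier coefficients; see
  \<open>pre_norm_eq_snorm\<close>.
\<close>

definition snorm :: "real \<Rightarrow> real \<Rightarrow> coeffs \<Rightarrow> real" where
  "snorm p b a = lnorm p b (\<lambda>\<xi> \<tau>. cmod (ft (a \<xi>) \<tau>))"

lemma snorm_nonneg [simp]: "0 \<le> snorm p b a"
  by (simp add: snorm_def lnorm_def)

lemma ft_diff:
  assumes "integrable lborel f" "integrable lborel g"
  shows "ft (\<lambda>t. f t - g t) \<tau> = ft f \<tau> - ft g \<tau>"
proof -
  have "integrable lborel (\<lambda>t. f t * cis (- (t * \<tau>)))" "integrable lborel (\<lambda>t. g t * cis (- (t * \<tau>)))"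
    by (intro integrable_mult_cis assms, simp)+
  then show ?thesis
    by (simp add: ft_def left_diff_distrib right_diff_distrib)
qed

lemma snorm_triangle:
  assumes p: "1 \<le> p" and a: "schwartz a" "schwartz b"
    and c: "\<And>\<xi> \<tau>. cmod (ft (c \<xi>) \<tau>) \<le> cmod (ft (a \<xi>) \<tau>) + cmod (ft (b \<xi>) \<tau>)"
  shows "snorm p s c \<le> snorm p s a + snorm p s b"
  unfolding snorm_def
  using a[THEN schwartz_measurable]
  by (intro lnorm_triangle p wnorm_schwartz_finite a c) auto

lemma snorm_diff_triangle:
  assumes p: "1 \<le> p" and a: "schwartz a" "schwartz b" "schwartz c"
  shows "snorm p s (\<lambda>\<xi> t. a \<xi> t - c \<xi> t) \<le> snorm p s (\<lambda>\<xi> t. a \<xi> t - b \<xi> t) + snorm p s (\<lambda>\<xi> t. b \<xi> t - c \<xi> t)"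
proof (rule snorm_triangle[OF p])
  fix \<xi> \<tau>
  note i = a[THEN schwartz_integrable]
  show "cmod (ft (\<lambda>t. a \<xi> t - c \<xi> t) \<tau>) \<le> cmod (ft (\<lambda>t. a \<xi> t - b \<xi> t) \<tau>) + cmod (ft (\<lambda>t. b \<xi> t - c \<xi> t) \<tau>)"
    using norm_triangle_ineq[of "ft (a \<xi>) \<tau> - ft (b \<xi>) \<tau>" "ft (b \<xi>) \<tau> - ft (c \<xi>) \<tau>"] by (simp add: ft_diff i)
qed (intro schwartz_diff a)+

lemma snorm_diff_commute:
  assumes a: "schwartz a" "schwartz b"
  shows "snorm p s (\<lambda>\<xi> t. a \<xi> t - b \<xi> t) = snorm p s (\<lambda>\<xi> t. b \<xi> t - a \<xi> t)"
  unfolding snorm_def by (simp add: ft_diff a[THEN schwartz_integrable] norm_minus_commute)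

lemma snorm_diff_self:
  assumes p: "1 \<le> p"
  shows "snorm p s (\<lambda>\<xi> t. a \<xi> t - a \<xi> t) = 0"
  using p by (simp add: snorm_def lnorm_def wnorm_def ft_def)

lemma abs_snorm_diff_le:
  assumes p: "1 \<le> p" and a: "schwartz a" "schwartz b"
  shows "\<bar>snorm p s a - snorm p s b\<bar> \<le> snorm p s (\<lambda>\<xi> t. a \<xi> t - b \<xi> t)"
proof -
  note i = a[THEN schwartz_integrable]
  have "snorm p s a \<le> snorm p s (\<lambda>\<xi> t. a \<xi> t - b \<xi> t) + snorm p s b"
  proof (rule snorm_triangle[OF p])
    show "cmod (ft (a \<xi>) \<tau>) \<le> cmod (ft (\<lambda>t. a \<xi> t - b \<xi> t) \<tau>) + cmod (ft (b \<xi>) \<tau>)" for \<xi> \<tau>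
      using norm_triangle_ineq[of "ft (a \<xi>) \<tau> - ft (b \<xi>) \<tau>" "ft (b \<xi>) \<tau>"] by (simp add: ft_diff i)
  qed (intro schwartz_diff a)+
  moreover have "snorm p s b \<le> snorm p s (\<lambda>\<xi> t. a \<xi> t - b \<xi> t) + snorm p s a"
  proof (rule snorm_triangle[OF p])
    show "cmod (ft (b \<xi>) \<tau>) \<le> cmod (ft (\<lambda>t. a \<xi> t - b \<xi> t) \<tau>) + cmod (ft (a \<xi>) \<tau>)" for \<xi> \<tau>
      using norm_triangle_ineq4[of "ft (a \<xi>) \<tau>" "ft (a \<xi>) \<tau> - ft (b \<xi>) \<tau>"] by (simp add: ft_diff i)
  qed (intro schwartz_diff a)+
  ultimately show ?thesis by linarith
qed

theorem snorm_trilinear_estimate: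
  fixes r \<epsilon> b :: real
  assumes r: "1 < r" and \<epsilon>: "0 < \<epsilon>" and b: "1 / r < b"
  shows "\<exists>C\<ge>0. \<forall>a1 a2 a3. schwartz a1 \<longrightarrow> schwartz a2 \<longrightarrow> schwartz a3 \<longrightarrow>
    snorm (conj_exponent r) (- \<epsilon>) (trilinear a1 a2 a3)
      \<le> C * (snorm (conj_exponent r) b a1 * snorm (conj_exponent r) b a2 * snorm (conj_exponent r) b a3)"
proof -
  define p where "p = conj_exponent r"
  have p: "1 \<le> p" using r by (simp add: p_def conj_exponent_def field_simps)
  from trilinear_wnorm_estimate[OF r \<epsilon> b p_def] show ?thesis
  proof (elim exE conjE)
    fix C :: real
    assume C: "0 \<le> C" and est: "\<forall>h1 h2 h3 g.
      (\<forall>\<xi> \<tau>. 0 \<le> h1 \<xi> \<tau> \<and> 0 \<le> h2 \<xi> \<tau> \<and> 0 \<le> h3 \<xi> \<tau> \<and> 0 \<le> g \<xi> \<tau>) \<longrightarrow>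
      (\<forall>\<xi>. h1 \<xi> \<in> borel_measurable borel \<and> h2 \<xi> \<in> borel_measurable borel \<and> h3 \<xi> \<in> borel_measurable borel) \<longrightarrow>
      (\<forall>\<xi> \<tau>. ennreal (g \<xi> \<tau>) \<le> nonresonant_convolution h1 h2 h3 \<xi> \<tau>) \<longrightarrow>
      wnorm p (- \<epsilon>) g \<le> ennreal C * (wnorm p b h1 * wnorm p b h2 * wnorm p b h3)"
    have "snorm p (- \<epsilon>) (trilinear a1 a2 a3) \<le> C powr (1 / p) * (snorm p b a1 * snorm p b a2 * snorm p b a3)"
      if a: "schwartz a1" "schwartz a2" "schwartz a3" for a1 a2 a3
    proof -
      let ?h = "\<lambda>a \<xi> \<tau>. cmod (ft (a \<xi>) \<tau>)"
      note m = a[THEN schwartz_measurable]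
      have "wnorm p (- \<epsilon>) (?h (trilinear a1 a2 a3)) \<le> ennreal C * (wnorm p b (?h a1) * wnorm p b (?h a2) * wnorm p b (?h a3))"
      proof (rule est[rule_format])
        show "0 \<le> cmod (ft (a1 \<xi>) \<tau>) \<and> 0 \<le> cmod (ft (a2 \<xi>) \<tau>) \<and> 0 \<le> cmod (ft (a3 \<xi>) \<tau>) \<and> 0 \<le> cmod (ft (trilinear a1 a2 a3 \<xi>) \<tau>)" for \<xi> \<tau>
          by simp
        show "(\<lambda>\<tau>. cmod (ft (a1 \<xi>) \<tau>)) \<in> borel_measurable borel \<and> (\<lambda>\<tau>. cmod (ft (a2 \<xi>) \<tau>)) \<in> borel_measurable borel
            \<and> (\<lambda>\<tau>. cmod (ft (a3 \<xi>) \<tau>)) \<in> borel_measurable borel" for \<xi>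
          using m by simp
      qed (rule norm_ft_trilinear_le[OF a])
      then have "enn2real (wnorm p (- \<epsilon>) (?h (trilinear a1 a2 a3))) \<le> enn2real (ennreal C * (wnorm p b (?h a1) * wnorm p b (?h a2) * wnorm p b (?h a3)))"
        using wnorm_schwartz_finite[OF a(1) p, of b] wnorm_schwartz_finite[OF a(2) p, of b] wnorm_schwartz_finite[OF a(3) p, of b]
        by (intro enn2real_mono) (auto simp: ennreal_mult_less_top)
      also have "\<dots> = C * (enn2real (wnorm p b (?h a1)) * enn2real (wnorm p b (?h a2)) * enn2real (wnorm p b (?h a3)))"
        using C by (simp add: enn2real_mult)
      finally have "enn2real (wnorm p (- \<epsilon>) (?h (trilinear a1 a2 a3))) powr (1 / p)
          \<le> (C * (enn2real (wnorm p b (?h a1)) * enn2real (wnorm p b (?h a2)) * enn2real (wnorm p b (?h a3)))) powr (1 / p)"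
        using p by (intro powr_mono2) auto
      then show ?thesis
        using C by (simp add: snorm_def lnorm_def powr_mult)
    qed
    then show ?thesis unfolding p_def[symmetric] by (intro exI[of _ "C powr (1 / p)"]) auto
  qed
qed

section \<open>Fourier coefficients of test functions\<close>

definition coef :: "st_fun \<Rightarrow> coeffs" where
  "coef u \<xi> t = fourier_x (\<lambda>x. u (t, x)) \<xi>"

text \<open>
  The Fourier series, inverse to \<open>coef\<close> on \<open>schwartz\<close> families.
\<close>

definition synth :: "coeffs \<Rightarrow> st_fun" where
  "synth a = (\<lambda>(t, x). 1 / sqrt (2 * pi) * (\<Sum>\<^sub>\<infinity>\<xi>::int. a \<xi> t * cis (x * of_int \<xi>)))"

lemma pre_norm_eq_snorm: "pre_norm r 0 b u = snorm (conj_exponent r) b (coef u)"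
proof -
  have "fourier_tx u \<tau> \<xi> = ft (coef u \<xi>) \<tau>" for \<tau> \<xi>
    by (simp add: fourier_tx_def ft_def coef_def)
  then show ?thesis
    by (simp add: pre_norm_def snorm_def lnorm_def wnorm_def)
qed

abbreviation d_t :: "st_fun \<Rightarrow> st_fun" where
  "d_t u \<equiv> \<lambda>p. frechet_derivative u (at p) (1, 0)"

abbreviation d_x :: "st_fun \<Rightarrow> st_fun" where
  "d_x u \<equiv> \<lambda>p. frechet_derivative u (at p) (0, 1)"

lemma partials_trans: "w \<in> partials v \<Longrightarrow> v \<in> partials u \<Longrightarrow> w \<in> partials u"
proof (induction rule: partials.induct)
  case (dt w)
  then show ?case by (intro partials.dt) simp
next
  case (dx w)
  then show ?case by (intro partials.dx) simp
qed simp

lemma test_funD: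
  assumes "test_fun u"
  shows test_fun_periodic: "u (t, x + 2 * pi) = u (t, x)"
    and test_fun_partials_differentiable: "v \<in> partials u \<Longrightarrow> v differentiable (at p)"
    and test_fun_partials_bounded: "v \<in> partials u \<Longrightarrow> bounded (range (\<lambda>(t, x). \<bar>t\<bar> ^ N *\<^sub>R v (t, x)))"
proof -
  note A = assms[unfolded test_fun_def]
  show "u (t, x + 2 * pi) = u (t, x)"
    by (rule conjunct1[OF A, THEN spec, THEN spec])
  show "v differentiable (at p)" if "v \<in> partials u"
    by (rule conjunct2[OF A, THEN bspec, OF that, THEN conjunct1, THEN spec])
  show "bounded (range (\<lambda>(t, x). \<bar>t\<bar> ^ N *\<^sub>R v (t, x)))" if "v \<in> partials u"
    by (rule conjunct2[OF A, THEN bspec, OF that, THEN conjunct2, THEN spec])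
qed

lemma test_fun_differentiable: "test_fun u \<Longrightarrow> u differentiable (at p)"
  by (rule test_fun_partials_differentiable[OF _ partials.self])

lemma test_fun_has_derivative: "test_fun u \<Longrightarrow> (u has_derivative frechet_derivative u (at p)) (at p)"
  by (rule frechet_derivative_works[THEN iffD1, OF test_fun_differentiable])

lemma test_fun_continuous: "test_fun u \<Longrightarrow> continuous_on S u"
  by (intro continuous_at_imp_continuous_on ballI differentiable_imp_continuous_within test_fun_differentiable)

lemma frechet_derivative_periodic:
  assumes u: "test_fun u"
  shows "frechet_derivative u (at (t, x + 2 * pi)) = frechet_derivative u (at (t, x))"
proof -
  let ?s = "\<lambda>p :: real \<times> real. p + (0, 2 * pi)"
  have "(?s has_derivative (\<lambda>h. h + 0)) (at (t, x))"
    by (intro has_derivative_add has_derivative_ident has_derivative_const)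
  then have "(u \<circ> ?s has_derivative (frechet_derivative u (at (?s (t, x))) \<circ> (\<lambda>h. h + 0))) (at (t, x))"
    by (rule diff_chain_at) (rule test_fun_has_derivative[OF u])
  moreover have "u \<circ> ?s = u"
  proof
    fix p :: "real \<times> real"
    show "(u \<circ> ?s) p = u p"
      by (cases p) (simp only: o_def add_Pair add_0_right test_fun_periodic[OF u])
  qed
  ultimately have "(u has_derivative frechet_derivative u (at (t, x + 2 * pi))) (at (t, x))"
    by (simp only: o_def add_Pair add_0_right)
  from frechet_derivative_at[OF this] show ?thesis .
qed

lemma test_fun_partial:
  assumes u: "test_fun u" and v: "v = d_t u \<or> v = d_x u"
  shows "test_fun v"
proof -
  have vu: "v \<in> partials u"
    using v
  proof
    assume "v = d_t u"
    then show ?thesis by (simp only: partials.dt[OF partials.self])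
  next
    assume "v = d_x u"
    then show ?thesis by (simp only: partials.dx[OF partials.self])
  qed
  have per: "v (t, x + 2 * pi) = v (t, x)" for t x
    using v by (elim disjE) (simp_all only: frechet_derivative_periodic[OF u])
  show ?thesis
    unfolding test_fun_def
  proof (intro conjI allI ballI)
    fix w p N assume "w \<in> partials v"
    then have "w \<in> partials u" using vu by (rule partials_trans)
    then show "w differentiable (at p)" "bounded (range (\<lambda>(t, x). \<bar>t\<bar> ^ N *\<^sub>R w (t, x)))"
      by (rule test_funD[OF u])+
  qed (rule per)
qed

lemma test_fun_d_t: "test_fun u \<Longrightarrow> test_fun (d_t u)"
  by (rule test_fun_partial[of u]) simp_all

lemma test_fun_d_x: "test_fun u \<Longrightarrow> test_fun (d_x u)"
  by (rule test_fun_partial[of u]) simp_all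

lemma d_t_has_vector_derivative:
  assumes "test_fun u"
  shows "((\<lambda>t. u (t, x)) has_vector_derivative d_t u (t, x)) (at t)"
proof -
  have "((\<lambda>t. (t, x)) has_derivative (\<lambda>h. (h, 0))) (at t)"
    by (auto intro!: derivative_eq_intros)
  then have "(u \<circ> (\<lambda>t. (t, x)) has_derivative (frechet_derivative u (at (t, x)) \<circ> (\<lambda>h. (h, 0)))) (at t)"
    by (rule diff_chain_at) (rule test_fun_has_derivative[OF assms])
  moreover have "frechet_derivative u (at (t, x)) \<circ> (\<lambda>h. (h, 0)) = (\<lambda>h. h *\<^sub>R d_t u (t, x))"
  proof
    fix h
    show "(frechet_derivative u (at (t, x)) \<circ> (\<lambda>h. (h, 0))) h = h *\<^sub>R d_t u (t, x)"
      using linear_scale[OF has_derivative_linear[OF test_fun_has_derivative[OF assms]], of "(t, x)" h "(1, 0)"] by simp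
  qed
  ultimately show ?thesis
    by (simp only: has_vector_derivative_def o_def)
qed

lemma d_x_has_vector_derivative:
  assumes "test_fun u"
  shows "((\<lambda>x. u (t, x)) has_vector_derivative d_x u (t, x)) (at x)"
proof -
  have "((\<lambda>x. (t, x)) has_derivative (\<lambda>h. (0, h))) (at x)"
    by (auto intro!: derivative_eq_intros)
  then have "(u \<circ> (\<lambda>x. (t, x)) has_derivative (frechet_derivative u (at (t, x)) \<circ> (\<lambda>h. (0, h)))) (at x)"
    by (rule diff_chain_at) (rule test_fun_has_derivative[OF assms])
  moreover have "frechet_derivative u (at (t, x)) \<circ> (\<lambda>h. (0, h)) = (\<lambda>h. h *\<^sub>R d_x u (t, x))"
  proof
    fix h
    show "(frechet_derivative u (at (t, x)) \<circ> (\<lambda>h. (0, h))) h = h *\<^sub>R d_x u (t, x)"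
      using linear_scale[OF has_derivative_linear[OF test_fun_has_derivative[OF assms]], of "(t, x)" h "(0, 1)"] by simp
  qed
  ultimately show ?thesis
    by (simp only: has_vector_derivative_def o_def)
qed

lemma continuous_on_cis_linear: "continuous_on S (\<lambda>x. cis (c * x))"
  by (intro continuous_at_imp_continuous_on ballI has_vector_derivative_continuous[OF has_vector_derivative_cis_linear])

lemma continuous_on_cis_compose [continuous_intros]:
  "continuous_on S g \<Longrightarrow> continuous_on S (\<lambda>x. cis (g x))"
  using continuous_on_compose2[OF continuous_on_cis_linear[of UNIV 1]] by auto

lemma fourier_x_eq_integral:
  assumes "continuous_on {0..2 * pi} f"
  shows "fourier_x f \<xi> = 1 / sqrt (2 * pi) * integral {0..2 * pi} (\<lambda>x. f x * cis (- (x * of_int \<xi>)))"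
    and "set_integrable lborel {0..2 * pi} (\<lambda>x. f x * cis (- (x * of_int \<xi>)))"
proof -
  have "continuous_on {0..2 * pi} (\<lambda>x. f x * cis (- (x * of_int \<xi>)))"
    by (intro continuous_intros assms)
  then show *: "set_integrable lborel {0..2 * pi} (\<lambda>x. f x * cis (- (x * of_int \<xi>)))"
    unfolding set_integrable_def by (intro borel_integrable_compact) auto
  show "fourier_x f \<xi> = 1 / sqrt (2 * pi) * integral {0..2 * pi} (\<lambda>x. f x * cis (- (x * of_int \<xi>)))"
    unfolding fourier_x_def set_borel_integral_eq_integral(2)[OF *] ..
qed

lemma test_fun_continuous_x: "test_fun u \<Longrightarrow> continuous_on S (\<lambda>x. u (t, x))"
  by (rule continuous_on_compose2[OF test_fun_continuous[of u UNIV]]) (auto intro!: continuous_intros)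

lemma coef_d_t:
  assumes u: "test_fun u"
  shows "(coef u \<xi> has_vector_derivative coef (d_t u) \<xi> t) (at t)"
proof -
  have "((\<lambda>t. integral (cbox 0 (2 * pi)) (\<lambda>x. u (t, x) * cis (- (x * of_int \<xi>)))) has_vector_derivative
      integral (cbox 0 (2 * pi)) (\<lambda>x. d_t u (t, x) * cis (- (x * of_int \<xi>)))) (at t within UNIV)"
  proof (rule leibniz_rule_vector_derivative)
    show "((\<lambda>t. u (t, x) * cis (- (x * of_int \<xi>))) has_vector_derivative d_t u (t, x) * cis (- (x * of_int \<xi>))) (at t within UNIV)" for t x
      by (rule has_vector_derivative_mult_left) (use d_t_has_vector_derivative[OF u, of x t] in simp)
    show "(\<lambda>x. u (t, x) * cis (- (x * of_int \<xi>))) integrable_on cbox 0 (2 * pi)" for t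
      by (intro integrable_continuous continuous_intros test_fun_continuous_x[OF u])
    have "continuous_on (UNIV \<times> cbox 0 (2 * pi)) (\<lambda>p. d_t u p * cis (- (snd p * of_int \<xi>)))"
      by (intro continuous_intros test_fun_continuous[OF test_fun_d_t[OF u]])
    then show "continuous_on (UNIV \<times> cbox 0 (2 * pi)) (\<lambda>(t, x). d_t u (t, x) * cis (- (x * of_int \<xi>)))"
      by (simp add: split_beta)
  qed auto
  from has_vector_derivative_mult_right[OF this, of "1 / sqrt (2 * pi)"]
  show ?thesis
    unfolding coef_def[abs_def]
    by (simp add: fourier_x_eq_integral(1)[OF test_fun_continuous_x[OF u]]
        fourier_x_eq_integral(1)[OF test_fun_continuous_x[OF test_fun_d_t[OF u]]])
qed

text \<open>
  Integration by parts over a period; the boundary terms cancel by periodicity.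
\<close>

lemma coef_d_x:
  assumes u: "test_fun u"
  shows "coef (d_x u) \<xi> t = \<i> * of_int \<xi> * coef u \<xi> t"
proof -
  let ?c = "\<lambda>x. cis (- (x * of_int \<xi>))"
  have c: "(?c has_vector_derivative - of_int \<xi> * \<i> * ?c x) (at x)" for x
    using has_vector_derivative_cis_linear[of "- of_int \<xi>" x] by (simp add: mult.commute)
  have "((\<lambda>x. u (t, x) * (- of_int \<xi> * \<i> * ?c x) + d_x u (t, x) * ?c x) has_integral
      (u (t, 2 * pi) * ?c (2 * pi) - u (t, 0) * ?c 0)) {0..2 * pi}"
  proof (rule fundamental_theorem_of_calculus)
    fix x
    have "((\<lambda>x. u (t, x) * ?c x) has_vector_derivative u (t, x) * (- of_int \<xi> * \<i> * ?c x) + d_x u (t, x) * ?c x) (at x)"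
      by (intro has_vector_derivative_mult d_x_has_vector_derivative[OF u] c)
    then show "((\<lambda>x. u (t, x) * ?c x) has_vector_derivative u (t, x) * (- of_int \<xi> * \<i> * ?c x) + d_x u (t, x) * ?c x)
        (at x within {0..2 * pi})"
      by (rule has_vector_derivative_at_within)
  qed simp
  moreover have "?c (2 * pi) = 1"
    using cis_multiple_2pi[of "- of_int \<xi>"] by simp
  ultimately have "((\<lambda>x. u (t, x) * (- of_int \<xi> * \<i> * ?c x) + d_x u (t, x) * ?c x) has_integral 0) {0..2 * pi}"
    using test_fun_periodic[OF u, of t 0] by simp
  then have "integral {0..2 * pi} (\<lambda>x. - (of_int \<xi> * \<i>) * (u (t, x) * ?c x) + d_x u (t, x) * ?c x) = 0"
    by (intro integral_unique) (simp add: mult_ac)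
  moreover have "integral {0..2 * pi} (\<lambda>x. - (of_int \<xi> * \<i>) * (u (t, x) * ?c x) + d_x u (t, x) * ?c x)
      = integral {0..2 * pi} (\<lambda>x. - (of_int \<xi> * \<i>) * (u (t, x) * ?c x)) + integral {0..2 * pi} (\<lambda>x. d_x u (t, x) * ?c x)"
    by (intro Henstock_Kurzweil_Integration.integral_add integrable_continuous_real continuous_intros
        test_fun_continuous_x[OF u] test_fun_continuous_x[OF test_fun_d_x[OF u]])
  moreover have "integral {0..2 * pi} (\<lambda>x. - (of_int \<xi> * \<i>) * (u (t, x) * ?c x)) = - (of_int \<xi> * \<i>) * integral {0..2 * pi} (\<lambda>x. u (t, x) * ?c x)"
    by (rule Henstock_Kurzweil_Integration.integral_mult_right)
  ultimately have "- (of_int \<xi> * \<i>) * integral {0..2 * pi} (\<lambda>x. u (t, x) * ?c x) + integral {0..2 * pi} (\<lambda>x. d_x u (t, x) * ?c x) = 0"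
    by (simp only:)
  then have "integral {0..2 * pi} (\<lambda>x. d_x u (t, x) * ?c x) = of_int \<xi> * \<i> * integral {0..2 * pi} (\<lambda>x. u (t, x) * ?c x)"
    by (simp add: add_eq_0_iff)
  then show ?thesis
    by (simp add: coef_def fourier_x_eq_integral(1)[OF test_fun_continuous_x[OF u]]
        fourier_x_eq_integral(1)[OF test_fun_continuous_x[OF test_fun_d_x[OF u]]])
qed

lemma norm_fourier_x_le:
  assumes f: "continuous_on {0..2 * pi} f" and B: "\<And>x. cmod (f x) \<le> B"
  shows "cmod (fourier_x f \<xi>) \<le> B * (2 * pi)"
proof -
  have "cmod (integral (cbox 0 (2 * pi)) (\<lambda>x. f x * cis (- (x * of_int \<xi>)))) \<le> B * measure lborel (cbox 0 (2 * pi))"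
  proof (rule has_integral_bound)
    show "0 \<le> B" using B[of 0] norm_ge_zero order.trans by blast
    have "(\<lambda>x. f x * cis (- (x * of_int \<xi>))) integrable_on cbox 0 (2 * pi)"
      using f by (intro integrable_continuous continuous_intros) simp
    then show "((\<lambda>x. f x * cis (- (x * of_int \<xi>))) has_integral integral (cbox 0 (2 * pi)) (\<lambda>x. f x * cis (- (x * of_int \<xi>)))) (cbox 0 (2 * pi))"
      by (rule integrable_integral)
  qed (simp add: norm_mult B)
  then have "cmod (integral {0..2 * pi} (\<lambda>x. f x * cis (- (x * of_int \<xi>)))) \<le> B * (2 * pi)"
    by simp
  moreover have "cmod (fourier_x f \<xi>) \<le> 1 * cmod (integral {0..2 * pi} (\<lambda>x. f x * cis (- (x * of_int \<xi>))))"
    unfolding fourier_x_eq_integral(1)[OF f] norm_mult norm_ft_factor(1)[simplified]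
    using norm_ft_factor by (intro mult_right_mono) (auto simp: norm_divide)
  ultimately show ?thesis by simp
qed

lemma coef_polynomial_decay:
  "test_fun u \<Longrightarrow> \<exists>C\<ge>0. \<forall>\<xi> t. \<bar>t\<bar> ^ N * (\<bar>of_int \<xi>\<bar> ^ M * cmod (coef u \<xi> t)) \<le> C"
proof (induction M arbitrary: u)
  case 0
  then have "bounded (range (\<lambda>(t, x). \<bar>t\<bar> ^ N *\<^sub>R u (t, x)))"
    by (rule test_fun_partials_bounded[OF _ partials.self])
  then obtain B where B: "\<And>t x. \<bar>t\<bar> ^ N * cmod (u (t, x)) \<le> B"
    by (auto simp: bounded_iff)
  have B0: "0 \<le> B" by (rule order.trans[OF _ B[of 0 0]]) simp
  have "\<bar>t\<bar> ^ N * (\<bar>of_int \<xi>\<bar> ^ 0 * cmod (coef u \<xi> t)) \<le> B * (2 * pi)" for \<xi> t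
  proof -
    have "fourier_x (\<lambda>x. of_real (\<bar>t\<bar> ^ N) * u (t, x)) \<xi> = of_real (\<bar>t\<bar> ^ N) * coef u \<xi> t"
      unfolding coef_def fourier_x_def
      by (simp only: mult.assoc set_integral_mult_right) (simp only: mult.left_commute)
    moreover have "cmod (fourier_x (\<lambda>x. of_real (\<bar>t\<bar> ^ N) * u (t, x)) \<xi>) \<le> B * (2 * pi)"
    proof (rule norm_fourier_x_le)
      show "continuous_on {0..2 * pi} (\<lambda>x. of_real (\<bar>t\<bar> ^ N) * u (t, x))"
        by (intro continuous_on_mult continuous_on_const test_fun_continuous_x 0)
      show "cmod (of_real (\<bar>t\<bar> ^ N) * u (t, x)) \<le> B" for x
        using B[of t x] by (simp add: norm_mult norm_power)
    qed
    ultimately show ?thesis by (simp add: norm_mult norm_power)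
  qed
  then show ?case using B0 by (intro exI[of _ "B * (2 * pi)"]) auto
next
  case (Suc M)
  from Suc.IH[OF test_fun_d_x[OF Suc.prems]] obtain C where C: "0 \<le> C"
    "\<And>\<xi> t. \<bar>t\<bar> ^ N * (\<bar>of_int \<xi>\<bar> ^ M * cmod (coef (d_x u) \<xi> t)) \<le> C" by blast
  have "\<bar>t\<bar> ^ N * (\<bar>of_int \<xi>\<bar> ^ Suc M * cmod (coef u \<xi> t)) \<le> C" for \<xi> t
    using C(2)[of t \<xi>] by (simp add: coef_d_x[OF Suc.prems] norm_mult mult_ac)
  with C(1) show ?case by blast
qed

lemma rapid_coef:
  assumes u: "test_fun u"
  shows "rapid (coef u)"
  unfolding rapid_def
proof
  fix N
  obtain A where A: "\<And>\<xi> t. \<bar>t\<bar> ^ 0 * (\<bar>of_int \<xi>\<bar> ^ 0 * cmod (coef u \<xi> t)) \<le> A" using coef_polynomial_decay[OF u] by blast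
  obtain B where B: "\<And>\<xi> t. \<bar>t\<bar> ^ N * (\<bar>of_int \<xi>\<bar> ^ 0 * cmod (coef u \<xi> t)) \<le> B" using coef_polynomial_decay[OF u] by blast
  obtain C where C: "\<And>\<xi> t. \<bar>t\<bar> ^ 0 * (\<bar>of_int \<xi>\<bar> ^ N * cmod (coef u \<xi> t)) \<le> C" using coef_polynomial_decay[OF u] by blast
  obtain D where D: "\<And>\<xi> t. \<bar>t\<bar> ^ N * (\<bar>of_int \<xi>\<bar> ^ N * cmod (coef u \<xi> t)) \<le> D" using coef_polynomial_decay[OF u] by blast
  have "cmod (coef u \<xi> t) * (wt (of_int \<xi>) * wt t) ^ N \<le> 4 ^ N * (A + B + C + D)" for \<xi> t
  proof -
    have "cmod (coef u \<xi> t) * (wt (of_int \<xi>) ^ N * wt t ^ N)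
        \<le> cmod (coef u \<xi> t) * ((2 ^ N * (1 + \<bar>of_int \<xi>\<bar> ^ N)) * (2 ^ N * (1 + \<bar>t\<bar> ^ N)))"
      by (intro mult_left_mono mult_mono wt_power_le) auto
    also have "\<dots> = (2 ^ N * 2 ^ N) * (\<bar>t\<bar> ^ 0 * (\<bar>of_int \<xi>\<bar> ^ 0 * cmod (coef u \<xi> t)) + \<bar>t\<bar> ^ N * (\<bar>of_int \<xi>\<bar> ^ 0 * cmod (coef u \<xi> t))
        + \<bar>t\<bar> ^ 0 * (\<bar>of_int \<xi>\<bar> ^ N * cmod (coef u \<xi> t)) + \<bar>t\<bar> ^ N * (\<bar>of_int \<xi>\<bar> ^ N * cmod (coef u \<xi> t)))"
      by (simp add: algebra_simps)
    also have "\<dots> \<le> (2 ^ N * 2 ^ N) * (A + B + C + D)"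
      by (intro mult_left_mono add_mono A B C D) auto
    also have "(2 ^ N * 2 ^ N :: real) = 4 ^ N"
      by (simp flip: power_mult_distrib)
    finally show ?thesis by (simp add: power_mult_distrib)
  qed
  then show "\<exists>C. \<forall>\<xi> t. cmod (coef u \<xi> t) * (wt (of_int \<xi>) * wt t) ^ N \<le> C" by blast
qed

lemma smooth_upto_coef: "test_fun u \<Longrightarrow> smooth_upto k (coef u)"
proof (induction k arbitrary: u)
  case (Suc k)
  show ?case
    by (rule smooth_upto_SucI[OF rapid_coef[OF Suc.prems] coef_d_t[OF Suc.prems] Suc.IH[OF test_fun_d_t[OF Suc.prems]]])
qed (simp add: rapid_coef)

lemma schwartz_coef: "test_fun u \<Longrightarrow> schwartz (coef u)"
  unfolding schwartz_def using smooth_upto_coef by blast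

lemma coef_diff:
  assumes "test_fun u" "test_fun v"
  shows "coef (\<lambda>p. u p - v p) = (\<lambda>\<xi> t. coef u \<xi> t - coef v \<xi> t)"
proof (intro ext)
  fix \<xi> t
  let ?c = "\<lambda>x. cis (- (x * of_int \<xi>))"
  have "(\<lambda>x. u (t, x) * ?c x) integrable_on {0..2 * pi}" "(\<lambda>x. v (t, x) * ?c x) integrable_on {0..2 * pi}"
    by (intro integrable_continuous_real continuous_intros assms[THEN test_fun_continuous_x])+
  moreover have "continuous_on {0..2 * pi} (\<lambda>x. u (t, x) - v (t, x))"
    by (intro continuous_intros assms[THEN test_fun_continuous_x])
  ultimately show "coef (\<lambda>p. u p - v p) \<xi> t = coef u \<xi> t - coef v \<xi> t"
    unfolding coef_def
    by (simp add: fourier_x_eq_integral(1) assms[THEN test_fun_continuous_x] left_diff_distrib right_diff_distrib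
        Henstock_Kurzweil_Integration.integral_diff)
qed

section \<open>Fourier series of rapidly decreasing families\<close>

text \<open>
  Term-by-term differentiation in \<open>(t, x)\<close> jointly. Both partial derivatives are again Fourier
  series of \<open>schwartz\<close> families, which is why \<open>partials_synth\<close> can induct.
\<close>

lemma synth_has_derivative:
  assumes a: "schwartz a"
  shows "(synth a has_derivative
    (\<lambda>h. fst h *\<^sub>R synth (time_deriv a) p + snd h *\<^sub>R synth (\<lambda>\<xi> t. \<i> * of_int \<xi> * a \<xi> t) p)) (at p)"
proof -
  define f where "f \<xi> p = a \<xi> (fst p) * cis (snd p * of_int \<xi>)" for \<xi> and p :: "real \<times> real"
  define f1 where "f1 \<xi> p = time_deriv a \<xi> (fst p) * cis (snd p * of_int \<xi>)" for \<xi> and p :: "real \<times> real"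
  define f2 where "f2 \<xi> p = \<i> * of_int \<xi> * a \<xi> (fst p) * cis (snd p * of_int \<xi>)" for \<xi> and p :: "real \<times> real"
  have a': "schwartz (time_deriv a)" by (rule schwartz_time_deriv[OF a])
  have a2: "schwartz (\<lambda>\<xi> t. \<i> * of_int \<xi> * a \<xi> t)"
    by (rule schwartz_mult_int[OF _ a]) (simp add: norm_mult wt_def)
  have bound: "\<exists>C\<ge>0. \<forall>\<xi> t. cmod (c \<xi> t) \<le> C * decay (of_int \<xi>)" if c: "schwartz c" for c
  proof -
    obtain C where C: "0 \<le> C" "\<And>\<xi> t. cmod (c \<xi> t) \<le> C / wt (of_int \<xi>) ^ 2 * decay t"
      using schwartz_decay_bound[OF c] by metis
    have "cmod (c \<xi> t) \<le> C * decay (of_int \<xi>)" for \<xi> t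
    proof -
      have "C / wt (of_int \<xi>) ^ 2 * decay t \<le> C / wt (of_int \<xi>) ^ 2 * 1"
        using C(1) by (intro mult_left_mono decay_le_1) auto
      with C(2)[of \<xi> t] show ?thesis by (simp add: decay_def)
    qed
    with C(1) show ?thesis by blast
  qed
  obtain C0 where C0: "0 \<le> C0" "\<And>\<xi> t. cmod (a \<xi> t) \<le> C0 * decay (of_int \<xi>)" using bound[OF a] by blast
  obtain C1 where C1: "0 \<le> C1" "\<And>\<xi> t. cmod (time_deriv a \<xi> t) \<le> C1 * decay (of_int \<xi>)" using bound[OF a'] by blast
  obtain C2 where C2: "0 \<le> C2" "\<And>\<xi> t. cmod (\<i> * of_int \<xi> * a \<xi> t) \<le> C2 * decay (of_int \<xi>)" using bound[OF a2] by blast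
  have sm: "(\<lambda>\<xi>. cmod (f \<xi> q)) summable_on UNIV" for q
    by (rule Infinite_Sum.abs_summable_on_comparison_test'[OF summable_on_cmult_right[OF summable_decay, of C0]])
       (simp add: f_def norm_mult C0)
  have sm1: "(\<lambda>\<xi>. f1 \<xi> q) summable_on UNIV" for q
    by (rule Infinite_Sum.abs_summable_summable, rule Infinite_Sum.abs_summable_on_comparison_test'[OF summable_on_cmult_right[OF summable_decay, of C1]])
       (simp add: f1_def norm_mult C1)
  have sm2: "(\<lambda>\<xi>. f2 \<xi> q) summable_on UNIV" for q
    by (rule Infinite_Sum.abs_summable_summable, rule Infinite_Sum.abs_summable_on_comparison_test'[OF summable_on_cmult_right[OF summable_decay, of C2]])
       (use C2 in \<open>simp add: f2_def norm_mult\<close>)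
  have der: "((\<lambda>q. \<Sum>\<^sub>\<infinity>\<xi>. f \<xi> q) has_derivative (\<lambda>h. \<Sum>\<^sub>\<infinity>\<xi>. fst h *\<^sub>R f1 \<xi> p + snd h *\<^sub>R f2 \<xi> p)) (at p)"
  proof (rule has_derivative_infsum[where B = "\<lambda>\<xi>. (C1 + C2) * decay (of_int \<xi>)"])
    fix \<xi> and q h :: "real \<times> real"
    have "((\<lambda>q :: real \<times> real. a \<xi> (fst q)) has_derivative (\<lambda>h. fst h *\<^sub>R time_deriv a \<xi> (fst q))) (at q)"
      using diff_chain_at[OF has_derivative_fst[OF has_derivative_ident]
          schwartz_has_vector_derivative[OF a, of \<xi> "fst q", unfolded has_vector_derivative_def], unfolded o_def] by simp
    moreover have "((\<lambda>q :: real \<times> real. cis (of_int \<xi> * snd q)) has_derivative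
        (\<lambda>h. snd h *\<^sub>R (of_real (of_int \<xi>) * \<i> * cis (of_int \<xi> * snd q)))) (at q)"
      using diff_chain_at[OF has_derivative_snd[OF has_derivative_ident]
          has_vector_derivative_cis_linear[of "of_int \<xi>" "snd q", unfolded has_vector_derivative_def], unfolded o_def] by simp
    ultimately have "((\<lambda>q :: real \<times> real. a \<xi> (fst q) * cis (of_int \<xi> * snd q)) has_derivative
        (\<lambda>h. a \<xi> (fst q) * (snd h *\<^sub>R (of_real (of_int \<xi>) * \<i> * cis (of_int \<xi> * snd q)))
          + fst h *\<^sub>R time_deriv a \<xi> (fst q) * cis (of_int \<xi> * snd q))) (at q)"
      by (rule has_derivative_mult)
    then show "(f \<xi> has_derivative (\<lambda>h. fst h *\<^sub>R f1 \<xi> q + snd h *\<^sub>R f2 \<xi> q)) (at q)"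
      unfolding f_def[abs_def] f1_def f2_def by (simp add: scaleR_conv_of_real mult_ac add.commute)
    have "cmod (fst h *\<^sub>R f1 \<xi> q + snd h *\<^sub>R f2 \<xi> q) \<le> \<bar>fst h\<bar> * cmod (f1 \<xi> q) + \<bar>snd h\<bar> * cmod (f2 \<xi> q)"
      by (rule order.trans[OF norm_triangle_ineq]) simp
    also have "\<dots> \<le> norm h * (C1 * decay (of_int \<xi>)) + norm h * (C2 * decay (of_int \<xi>))"
    proof (intro add_mono mult_mono)
      show "\<bar>fst h\<bar> \<le> norm h" "\<bar>snd h\<bar> \<le> norm h"
        using norm_fst_le[of "fst h" "snd h"] norm_snd_le[of "snd h" "fst h"] by simp_all
      show "cmod (f1 \<xi> q) \<le> C1 * decay (of_int \<xi>)" using C1(2) by (simp add: f1_def norm_mult)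
      show "cmod (f2 \<xi> q) \<le> C2 * decay (of_int \<xi>)" using C2(2) by (simp add: f2_def norm_mult)
    qed auto
    finally show "cmod (fst h *\<^sub>R f1 \<xi> q + snd h *\<^sub>R f2 \<xi> q) \<le> (C1 + C2) * decay (of_int \<xi>) * norm h"
      by (simp add: algebra_simps)
    show "0 \<le> (C1 + C2) * decay (of_int \<xi>)" using C1 C2 by simp
  qed (intro summable_on_cmult_right summable_decay sm)+
  have split: "(\<Sum>\<^sub>\<infinity>\<xi>. fst h *\<^sub>R f1 \<xi> p + snd h *\<^sub>R f2 \<xi> p) = fst h *\<^sub>R (\<Sum>\<^sub>\<infinity>\<xi>. f1 \<xi> p) + snd h *\<^sub>R (\<Sum>\<^sub>\<infinity>\<xi>. f2 \<xi> p)" for h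
    unfolding scaleR_conv_of_real
    by (subst infsum_add) (intro summable_on_cmult_right sm1 sm2, intro summable_on_cmult_right sm1 sm2, simp only: infsum_cmult_right')
  have "((\<lambda>q. of_real (1 / sqrt (2 * pi)) * (\<Sum>\<^sub>\<infinity>\<xi>. f \<xi> q)) has_derivative
      (\<lambda>h. of_real (1 / sqrt (2 * pi)) * (fst h *\<^sub>R (\<Sum>\<^sub>\<infinity>\<xi>. f1 \<xi> p) + snd h *\<^sub>R (\<Sum>\<^sub>\<infinity>\<xi>. f2 \<xi> p)))) (at p)"
    using has_derivative_mult_right[OF der[unfolded split]] .
  moreover have "(\<lambda>q. of_real (1 / sqrt (2 * pi)) * (\<Sum>\<^sub>\<infinity>\<xi>. f \<xi> q)) = synth a"
    by (simp add: synth_def f_def case_prod_unfold)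
  moreover have "of_real (1 / sqrt (2 * pi)) * (\<Sum>\<^sub>\<infinity>\<xi>. f1 \<xi> p) = synth (time_deriv a) p"
    by (simp add: synth_def f1_def split_beta)
  moreover have "of_real (1 / sqrt (2 * pi)) * (\<Sum>\<^sub>\<infinity>\<xi>. f2 \<xi> p) = synth (\<lambda>\<xi> t. \<i> * of_int \<xi> * a \<xi> t) p"
    by (simp add: synth_def f2_def split_beta)
  ultimately show ?thesis
    by (simp only: distrib_left mult_scaleR_right)
qed

lemma synth_bounded:
  assumes a: "schwartz a"
  shows "bounded (range (\<lambda>(t, x). \<bar>t\<bar> ^ N *\<^sub>R synth a (t, x)))"
proof -
  obtain C where C: "0 \<le> C" "\<And>\<xi> t. cmod (a \<xi> t) \<le> C / (wt (of_int \<xi>) * wt t) ^ (N + 2)"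
    using rapidD[OF schwartz_rapid[OF a]] by metis
  have pointwise: "\<bar>t\<bar> ^ N * cmod (a \<xi> t * cis (x * of_int \<xi>)) \<le> C * decay (of_int \<xi>)" for t x \<xi>
  proof -
    have "(wt (of_int \<xi>))\<^sup>2 * \<bar>t\<bar> ^ N \<le> wt (of_int \<xi>) ^ (N + 2) * wt t ^ N"
      by (intro mult_mono power_increasing power_mono) (auto simp: wt_ge_1, simp add: wt_def)
    also have "\<dots> \<le> wt (of_int \<xi>) ^ (N + 2) * wt t ^ (N + 2)"
      by (intro mult_left_mono power_increasing) (auto simp: wt_ge_1)
    finally have le: "(wt (of_int \<xi>))\<^sup>2 * \<bar>t\<bar> ^ N \<le> (wt (of_int \<xi>) * wt t) ^ (N + 2)"
      by (simp only: power_mult_distrib)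
    have "\<bar>t\<bar> ^ N * cmod (a \<xi> t) \<le> \<bar>t\<bar> ^ N * (C / (wt (of_int \<xi>) * wt t) ^ (N + 2))"
      by (intro mult_left_mono C) simp
    also have "\<dots> \<le> C / (wt (of_int \<xi>))\<^sup>2"
      using mult_left_mono[OF le C(1)] by (simp add: divide_simps mult_ac)
    finally show ?thesis by (simp add: norm_mult decay_def)
  qed
  have "cmod (\<bar>t\<bar> ^ N *\<^sub>R synth a (t, x)) \<le> C * (\<Sum>\<^sub>\<infinity>\<xi>::int. decay (of_int \<xi>))" for t x
  proof -
    let ?g = "\<lambda>\<xi>. of_real (\<bar>t\<bar> ^ N) * (a \<xi> t * cis (x * of_int \<xi>))"
    have g: "cmod (?g \<xi>) \<le> C * decay (of_int \<xi>)" for \<xi>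
      using pointwise[of t \<xi> x] by (simp add: norm_mult norm_power)
    have sg: "(\<lambda>\<xi>. cmod (?g \<xi>)) summable_on UNIV"
      by (rule Infinite_Sum.abs_summable_on_comparison_test'[OF summable_on_cmult_right[OF summable_decay, of C]]) (rule g)
    have "\<bar>t\<bar> ^ N *\<^sub>R synth a (t, x) = of_real (1 / sqrt (2 * pi)) * (\<Sum>\<^sub>\<infinity>\<xi>. ?g \<xi>)"
      by (simp add: synth_def scaleR_conv_of_real infsum_cmult_right')
    then have "cmod (\<bar>t\<bar> ^ N *\<^sub>R synth a (t, x)) = 1 / sqrt (2 * pi) * cmod (\<Sum>\<^sub>\<infinity>\<xi>. ?g \<xi>)"
      by (simp only: norm_mult norm_of_real) simp
    also have "\<dots> \<le> 1 * cmod (\<Sum>\<^sub>\<infinity>\<xi>. ?g \<xi>)"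
      by (intro mult_right_mono norm_ft_factor) simp
    also have "\<dots> \<le> (\<Sum>\<^sub>\<infinity>\<xi>. cmod (?g \<xi>))"
      using norm_infsum_bound[OF sg] by simp
    also have "\<dots> \<le> (\<Sum>\<^sub>\<infinity>\<xi>::int. C * decay (of_int \<xi>))"
      by (intro infsum_mono sg summable_on_cmult_right summable_decay g)
    also have "\<dots> = C * (\<Sum>\<^sub>\<infinity>\<xi>::int. decay (of_int \<xi>))"
      by (rule infsum_cmult_right')
    finally show ?thesis .
  qed
  then show ?thesis unfolding bounded_iff by auto
qed

lemma frechet_derivative_synth:
  assumes "schwartz a"
  shows "frechet_derivative (synth a) (at p) (1, 0) = synth (time_deriv a) p"
    and "frechet_derivative (synth a) (at p) (0, 1) = synth (\<lambda>\<xi> t. \<i> * of_int \<xi> * a \<xi> t) p"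
  unfolding frechet_derivative_at[OF synth_has_derivative[OF assms, of p], symmetric]
  by (simp_all only: fst_conv snd_conv scaleR_one scaleR_zero_left add_0_right add_0_left)

lemma partials_synth:
  assumes "v \<in> partials (synth a)" and a: "schwartz a"
  shows "\<exists>c. schwartz c \<and> v = synth c"
  using assms(1)
proof (induction rule: partials.induct)
  case self
  then show ?case using a by blast
next
  case (dt v)
  then obtain c where c: "schwartz c" "v = synth c" by blast
  have "(\<lambda>p. frechet_derivative v (at p) (1, 0)) = synth (time_deriv c)"
    unfolding c(2) by (rule ext) (rule frechet_derivative_synth[OF c(1)])
  then show ?case
    using schwartz_time_deriv[OF c(1)] by (intro exI[of _ "time_deriv c"] conjI)
next
  case (dx v)
  then obtain c where c: "schwartz c" "v = synth c" by blast
  have "(\<lambda>p. frechet_derivative v (at p) (0, 1)) = synth (\<lambda>\<xi> t. \<i> * of_int \<xi> * c \<xi> t)"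
    unfolding c(2) by (rule ext) (rule frechet_derivative_synth[OF c(1)])
  moreover have "schwartz (\<lambda>\<xi> t. \<i> * of_int \<xi> * c \<xi> t)"
    by (rule schwartz_mult_int[OF _ c(1)]) (simp add: norm_mult wt_def)
  ultimately show ?case
    by (intro exI[of _ "\<lambda>\<xi> t. \<i> * of_int \<xi> * c \<xi> t"] conjI)
qed

lemma test_fun_synth:
  assumes a: "schwartz a"
  shows "test_fun (synth a)"
  unfolding test_fun_def
proof (intro conjI allI ballI)
  fix t x
  have "cis ((x + 2 * pi) * of_int \<xi>) = cis (x * of_int \<xi>)" for \<xi> :: int
  proof -
    have "cis ((x + 2 * pi) * of_int \<xi>) = cis (x * of_int \<xi>) * cis (2 * pi * of_int \<xi>)"
      by (simp add: cis_mult algebra_simps)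
    then show ?thesis by simp
  qed
  then show "synth a (t, x + 2 * pi) = synth a (t, x)"
    by (simp add: synth_def)
next
  fix v p and N :: nat
  assume "v \<in> partials (synth a)"
  then obtain c where c: "schwartz c" "v = synth c" using partials_synth[OF _ a] by blast
  show "v differentiable (at p)"
    unfolding c(2) by (rule differentiableI[OF synth_has_derivative[OF c(1)]])
  show "bounded (range (\<lambda>(t, x). \<bar>t\<bar> ^ N *\<^sub>R v (t, x)))"
    unfolding c(2) by (rule synth_bounded[OF c(1)])
qed

lemma integral_cis_orthogonal:
  fixes \<eta> \<xi> :: int
  shows "(LINT x:{0..2 * pi}|lborel. cis (x * of_int \<eta>) * cis (- (x * of_int \<xi>))) = (if \<eta> = \<xi> then of_real (2 * pi) else 0)"
proof -
  define m where "m = \<eta> - \<xi>"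
  have eq: "cis (x * of_int \<eta>) * cis (- (x * of_int \<xi>)) = cis (of_int m * x)" for x
    by (simp add: cis_mult m_def algebra_simps)
  have "set_integrable lborel {0..2 * pi} (\<lambda>x. cis (of_int m * x))"
    unfolding set_integrable_def by (intro borel_integrable_compact continuous_intros) auto
  then have "(LINT x:{0..2 * pi}|lborel. cis (of_int m * x)) = integral {0..2 * pi} (\<lambda>x. cis (of_int m * x))"
    by (rule set_borel_integral_eq_integral)
  also have "\<dots> = (if \<eta> = \<xi> then of_real (2 * pi) else 0)"
  proof (cases "\<eta> = \<xi>")
    case True
    then show ?thesis by (simp add: m_def scaleR_conv_of_real)
  next
    case False
    then have m0: "m \<noteq> 0" by (simp add: m_def)
    have "((\<lambda>x. cis (of_int m * x)) has_integral
        (1 / (of_int m * \<i>) * cis (of_int m * (2 * pi)) - 1 / (of_int m * \<i>) * cis (of_int m * 0))) {0..2 * pi}"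
    proof (rule fundamental_theorem_of_calculus)
      fix x
      have "((\<lambda>x. 1 / (of_int m * \<i>) * cis (of_int m * x)) has_vector_derivative
          1 / (of_int m * \<i>) * (of_real (of_int m) * \<i> * cis (of_int m * x))) (at x within {0..2 * pi})"
        by (intro has_vector_derivative_mult_right has_vector_derivative_at_within[OF has_vector_derivative_cis_linear])
      then show "((\<lambda>x. 1 / (of_int m * \<i>) * cis (of_int m * x)) has_vector_derivative cis (of_int m * x)) (at x within {0..2 * pi})"
        using m0 by simp
    qed simp
    moreover have "cis (of_int m * (2 * pi)) = 1"
      using cis_multiple_2pi[of "of_int m"] by (simp add: mult.commute)
    ultimately have "integral {0..2 * pi} (\<lambda>x. cis (of_int m * x)) = 0"
      by (intro integral_unique) simp
    with False show ?thesis by simp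
  qed
  finally show ?thesis by (simp only: eq)
qed

text \<open>
  Orthogonality of the characters; the series may be integrated term by term because it
  converges absolutely, uniformly in \<open>x\<close>.
\<close>

lemma coef_synth:
  assumes a: "schwartz a"
  shows "coef (synth a) = a"
proof (intro ext)
  fix \<xi> t
  obtain C where C: "0 \<le> C" "\<And>\<eta> t. cmod (a \<eta> t) \<le> C / wt (of_int \<eta>) ^ 2 * decay t"
    using schwartz_decay_bound[OF a] by metis
  have Cb: "cmod (a \<eta> t) \<le> C * decay (of_int \<eta>)" for \<eta>
  proof -
    have "C / wt (of_int \<eta>) ^ 2 * decay t \<le> C / wt (of_int \<eta>) ^ 2 * 1"
      using C(1) by (intro mult_left_mono decay_le_1) auto
    with C(2)[of \<eta> t] show ?thesis by (simp add: decay_def)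
  qed
  let ?I = "{0..2 * pi}"
  let ?g = "\<lambda>\<eta> x. a \<eta> t * (indicator ?I x *\<^sub>R (cis (x * of_int \<eta>) * cis (- (x * of_int \<xi>))))"
  have swap: "(LINT x|lborel. (\<Sum>\<^sub>\<infinity>\<eta>. ?g \<eta> x)) = (\<Sum>\<^sub>\<infinity>\<eta>. LINT x|lborel. ?g \<eta> x)"
  proof (rule integral_infsum[where B = "\<lambda>\<eta>. C * decay (of_int \<eta>)" and w = "indicator ?I"])
    show "infinite (UNIV :: int set)" by (rule infinite_UNIV_int)
    show "cmod (?g \<eta> x) \<le> C * decay (of_int \<eta>) * indicator ?I x" for \<eta> x
      using Cb[of \<eta>] by (simp add: norm_mult indicator_def)
    show "(\<lambda>\<eta>::int. C * decay (of_int \<eta>)) summable_on UNIV"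
      by (intro summable_on_cmult_right summable_decay)
    show "integrable lborel (indicator ?I :: real \<Rightarrow> real)" by simp
  qed (use C in auto)
  have "(LINT x:?I|lborel. synth a (t, x) * cis (- (x * of_int \<xi>)))
      = (LINT x|lborel. of_real (1 / sqrt (2 * pi)) * (\<Sum>\<^sub>\<infinity>\<eta>. ?g \<eta> x))"
    unfolding set_lebesgue_integral_def
  proof (intro Bochner_Integration.integral_cong refl)
    fix x
    have "(\<Sum>\<^sub>\<infinity>\<eta>. ?g \<eta> x) = (\<Sum>\<^sub>\<infinity>\<eta>. (a \<eta> t * cis (x * of_int \<eta>)) * (indicator ?I x *\<^sub>R cis (- (x * of_int \<xi>))))"
      by (intro infsum_cong) (simp add: indicator_def)
    also have "\<dots> = (\<Sum>\<^sub>\<infinity>\<eta>. a \<eta> t * cis (x * of_int \<eta>)) * (indicator ?I x *\<^sub>R cis (- (x * of_int \<xi>)))"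
      by (rule infsum_cmult_left')
    finally show "indicator ?I x *\<^sub>R (synth a (t, x) * cis (- (x * of_int \<xi>))) = of_real (1 / sqrt (2 * pi)) * (\<Sum>\<^sub>\<infinity>\<eta>. ?g \<eta> x)"
      by (simp add: synth_def)
  qed
  also have "\<dots> = of_real (1 / sqrt (2 * pi)) * (\<Sum>\<^sub>\<infinity>\<eta>. a \<eta> t * (if \<eta> = \<xi> then of_real (2 * pi) else 0))"
    by (simp only: integral_mult_right_zero swap integral_cis_orthogonal[unfolded set_lebesgue_integral_def])
  also have "(\<Sum>\<^sub>\<infinity>\<eta>. a \<eta> t * (if \<eta> = \<xi> then of_real (2 * pi) else 0)) = (\<Sum>\<^sub>\<infinity>\<eta>\<in>{\<xi>}. a \<eta> t * of_real (2 * pi))"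
    by (intro infsum_cong_neutral) auto
  also have "\<dots> = a \<xi> t * of_real (2 * pi)" by simp
  finally have "coef (synth a) \<xi> t = of_real (1 / sqrt (2 * pi)) * (of_real (1 / sqrt (2 * pi)) * (a \<xi> t * of_real (2 * pi)))"
    by (simp only: coef_def fourier_x_def)
  also have "\<dots> = of_real (1 / sqrt (2 * pi) * (1 / sqrt (2 * pi)) * (2 * pi)) * a \<xi> t"
    by (simp only: of_real_mult mult_ac)
  also have "1 / sqrt (2 * pi) * (1 / sqrt (2 * pi)) * (2 * pi) = 1"
    by (simp add: divide_simps)
  finally show "coef (synth a) \<xi> t = a \<xi> t" by simp
qed

lemma fourier_x_cnj: "fourier_x (\<lambda>x. cnj (f x)) \<xi> = cnj (fourier_x f (- \<xi>))"
proof -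
  have "(\<lambda>x. indicator {0..2 * pi} x *\<^sub>R (cnj (f x) * cis (- (x * of_int \<xi>))))
      = (\<lambda>x. cnj (indicator {0..2 * pi} x *\<^sub>R (f x * cis (- (x * of_int (- \<xi>))))))"
    by (simp add: cis_cnj fun_eq_iff)
  then have "(LINT x:{0..2 * pi}|lborel. cnj (f x) * cis (- (x * of_int \<xi>))) = cnj (LINT x:{0..2 * pi}|lborel. f x * cis (- (x * of_int (- \<xi>))))"
    unfolding set_lebesgue_integral_def by (simp only: Bochner_Integration.integral_cnj)
  then show ?thesis
    unfolding fourier_x_def by (simp only: complex_cnj_mult) simp
qed

lemma C1_coeff_eq_trilinear: "C1_coeff u1 u2 u3 t \<xi> = trilinear (coef u1) (coef u2) (coef u3) \<xi> t"
proof -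
  let ?S = "{(\<xi>1, \<xi>2, \<xi>3). \<xi> = \<xi>1 + \<xi>2 + \<xi>3 \<and> \<xi>1 \<noteq> \<xi> \<and> \<xi>2 \<noteq> \<xi>}"
  let ?A = "{(j, k). j \<noteq> \<xi> \<and> k \<noteq> \<xi>}"
  let ?h = "\<lambda>(j, k). (j, k, \<xi> - j - k)"
  let ?F = "\<lambda>(\<xi>1, \<xi>2, \<xi>3). fourier_x (\<lambda>x. u1 (t, x)) \<xi>1 * fourier_x (\<lambda>x. u2 (t, x)) \<xi>2
        * fourier_x (\<lambda>x. cnj (u3 (t, x))) \<xi>3"
  have "bij_betw ?h ?A ?S"
    by (rule bij_betw_byWitness[where f' = "\<lambda>(j, k, l). (j, k)"]) auto
  then have "(\<Sum>\<^sub>\<infinity>s\<in>?S. ?F s) = (\<Sum>\<^sub>\<infinity>q\<in>?A. ?F (?h q))"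
    by (rule infsum_reindex_bij_betw[symmetric])
  also have "\<dots> = (\<Sum>\<^sub>\<infinity>q. tri_term (coef u1) (coef u2) (coef u3) \<xi> q t)"
  proof (rule infsum_cong_neutral)
    fix q assume "q \<in> ?A \<inter> UNIV"
    then obtain j k where q: "q = (j, k)" "j \<noteq> \<xi>" "k \<noteq> \<xi>" by auto
    have "fourier_x (\<lambda>x. cnj (u3 (t, x))) (\<xi> - j - k) = cnj (coef u3 (j + k - \<xi>) t)"
      unfolding fourier_x_cnj coef_def by (simp add: algebra_simps)
    with q show "?F (?h q) = tri_term (coef u1) (coef u2) (coef u3) \<xi> q t"
      by (simp add: tri_term_def coef_def)
  qed (auto simp: tri_term_def)
  finally show ?thesis
    by (simp add: C1_coeff_def trilinear_def)
qed

text \<open>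
  Here \<open>C\<^sub>1\<close> reduces to coefficients. Since the families are \<open>schwartz\<close>, its smoothness and decay
  on test functions follow at once.
\<close>

lemma C1_eq_synth: "C1 u1 u2 u3 = synth (trilinear (coef u1) (coef u2) (coef u3))"
  by (simp add: C1_def synth_def C1_coeff_eq_trilinear)

lemma
  assumes "test_fun u1" "test_fun u2" "test_fun u3"
  shows test_fun_C1: "test_fun (C1 u1 u2 u3)"
    and coef_C1: "coef (C1 u1 u2 u3) = trilinear (coef u1) (coef u2) (coef u3)"
proof -
  have "schwartz (trilinear (coef u1) (coef u2) (coef u3))"
    by (intro schwartz_trilinear schwartz_coef assms)
  then show "test_fun (C1 u1 u2 u3)" "coef (C1 u1 u2 u3) = trilinear (coef u1) (coef u2) (coef u3)"
    by (simp_all add: C1_eq_synth test_fun_synth coef_synth)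
qed

section \<open>The completed spaces\<close>

lemma pre_norm_diff_eq:
  assumes "test_fun u" "test_fun v"
  shows "pre_norm r 0 s (\<lambda>p. u p - v p) = snorm (conj_exponent r) s (\<lambda>\<xi> t. coef u \<xi> t - coef v \<xi> t)"
  by (simp add: pre_norm_eq_snorm coef_diff[OF assms])

lemma pre_norm_nonneg: "0 \<le> pre_norm r 0 s u"
  by (simp add: pre_norm_eq_snorm)

lemma X_cauchy_test_fun: "u \<in> X_cauchy r s b \<Longrightarrow> test_fun (u n)"
  by (simp add: X_cauchy_def)

lemma X_equivD:
  assumes "(u, v) \<in> X_equiv r 0 s"
  shows "u \<in> X_cauchy r 0 s" "v \<in> X_cauchy r 0 s"
    "(\<lambda>n. pre_norm r 0 s (\<lambda>p. u n p - v n p)) \<longlonglongrightarrow> 0"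
  using assms by (auto simp: X_equiv_def)

lemma X_spaceE:
  assumes "U \<in> X_space r 0 s"
  obtains u where "u \<in> X_cauchy r 0 s" "U = X_equiv r 0 s `` {u}"
  using assms unfolding X_space_def by (rule quotientE)

context
  fixes r :: real
  assumes r: "1 < r"
begin

private lemma p: "1 \<le> conj_exponent r"
  using r by (simp add: conj_exponent_def field_simps)

lemma pre_norm_triangle:
  assumes "test_fun u" "test_fun v" "test_fun w"
  shows "pre_norm r 0 s (\<lambda>x. u x - w x) \<le> pre_norm r 0 s (\<lambda>x. u x - v x) + pre_norm r 0 s (\<lambda>x. v x - w x)"
  unfolding pre_norm_diff_eq[OF assms(1,3)] pre_norm_diff_eq[OF assms(1,2)] pre_norm_diff_eq[OF assms(2,3)]
  by (intro snorm_diff_triangle p schwartz_coef assms)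

lemma pre_norm_commute:
  assumes "test_fun u" "test_fun v"
  shows "pre_norm r 0 s (\<lambda>x. u x - v x) = pre_norm r 0 s (\<lambda>x. v x - u x)"
  unfolding pre_norm_diff_eq[OF assms] pre_norm_diff_eq[OF assms(2,1)]
  by (intro snorm_diff_commute schwartz_coef assms)

lemma pre_norm_self:
  assumes "test_fun u"
  shows "pre_norm r 0 s (\<lambda>x. u x - u x) = 0"
  unfolding pre_norm_diff_eq[OF assms assms] by (rule snorm_diff_self[OF p])

lemma abs_pre_norm_diff_le:
  assumes "test_fun u" "test_fun v"
  shows "\<bar>pre_norm r 0 s u - pre_norm r 0 s v\<bar> \<le> pre_norm r 0 s (\<lambda>x. u x - v x)"
  unfolding pre_norm_diff_eq[OF assms] pre_norm_eq_snorm
  by (intro abs_snorm_diff_le p schwartz_coef assms)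

lemma X_equiv_refl: "u \<in> X_cauchy r 0 s \<Longrightarrow> (u, u) \<in> X_equiv r 0 s"
  by (simp only: X_equiv_def mem_Collect_eq prod.case pre_norm_self[OF X_cauchy_test_fun] tendsto_const simp_thms)

lemma X_equiv_sym:
  assumes "(u, v) \<in> X_equiv r 0 s"
  shows "(v, u) \<in> X_equiv r 0 s"
proof -
  note D = X_equivD[OF assms]
  have "pre_norm r 0 s (\<lambda>p. v n p - u n p) = pre_norm r 0 s (\<lambda>p. u n p - v n p)" for n
    by (intro pre_norm_commute X_cauchy_test_fun[OF D(1)] X_cauchy_test_fun[OF D(2)])
  with D show ?thesis by (simp add: X_equiv_def)
qed

lemma X_equiv_trans:
  assumes "(u, v) \<in> X_equiv r 0 s" "(v, w) \<in> X_equiv r 0 s"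
  shows "(u, w) \<in> X_equiv r 0 s"
proof -
  note D = X_equivD[OF assms(1)] and E = X_equivD[OF assms(2)]
  have "(\<lambda>n. pre_norm r 0 s (\<lambda>p. u n p - w n p)) \<longlonglongrightarrow> 0"
  proof (rule tendsto_sandwich[OF _ _ tendsto_const])
    show "(\<lambda>n. pre_norm r 0 s (\<lambda>p. u n p - v n p) + pre_norm r 0 s (\<lambda>p. v n p - w n p)) \<longlonglongrightarrow> 0"
      using tendsto_add[OF D(3) E(3)] by simp
    show "\<forall>\<^sub>F n in sequentially. pre_norm r 0 s (\<lambda>p. u n p - w n p)
        \<le> pre_norm r 0 s (\<lambda>p. u n p - v n p) + pre_norm r 0 s (\<lambda>p. v n p - w n p)"
      by (intro always_eventually allI pre_norm_triangle X_cauchy_test_fun[OF D(1)] X_cauchy_test_fun[OF D(2)] X_cauchy_test_fun[OF E(2)])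
  qed (simp add: pre_norm_nonneg)
  with D E show ?thesis by (simp add: X_equiv_def)
qed

lemma X_cauchy_pre_norm_convergent:
  assumes "u \<in> X_cauchy r 0 s"
  shows "convergent (\<lambda>n. pre_norm r 0 s (u n))"
proof (rule Cauchy_convergent, rule metric_CauchyI)
  fix e :: real assume "0 < e"
  then obtain N where N: "\<And>m n. m \<ge> N \<Longrightarrow> n \<ge> N \<Longrightarrow> pre_norm r 0 s (\<lambda>p. u m p - u n p) < e"
    using assms unfolding X_cauchy_def by blast
  have "dist (pre_norm r 0 s (u m)) (pre_norm r 0 s (u n)) < e" if "m \<ge> N" "n \<ge> N" for m n
    using abs_pre_norm_diff_le[OF X_cauchy_test_fun[OF assms] X_cauchy_test_fun[OF assms], of s m n] N[OF that]
    by (simp add: dist_real_def)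
  then show "\<exists>M. \<forall>m\<ge>M. \<forall>n\<ge>M. dist (pre_norm r 0 s (u m)) (pre_norm r 0 s (u n)) < e" by blast
qed

text \<open>
  The description in \<open>X_norm\<close> is proper: the norms converge along one representing sequence
  because it is Cauchy, and all representing sequences have the same limit.
\<close>

lemma X_norm_class:
  assumes u: "u \<in> X_cauchy r 0 s"
  shows "(\<lambda>n. pre_norm r 0 s (u n)) \<longlonglongrightarrow> X_norm r 0 s (X_equiv r 0 s `` {u})"
proof -
  obtain l where l: "(\<lambda>n. pre_norm r 0 s (u n)) \<longlonglongrightarrow> l"
    using X_cauchy_pre_norm_convergent[OF u] by (auto simp: convergent_def)
  have "(\<lambda>n. pre_norm r 0 s (v n)) \<longlonglongrightarrow> l" if "(u, v) \<in> X_equiv r 0 s" for v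
  proof -
    note D = X_equivD[OF that]
    have "(\<lambda>n. pre_norm r 0 s (u n) - pre_norm r 0 s (v n)) \<longlonglongrightarrow> 0"
    proof (rule Lim_null_comparison[OF _ D(3)])
      show "\<forall>\<^sub>F n in sequentially. norm (pre_norm r 0 s (u n) - pre_norm r 0 s (v n)) \<le> pre_norm r 0 s (\<lambda>p. u n p - v n p)"
        using abs_pre_norm_diff_le[OF X_cauchy_test_fun[OF D(1)] X_cauchy_test_fun[OF D(2)]]
        by (intro always_eventually allI) simp
    qed
    from tendsto_diff[OF l this] show ?thesis by simp
  qed
  then have "X_norm r 0 s (X_equiv r 0 s `` {u}) = l"
    unfolding X_norm_def
  proof (intro the_equality)
    fix l' assume "\<forall>v\<in>X_equiv r 0 s `` {u}. (\<lambda>n. pre_norm r 0 s (v n)) \<longlonglongrightarrow> l'"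
    then have "(\<lambda>n. pre_norm r 0 s (u n)) \<longlonglongrightarrow> l'" using X_equiv_refl[OF u] by blast
    then show "l' = l" using l LIMSEQ_unique by blast
  qed auto
  with l show ?thesis by simp
qed

lemma X_cauchy_pre_norm_bounded:
  assumes "u \<in> X_cauchy r 0 s"
  obtains B where "0 \<le> B" "\<And>n. pre_norm r 0 s (u n) \<le> B"
proof -
  have "Bseq (\<lambda>n. pre_norm r 0 s (u n))"
    by (rule convergent_imp_Bseq[OF X_cauchy_pre_norm_convergent[OF assms]])
  then obtain B where "0 < B" "\<And>n. norm (pre_norm r 0 s (u n)) \<le> B"
    by (auto elim: BseqE)
  then show ?thesis by (intro that[of B]) (auto simp: abs_le_iff)
qed

text \<open>
  Telescoping in the three arguments. This Lipschitz bound on bounded sets yields both that images of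
  Cauchy sequences are Cauchy and that the limit does not depend on the representing sequences.
\<close>

lemma pre_norm_C1_diff_le:
  assumes C: "0 \<le> C" "\<And>a1 a2 a3. schwartz a1 \<Longrightarrow> schwartz a2 \<Longrightarrow> schwartz a3 \<Longrightarrow>
      snorm (conj_exponent r) s' (trilinear a1 a2 a3)
        \<le> C * (snorm (conj_exponent r) s a1 * snorm (conj_exponent r) s a2 * snorm (conj_exponent r) s a3)"
    and u: "test_fun u1" "test_fun u2" "test_fun u3" and v: "test_fun v1" "test_fun v2" "test_fun v3"
    and B: "pre_norm r 0 s u2 \<le> B" "pre_norm r 0 s u3 \<le> B" "pre_norm r 0 s v1 \<le> B" "pre_norm r 0 s v2 \<le> B"
  shows "pre_norm r 0 s' (\<lambda>p. C1 u1 u2 u3 p - C1 v1 v2 v3 p)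
    \<le> C * B\<^sup>2 * (pre_norm r 0 s (\<lambda>p. u1 p - v1 p) + pre_norm r 0 s (\<lambda>p. u2 p - v2 p) + pre_norm r 0 s (\<lambda>p. u3 p - v3 p))"
proof -
  let ?q = "conj_exponent r"
  define a1 a2 a3 b1 b2 b3 where "a1 = coef u1" and "a2 = coef u2" and "a3 = coef u3"
    and "b1 = coef v1" and "b2 = coef v2" and "b3 = coef v3"
  note defs = a1_def a2_def a3_def b1_def b2_def b3_def
  have a: "schwartz a1" "schwartz a2" "schwartz a3" and b: "schwartz b1" "schwartz b2" "schwartz b3"
    unfolding defs by (intro schwartz_coef u v)+
  note tri = schwartz_trilinear
  define d1 d2 d3 where "d1 = snorm ?q s (\<lambda>\<xi> t. a1 \<xi> t - b1 \<xi> t)" and "d2 = snorm ?q s (\<lambda>\<xi> t. a2 \<xi> t - b2 \<xi> t)"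
    and "d3 = snorm ?q s (\<lambda>\<xi> t. a3 \<xi> t - b3 \<xi> t)"
  have d: "0 \<le> d1" "0 \<le> d2" "0 \<le> d3" by (simp_all add: d1_def d2_def d3_def)
  have nB: "snorm ?q s a2 \<le> B" "snorm ?q s a3 \<le> B" "snorm ?q s b1 \<le> B" "snorm ?q s b2 \<le> B"
    using B by (simp_all add: pre_norm_eq_snorm defs)
  have B0: "0 \<le> B" by (rule order.trans[OF snorm_nonneg nB(1)])
  have e1: "snorm ?q s' (\<lambda>\<xi> t. trilinear a1 a2 a3 \<xi> t - trilinear b1 a2 a3 \<xi> t) \<le> C * B\<^sup>2 * d1"
  proof -
    have "snorm ?q s' (\<lambda>\<xi> t. trilinear a1 a2 a3 \<xi> t - trilinear b1 a2 a3 \<xi> t) \<le> C * (d1 * snorm ?q s a2 * snorm ?q s a3)"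
      unfolding trilinear_diff(1)[OF a[THEN schwartz_rapid] b[THEN schwartz_rapid], symmetric] d1_def
      by (intro C schwartz_diff a b)
    also have "\<dots> \<le> C * (d1 * B * B)"
      using C(1) d B0 by (intro mult_left_mono mult_mono nB mult_nonneg_nonneg) auto
    finally show ?thesis by (simp add: power2_eq_square mult_ac)
  qed
  have e2: "snorm ?q s' (\<lambda>\<xi> t. trilinear b1 a2 a3 \<xi> t - trilinear b1 b2 a3 \<xi> t) \<le> C * B\<^sup>2 * d2"
  proof -
    have "snorm ?q s' (\<lambda>\<xi> t. trilinear b1 a2 a3 \<xi> t - trilinear b1 b2 a3 \<xi> t) \<le> C * (snorm ?q s b1 * d2 * snorm ?q s a3)"
      unfolding trilinear_diff(2)[OF a[THEN schwartz_rapid] b[THEN schwartz_rapid], symmetric] d2_def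
      by (intro C schwartz_diff a b)
    also have "\<dots> \<le> C * (B * d2 * B)"
      using C(1) d B0 by (intro mult_left_mono mult_mono nB mult_nonneg_nonneg) auto
    finally show ?thesis by (simp add: power2_eq_square mult_ac)
  qed
  have e3: "snorm ?q s' (\<lambda>\<xi> t. trilinear b1 b2 a3 \<xi> t - trilinear b1 b2 b3 \<xi> t) \<le> C * B\<^sup>2 * d3"
  proof -
    have "snorm ?q s' (\<lambda>\<xi> t. trilinear b1 b2 a3 \<xi> t - trilinear b1 b2 b3 \<xi> t) \<le> C * (snorm ?q s b1 * snorm ?q s b2 * d3)"
      unfolding trilinear_diff(3)[OF a[THEN schwartz_rapid] b[THEN schwartz_rapid], symmetric] d3_def
      by (intro C schwartz_diff a b)
    also have "\<dots> \<le> C * (B * B * d3)"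
      using C(1) d B0 by (intro mult_left_mono mult_mono nB mult_nonneg_nonneg) auto
    finally show ?thesis by (simp add: power2_eq_square mult_ac)
  qed
  have "snorm ?q s' (\<lambda>\<xi> t. trilinear a1 a2 a3 \<xi> t - trilinear b1 b2 b3 \<xi> t)
      \<le> snorm ?q s' (\<lambda>\<xi> t. trilinear a1 a2 a3 \<xi> t - trilinear b1 a2 a3 \<xi> t)
        + snorm ?q s' (\<lambda>\<xi> t. trilinear b1 a2 a3 \<xi> t - trilinear b1 b2 b3 \<xi> t)"
    by (intro snorm_diff_triangle p tri a b)
  also have "snorm ?q s' (\<lambda>\<xi> t. trilinear b1 a2 a3 \<xi> t - trilinear b1 b2 b3 \<xi> t)
      \<le> snorm ?q s' (\<lambda>\<xi> t. trilinear b1 a2 a3 \<xi> t - trilinear b1 b2 a3 \<xi> t)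
        + snorm ?q s' (\<lambda>\<xi> t. trilinear b1 b2 a3 \<xi> t - trilinear b1 b2 b3 \<xi> t)"
    by (intro snorm_diff_triangle p tri a b)
  finally have "snorm ?q s' (\<lambda>\<xi> t. trilinear a1 a2 a3 \<xi> t - trilinear b1 b2 b3 \<xi> t) \<le> C * B\<^sup>2 * d1 + (C * B\<^sup>2 * d2 + C * B\<^sup>2 * d3)"
    using e1 e2 e3 by linarith
  then show ?thesis
    unfolding pre_norm_diff_eq[OF test_fun_C1[OF u] test_fun_C1[OF v]] coef_C1[OF u] coef_C1[OF v]
      pre_norm_diff_eq[OF u(1) v(1)] pre_norm_diff_eq[OF u(2) v(2)] pre_norm_diff_eq[OF u(3) v(3)]
    by (simp add: defs d1_def d2_def d3_def distrib_left)
qed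

end

theorem proposition1p3:
  fixes r \<epsilon> b :: real
  assumes "r > 1" and "\<epsilon> > 0" and "b > 1 / r"
  shows "\<exists>C::real. \<forall>U1 \<in> X_space r 0 b. \<forall>U2 \<in> X_space r 0 b. \<forall>U3 \<in> X_space r 0 b.
           C1_ext r 0 (- \<epsilon>) U1 U2 U3 \<in> X_space r 0 (- \<epsilon>) \<and>
           X_norm r 0 (- \<epsilon>) (C1_ext r 0 (- \<epsilon>) U1 U2 U3)
             \<le> C * (X_norm r 0 b U1 * X_norm r 0 b U2 * X_norm r 0 b U3)"
proof -
  note r = assms(1)
  let ?q = "conj_exponent r" and ?s = "- \<epsilon>"
  from snorm_trilinear_estimate[OF assms] show ?thesis
  proof (elim exE conjE, intro exI ballI)
    fix C :: real and U1 U2 U3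
    assume C0: "0 \<le> C" and C: "\<forall>a1 a2 a3. schwartz a1 \<longrightarrow> schwartz a2 \<longrightarrow> schwartz a3 \<longrightarrow>
      snorm ?q ?s (trilinear a1 a2 a3) \<le> C * (snorm ?q b a1 * snorm ?q b a2 * snorm ?q b a3)"
      and U: "U1 \<in> X_space r 0 b" "U2 \<in> X_space r 0 b" "U3 \<in> X_space r 0 b"
    note diff_le = pre_norm_C1_diff_le[OF r C0 C[rule_format]]
    note test = X_cauchy_test_fun
    obtain u1 where u1: "u1 \<in> X_cauchy r 0 b" "U1 = X_equiv r 0 b `` {u1}" using X_spaceE[OF U(1)] .
    obtain u2 where u2: "u2 \<in> X_cauchy r 0 b" "U2 = X_equiv r 0 b `` {u2}" using X_spaceE[OF U(2)] .
    obtain u3 where u3: "u3 \<in> X_cauchy r 0 b" "U3 = X_equiv r 0 b `` {u3}" using X_spaceE[OF U(3)] .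
    have cauchy: "(\<lambda>n. C1 (v1 n) (v2 n) (v3 n)) \<in> X_cauchy r 0 ?s"
      if v: "v1 \<in> X_cauchy r 0 b" "v2 \<in> X_cauchy r 0 b" "v3 \<in> X_cauchy r 0 b" for v1 v2 v3
    proof -
      obtain B1 where B1: "0 \<le> B1" "\<And>n. pre_norm r 0 b (v1 n) \<le> B1" by (rule X_cauchy_pre_norm_bounded[OF r v(1)]) blast
      obtain B2 where B2: "0 \<le> B2" "\<And>n. pre_norm r 0 b (v2 n) \<le> B2" by (rule X_cauchy_pre_norm_bounded[OF r v(2)]) blast
      obtain B3 where B3: "0 \<le> B3" "\<And>n. pre_norm r 0 b (v3 n) \<le> B3" by (rule X_cauchy_pre_norm_bounded[OF r v(3)]) blast
      define B where "B = B1 + B2 + B3"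
      have bd: "pre_norm r 0 b (v1 n) \<le> B" "pre_norm r 0 b (v2 n) \<le> B" "pre_norm r 0 b (v3 n) \<le> B" for n
        using B1(1) B1(2)[of n] B2(1) B2(2)[of n] B3(1) B3(2)[of n] by (simp_all add: B_def)
      define K where "K = C * B\<^sup>2"
      have K: "0 \<le> K" using C0 by (simp add: K_def)
      have "\<exists>N. \<forall>m\<ge>N. \<forall>n\<ge>N. pre_norm r 0 ?s (\<lambda>p. C1 (v1 m) (v2 m) (v3 m) p - C1 (v1 n) (v2 n) (v3 n) p) < e"
        if e: "0 < e" for e
      proof -
        \<comment> \<open>\<open>K\<close> may be \<open>0\<close>, hence the \<open>1\<close>\<close>
        define d where "d = e / (3 * (K + 1))"
        have d: "0 < d" using e K by (simp add: d_def)
        obtain N1 where N1: "\<And>m n. m \<ge> N1 \<Longrightarrow> n \<ge> N1 \<Longrightarrow> pre_norm r 0 b (\<lambda>p. v1 m p - v1 n p) < d"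
          using v(1) d unfolding X_cauchy_def by blast
        obtain N2 where N2: "\<And>m n. m \<ge> N2 \<Longrightarrow> n \<ge> N2 \<Longrightarrow> pre_norm r 0 b (\<lambda>p. v2 m p - v2 n p) < d"
          using v(2) d unfolding X_cauchy_def by blast
        obtain N3 where N3: "\<And>m n. m \<ge> N3 \<Longrightarrow> n \<ge> N3 \<Longrightarrow> pre_norm r 0 b (\<lambda>p. v3 m p - v3 n p) < d"
          using v(3) d unfolding X_cauchy_def by blast
        have "pre_norm r 0 ?s (\<lambda>p. C1 (v1 m) (v2 m) (v3 m) p - C1 (v1 n) (v2 n) (v3 n) p) < e"
          if mn: "m \<ge> N1 + N2 + N3" "n \<ge> N1 + N2 + N3" for m n
        proof -
          have "pre_norm r 0 ?s (\<lambda>p. C1 (v1 m) (v2 m) (v3 m) p - C1 (v1 n) (v2 n) (v3 n) p)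
              \<le> C * B\<^sup>2 * (pre_norm r 0 b (\<lambda>p. v1 m p - v1 n p) + pre_norm r 0 b (\<lambda>p. v2 m p - v2 n p) + pre_norm r 0 b (\<lambda>p. v3 m p - v3 n p))"
            by (intro diff_le test[OF v(1)] test[OF v(2)] test[OF v(3)] bd)
          also have "\<dots> \<le> K * (d + d + d)"
            unfolding K_def[symmetric] using mn
            by (intro mult_left_mono add_mono less_imp_le[OF N1] less_imp_le[OF N2] less_imp_le[OF N3] K) auto
          also have "\<dots> < (K + 1) * (d + d + d)"
            using d by (intro mult_strict_right_mono) auto
          also have "\<dots> = d * (3 * (K + 1))" by (simp add: algebra_simps)
          also have "\<dots> = e" using K by (simp add: d_def)
          finally show ?thesis .
        qed
        then show ?thesis by blast
      qed
      then show ?thesis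
        unfolding X_cauchy_def by (simp add: test_fun_C1 test[OF v(1)] test[OF v(2)] test[OF v(3)])
    qed
    define w where "w n = C1 (u1 n) (u2 n) (u3 n)" for n
    have w: "w \<in> X_cauchy r 0 ?s"
      unfolding w_def[abs_def] by (rule cauchy[OF u1(1) u2(1) u3(1)])
    have indep: "((\<lambda>n. C1 (v1 n) (v2 n) (v3 n)), w) \<in> X_equiv r 0 ?s"
      if v: "(u1, v1) \<in> X_equiv r 0 b" "(u2, v2) \<in> X_equiv r 0 b" "(u3, v3) \<in> X_equiv r 0 b" for v1 v2 v3
    proof -
      note v1 = X_equivD[OF X_equiv_sym[OF r v(1)]] and v2 = X_equivD[OF X_equiv_sym[OF r v(2)]]
        and v3 = X_equivD[OF X_equiv_sym[OF r v(3)]]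
      obtain B1 where B1: "0 \<le> B1" "\<And>n. pre_norm r 0 b (u1 n) \<le> B1" by (rule X_cauchy_pre_norm_bounded[OF r u1(1)]) blast
      obtain B2 where B2: "0 \<le> B2" "\<And>n. pre_norm r 0 b (u2 n) \<le> B2" by (rule X_cauchy_pre_norm_bounded[OF r u2(1)]) blast
      obtain B3 where B3: "0 \<le> B3" "\<And>n. pre_norm r 0 b (v2 n) \<le> B3" by (rule X_cauchy_pre_norm_bounded[OF r v2(1)]) blast
      obtain B4 where B4: "0 \<le> B4" "\<And>n. pre_norm r 0 b (v3 n) \<le> B4" by (rule X_cauchy_pre_norm_bounded[OF r v3(1)]) blast
      define B where "B = B1 + B2 + B3 + B4"
      have bd: "pre_norm r 0 b (u1 n) \<le> B" "pre_norm r 0 b (u2 n) \<le> B" "pre_norm r 0 b (v2 n) \<le> B" "pre_norm r 0 b (v3 n) \<le> B" for n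
        using B1(1) B1(2)[of n] B2(1) B2(2)[of n] B3(1) B3(2)[of n] B4(1) B4(2)[of n] by (simp_all add: B_def)
      have "(\<lambda>n. pre_norm r 0 ?s (\<lambda>p. C1 (v1 n) (v2 n) (v3 n) p - w n p)) \<longlonglongrightarrow> 0"
      proof (rule tendsto_sandwich[OF _ _ tendsto_const])
        let ?R = "\<lambda>n. C * B\<^sup>2 * (pre_norm r 0 b (\<lambda>p. v1 n p - u1 n p) + pre_norm r 0 b (\<lambda>p. v2 n p - u2 n p) + pre_norm r 0 b (\<lambda>p. v3 n p - u3 n p))"
        have "?R \<longlonglongrightarrow> C * B\<^sup>2 * (0 + 0 + 0)"
          by (intro tendsto_intros v1(3) v2(3) v3(3))
        then show "?R \<longlonglongrightarrow> 0" by simp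
        show "\<forall>\<^sub>F n in sequentially. pre_norm r 0 ?s (\<lambda>p. C1 (v1 n) (v2 n) (v3 n) p - w n p) \<le> ?R n"
          unfolding w_def
          by (intro always_eventually allI diff_le test[OF v1(1)] test[OF v2(1)] test[OF v3(1)] test[OF u1(1)] test[OF u2(1)] test[OF u3(1)] bd)
      qed (simp add: pre_norm_nonneg)
      then show ?thesis
        using cauchy[OF v1(1) v2(1) v3(1)] w by (simp add: X_equiv_def)
    qed
    \<comment> \<open>by independence of the representatives, the extension is the class of the image of one choice\<close>
    have ext: "C1_ext r 0 ?s U1 U2 U3 = X_equiv r 0 ?s `` {w}"
    proof (intro set_eqI iffI)
      fix z assume "z \<in> C1_ext r 0 ?s U1 U2 U3"
      then show "z \<in> X_equiv r 0 ?s `` {w}"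
        using X_equiv_refl[OF r u1(1)] X_equiv_refl[OF r u2(1)] X_equiv_refl[OF r u3(1)]
        by (auto simp: C1_ext_def u1(2) u2(2) u3(2) w_def[abs_def])
    next
      fix z assume "z \<in> X_equiv r 0 ?s `` {w}"
      then have wz: "(w, z) \<in> X_equiv r 0 ?s" by simp
      show "z \<in> C1_ext r 0 ?s U1 U2 U3"
        unfolding C1_ext_def u1(2) u2(2) u3(2)
        using X_equiv_trans[OF r indep wz] by blast
    qed
    have "X_equiv r 0 ?s `` {w} \<in> X_space r 0 ?s"
      unfolding X_space_def using w by (rule quotientI)
    moreover have "X_norm r 0 ?s (X_equiv r 0 ?s `` {w}) \<le> C * (X_norm r 0 b U1 * X_norm r 0 b U2 * X_norm r 0 b U3)"
    proof (rule LIMSEQ_le[OF X_norm_class[OF r w]])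
      show "(\<lambda>n. C * (pre_norm r 0 b (u1 n) * pre_norm r 0 b (u2 n) * pre_norm r 0 b (u3 n)))
          \<longlonglongrightarrow> C * (X_norm r 0 b U1 * X_norm r 0 b U2 * X_norm r 0 b U3)"
        unfolding u1(2) u2(2) u3(2)
        by (intro tendsto_mult tendsto_const X_norm_class[OF r] u1(1) u2(1) u3(1))
      have "pre_norm r 0 ?s (w n) \<le> C * (pre_norm r 0 b (u1 n) * pre_norm r 0 b (u2 n) * pre_norm r 0 b (u3 n))" for n
        unfolding w_def pre_norm_eq_snorm coef_C1[OF test[OF u1(1)] test[OF u2(1)] test[OF u3(1)]]
        by (intro C[rule_format] schwartz_coef test[OF u1(1)] test[OF u2(1)] test[OF u3(1)])
      then show "\<exists>N. \<forall>n\<ge>N. pre_norm r 0 ?s (w n) \<le> C * (pre_norm r 0 b (u1 n) * pre_norm r 0 b (u2 n) * pre_norm r 0 b (u3 n))"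
        by blast
    qed
    ultimately show "C1_ext r 0 ?s U1 U2 U3 \<in> X_space r 0 ?s \<and>
        X_norm r 0 ?s (C1_ext r 0 ?s U1 U2 U3) \<le> C * (X_norm r 0 b U1 * X_norm r 0 b U2 * X_norm r 0 b U3)"
      unfolding ext by blast
  qed
qed

end
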